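(* Suppose that for $i=1,2$, $V_i\in L^\infty_{\rm loc}(\mathbb{R}^2)$, $\lim_{|x|\to\infty}V_i(x)=\infty$ and $\inf_{\mathbb{R}^2}V_i=0$. Then there exists $\delta>0$ such that for all $b_1,b_2,\beta>0$ with $|(b_1,b_2,\beta)|<\delta$, the problem $\hat e(b_1,b_2,\beta)$ admits a unique non-negative minimizer.
   Context: For $i=1,2$, $\mathcal{H}_i=\{u\in H^1(\mathbb{R}^2):\int V_i|u|^2dx<\infty\}$; $\mathcal{X}=\mathcal{H}_1\times\mathcal{H}_2$; $\mathcal{M}=\{(u_1,u_2)\in\mathcal{X}:\|u_1\|_2=\|u_2\|_2=1\}$. $E_{b_1,b_2,\beta}(u_1,u_2)=\sum_{i=1}^2\int_{\mathbb{R}^2}(|\nabla u_i|^2+V_i|u_i|^2-\frac{b_i}{2}|u_i|^4)dx-\beta\int_{\mathbb{R}^2}|u_1|^2|u_2|^2dx$ and $\hat e(b_1,b_2,\beta)=\inf_{\mathcal{M}}E_{b_1,b_2,\beta}$. A non-negative minimizer is a pair $(u_1,u_2)\in\mathcal{M}$ with $u_1,u_2\ge0$ attaining the infimum. $|(b_1,b_2,\beta)|$ is the Euclidean norm in $\mathbb{R}^3$. *)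

theory Defs
  imports "HOL-Analysis.Analysis"
begin

type_synonym R2 = "real ^ 2"

definition test_fun :: "(R2 \<Rightarrow> real) \<Rightarrow> (R2 \<Rightarrow> R2 \<Rightarrow> real) \<Rightarrow> bool" where
  "test_fun \<phi> D \<longleftrightarrow>
     (\<forall>x. (\<phi> has_derivative D x) (at x)) \<and>
     (\<forall>j. continuous_on UNIV (\<lambda>x. D x (axis j 1))) \<and>
     (\<exists>K. compact K \<and> (\<forall>x. x \<notin> K \<longrightarrow> \<phi> x = 0))"

definition weak_grad :: "(R2 \<Rightarrow> real) \<Rightarrow> (R2 \<Rightarrow> R2) \<Rightarrow> bool" where
  "weak_grad u g \<longleftrightarrow>
     g \<in> borel_measurable lborel \<and>
     (\<forall>\<phi> D. test_fun \<phi> D \<longrightarrow> (\<forall>j.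
        (\<integral>x. u x * D x (axis j 1) \<partial>lborel) = - (\<integral>x. g x $ j * \<phi> x \<partial>lborel)))"

definition wgrad :: "(R2 \<Rightarrow> real) \<Rightarrow> R2 \<Rightarrow> R2" where
  "wgrad u = (SOME g. weak_grad u g \<and> integrable lborel (\<lambda>x. (norm (g x))\<^sup>2))"

definition H1 :: "(R2 \<Rightarrow> real) set" where
  "H1 = {u. u \<in> borel_measurable lborel \<and> integrable lborel (\<lambda>x. (u x)\<^sup>2) \<and>
            (\<exists>g. weak_grad u g \<and> integrable lborel (\<lambda>x. (norm (g x))\<^sup>2))}"

definition Hspace :: "(R2 \<Rightarrow> real) \<Rightarrow> (R2 \<Rightarrow> real) set" where
  "Hspace V = {u \<in> H1. (\<integral>\<^sup>+ x. ennreal (V x * (u x)\<^sup>2) \<partial>lborel) < \<infinity>}"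

definition Mset :: "(R2 \<Rightarrow> real) \<Rightarrow> (R2 \<Rightarrow> real) \<Rightarrow> ((R2 \<Rightarrow> real) \<times> (R2 \<Rightarrow> real)) set" where
  "Mset V1 V2 = {(u1, u2). u1 \<in> Hspace V1 \<and> u2 \<in> Hspace V2 \<and>
      (\<integral>x. (u1 x)\<^sup>2 \<partial>lborel) = 1 \<and> (\<integral>x. (u2 x)\<^sup>2 \<partial>lborel) = 1}"

definition energy1 :: "(R2 \<Rightarrow> real) \<Rightarrow> real \<Rightarrow> (R2 \<Rightarrow> real) \<Rightarrow> real" where
  "energy1 V b u = (\<integral>x. (norm (wgrad u x))\<^sup>2 + V x * (u x)\<^sup>2 - b / 2 * (u x) ^ 4 \<partial>lborel)"

definition energy :: "(R2 \<Rightarrow> real) \<Rightarrow> (R2 \<Rightarrow> real) \<Rightarrow> real \<Rightarrow> real \<Rightarrow> real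
                       \<Rightarrow> (R2 \<Rightarrow> real) \<Rightarrow> (R2 \<Rightarrow> real) \<Rightarrow> real" where
  "energy V1 V2 b1 b2 \<beta> u1 u2 =
     energy1 V1 b1 u1 + energy1 V2 b2 u2 - \<beta> * (\<integral>x. (u1 x)\<^sup>2 * (u2 x)\<^sup>2 \<partial>lborel)"

definition nonneg_minimizer where
  "nonneg_minimizer V1 V2 b1 b2 \<beta> u1 u2 \<longleftrightarrow>
     (u1, u2) \<in> Mset V1 V2 \<and> (AE x in lborel. 0 \<le> u1 x) \<and> (AE x in lborel. 0 \<le> u2 x) \<and>
     (\<forall>(v1, v2) \<in> Mset V1 V2. energy V1 V2 b1 b2 \<beta> u1 u2 \<le> energy V1 V2 b1 b2 \<beta> v1 v2)"

definition Linf_loc :: "(R2 \<Rightarrow> real) \<Rightarrow> bool" where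
  "Linf_loc V \<longleftrightarrow> V \<in> borel_measurable lborel \<and>
     (\<forall>K. compact K \<longrightarrow> (\<exists>C. AE x in lborel. x \<in> K \<longrightarrow> \<bar>V x\<bar> \<le> C))"

end

theory Submission
  imports Defs "HOL-Complex_Analysis.Great_Picard"
begin

text \<open>
  Write \<open>Q(u) = \<integral> \<bar>\<nabla>u\<bar>\<^sup>2 + V u\<^sup>2\<close> for the quadratic part of the energy and \<open>\<lambda>\<close> for its infimum on
  the unit sphere of \<open>L\<^sup>2\<close>. Everything is decided by comparing two competitors \<open>u\<close>, \<open>v\<close> with their
  normalized midpoint \<open>m\<close>. With \<open>d = (u - v) / 2\<close> the parallelogram law gives
  \<open>Q(m) = q + (q \<parallel>d\<parallel>\<^sup>2 - Q(d)) / (1 - \<parallel>d\<parallel>\<^sup>2)\<close> where \<open>q = (Q(u) + Q(v)) / 2\<close>, and by Ladyzhenskaya's inequality the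
  quartic terms cost at most a multiple of \<open>\<delta> (\<parallel>d\<parallel>\<^sup>2 + Q(d))\<close>.

  Existence: a minimizing sequence is compact in \<open>L\<^sup>2\<close>, and the midpoint inequality upgrades this to
  convergence in the energy norm; no weak compactness is needed.

  Uniqueness: for small couplings both minimizers have \<open>Q\<close> close to \<open>\<lambda>\<close>, so their difference is almost
  orthogonal to the ground state and the spectral gap makes \<open>q \<parallel>d\<parallel>\<^sup>2 - Q(d)\<close> negative; hence \<open>m\<close>
  would have strictly smaller energy unless \<open>d = 0\<close>.

  The gap rests on the positivity of ground states. For a non-negative ground state \<open>v\<close> the weighted means
  \<open>\<tau>\<^sup>-\<^sup>3 \<integral> v(x) (\<tau> - \<bar>x - c\<bar>\<^sup>2)\<^sub>+\<^sup>2 dx\<close> are almost decreasing in \<open>\<tau>\<close>. Averaged over centres \<open>c\<close> in the zero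
  set of \<open>v\<close> they tend to \<open>0\<close> as \<open>\<tau> \<rightarrow> 0\<close>, so \<open>v\<close> vanishes identically if its zero set is not null.
\<close>

section \<open>Square-integrable functions\<close>

definition L2 :: "(R2 \<Rightarrow> real) set" where
  "L2 = {u. u \<in> borel_measurable lborel \<and> integrable lborel (\<lambda>x. (u x)\<^sup>2)}"

definition sqn :: "(R2 \<Rightarrow> real) \<Rightarrow> real" where
  "sqn u = (\<integral>x. (u x)\<^sup>2 \<partial>lborel)"

definition ip :: "(R2 \<Rightarrow> real) \<Rightarrow> (R2 \<Rightarrow> real) \<Rightarrow> real" where
  "ip u v = (\<integral>x. u x * v x \<partial>lborel)"

lemma L2D:
  assumes "u \<in> L2"
  shows "u \<in> borel_measurable borel" "integrable lborel (\<lambda>x. (u x)\<^sup>2)"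
  using assms by (auto simp: L2_def)

lemma L2I:
  "u \<in> borel_measurable borel \<Longrightarrow> integrable lborel (\<lambda>x. (u x)\<^sup>2) \<Longrightarrow> u \<in> L2"
  by (auto simp: L2_def)

lemma sqn_nonneg [simp]: "0 \<le> sqn u"
  by (simp add: sqn_def)

lemma abs_mult_le_sum_squares: "\<bar>a * b\<bar> \<le> a\<^sup>2 + (b::real)\<^sup>2"
  using sum_squares_bound[of "\<bar>a\<bar>" "\<bar>b\<bar>"] mult_nonneg_nonneg[OF abs_ge_zero[of a] abs_ge_zero[of b]]
  unfolding abs_mult power2_abs mult.assoc by linarith

lemma L2_mult_integrable:
  assumes "u \<in> L2" "v \<in> L2"
  shows "integrable lborel (\<lambda>x. u x * v x)"
proof (rule Bochner_Integration.integrable_bound)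
  show "integrable lborel (\<lambda>x. (u x)\<^sup>2 + (v x)\<^sup>2)"
    using assms by (auto dest: L2D)
  show "(\<lambda>x. u x * v x) \<in> borel_measurable lborel"
    using assms[THEN L2D(1)] by measurable
  show "AE x in lborel. norm (u x * v x) \<le> norm ((u x)\<^sup>2 + (v x)\<^sup>2)"
    using abs_mult_le_sum_squares by (intro AE_I2) simp
qed

lemma L2_lincomb:
  assumes "u \<in> L2" "v \<in> L2"
  shows "(\<lambda>x. a * u x + b * v x) \<in> L2"
proof (rule L2I)
  show "(\<lambda>x. a * u x + b * v x) \<in> borel_measurable borel"
    using assms[THEN L2D(1)] by measurable
  have "(\<lambda>x. (a * u x + b * v x)\<^sup>2) = (\<lambda>x. a\<^sup>2 * (u x)\<^sup>2 + 2 * a * b * (u x * v x) + b\<^sup>2 * (v x)\<^sup>2)"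
    by (auto simp: power2_eq_square algebra_simps)
  moreover have "integrable lborel (\<lambda>x. a\<^sup>2 * (u x)\<^sup>2 + 2 * a * b * (u x * v x) + b\<^sup>2 * (v x)\<^sup>2)"
    using L2D(2)[OF assms(1)] L2D(2)[OF assms(2)] L2_mult_integrable[OF assms] by simp
  ultimately show "integrable lborel (\<lambda>x. (a * u x + b * v x)\<^sup>2)" by simp
qed

lemma L2_zero [simp]: "(\<lambda>x. 0) \<in> L2"
  by (auto simp: L2_def)

lemma L2_scale: "u \<in> L2 \<Longrightarrow> (\<lambda>x. a * u x) \<in> L2"
  using L2_lincomb[of u u a 0] by simp

lemma L2_add: "u \<in> L2 \<Longrightarrow> v \<in> L2 \<Longrightarrow> (\<lambda>x. u x + v x) \<in> L2"
  using L2_lincomb[of u v 1 1] by simp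

lemma L2_diff: "u \<in> L2 \<Longrightarrow> v \<in> L2 \<Longrightarrow> (\<lambda>x. u x - v x) \<in> L2"
  using L2_lincomb[of u v 1 "-1"] by simp

lemma L2_abs: "u \<in> L2 \<Longrightarrow> (\<lambda>x. \<bar>u x\<bar>) \<in> L2"
  by (auto simp: L2_def)

lemma sqn_lincomb:
  assumes "u \<in> L2" "v \<in> L2"
  shows "sqn (\<lambda>x. a * u x + b * v x) = a\<^sup>2 * sqn u + 2 * a * b * ip u v + b\<^sup>2 * sqn v"
proof -
  have "(\<lambda>x. (a * u x + b * v x)\<^sup>2) = (\<lambda>x. a\<^sup>2 * (u x)\<^sup>2 + 2 * a * b * (u x * v x) + b\<^sup>2 * (v x)\<^sup>2)"
    by (auto simp: power2_eq_square algebra_simps)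
  then show ?thesis
    using assms L2_mult_integrable[OF assms] unfolding sqn_def ip_def
    by (simp add: L2D)
qed

lemma ip_self: "ip u u = sqn u"
  by (simp add: ip_def sqn_def power2_eq_square)

lemma ip_commute: "ip u v = ip v u"
  by (simp add: ip_def mult.commute)

lemma ip_lincomb_right:
  assumes "u \<in> L2" "v \<in> L2" "w \<in> L2"
  shows "ip w (\<lambda>x. a * u x + b * v x) = a * ip w u + b * ip w v"
proof -
  have "ip w (\<lambda>x. a * u x + b * v x) = (\<integral>x. a * (w x * u x) + b * (w x * v x) \<partial>lborel)"
    by (simp add: ip_def algebra_simps)
  also have "\<dots> = a * ip w u + b * ip w v"
    unfolding ip_def using assms by (simp add: L2_mult_integrable)
  finally show ?thesis .
qed

lemma sqn_scale: "sqn (\<lambda>x. a * u x) = a\<^sup>2 * sqn u"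
  by (simp add: sqn_def power_mult_distrib)

lemma sqn_add:
  "u \<in> L2 \<Longrightarrow> v \<in> L2 \<Longrightarrow> sqn (\<lambda>x. u x + v x) = sqn u + 2 * ip u v + sqn v"
  using sqn_lincomb[of u v 1 1] by simp

lemma sqn_diff:
  "u \<in> L2 \<Longrightarrow> v \<in> L2 \<Longrightarrow> sqn (\<lambda>x. u x - v x) = sqn u - 2 * ip u v + sqn v"
  using sqn_lincomb[of u v 1 "-1"] by simp

lemma sqn_minus_commute: "sqn (\<lambda>x. u x - v x) = sqn (\<lambda>x. v x - u x)"
  by (simp add: sqn_def power2_commute)

lemma sqn_parallelogram:
  "u \<in> L2 \<Longrightarrow> v \<in> L2 \<Longrightarrow>
    sqn (\<lambda>x. u x + v x) + sqn (\<lambda>x. u x - v x) = 2 * sqn u + 2 * sqn v"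
  by (simp add: sqn_add sqn_diff)

lemma sqn_add_le:
  "u \<in> L2 \<Longrightarrow> v \<in> L2 \<Longrightarrow> sqn (\<lambda>x. u x + v x) \<le> 2 * sqn u + 2 * sqn v"
  using sqn_parallelogram[of u v] sqn_nonneg[of "\<lambda>x. u x - v x"] by linarith

lemma sqn_eq_0:
  assumes "u \<in> L2" "sqn u = 0"
  shows "AE x in lborel. u x = 0"
  using assms integral_nonneg_eq_0_iff_AE[of lborel "\<lambda>x. (u x)\<^sup>2"] by (auto simp: sqn_def dest: L2D)

lemma sqn_cong_AE:
  assumes "u \<in> L2" "v \<in> L2" "AE x in lborel. u x = v x"
  shows "sqn u = sqn v"
  unfolding sqn_def using assms by (intro integral_cong_AE) (auto dest: L2D)

lemma quadratic_nonneg_discriminant: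
  fixes a b c :: real
  assumes nn: "\<And>t. 0 \<le> a + 2 * t * b + t\<^sup>2 * c" and c: "0 \<le> c"
  shows "b\<^sup>2 \<le> a * c"
proof (cases "c = 0")
  case True
  have "b = 0"
  proof (rule ccontr)
    assume "b \<noteq> 0"
    then have "a + 2 * (- (a + 1) / (2 * b)) * b = -1" by (simp add: field_simps)
    with nn[of "- (a + 1) / (2 * b)"] True show False by simp
  qed
  then show ?thesis using True by simp
next
  case False
  then have "c > 0" using c by simp
  have "a + 2 * (- b / c) * b + (- b / c)\<^sup>2 * c = a - b\<^sup>2 / c"
    using False by (simp add: field_simps power2_eq_square)
  then have "0 \<le> a - b\<^sup>2 / c" using nn[of "- b / c"] by simp
  then show ?thesis using \<open>c > 0\<close> by (simp add: field_simps)
qed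

lemma ip_Cauchy_Schwarz:
  assumes "u \<in> L2" "v \<in> L2"
  shows "(ip u v)\<^sup>2 \<le> sqn u * sqn v"
proof (rule quadratic_nonneg_discriminant)
  fix t
  show "0 \<le> sqn u + 2 * t * ip u v + t\<^sup>2 * sqn v"
    using sqn_lincomb[OF assms, of 1 t] sqn_nonneg[of "\<lambda>x. 1 * u x + t * v x"] by simp
qed simp

lemma abs_ip_le:
  assumes "u \<in> L2" "v \<in> L2"
  shows "\<bar>ip u v\<bar> \<le> sqrt (sqn u) * sqrt (sqn v)"
  using ip_Cauchy_Schwarz[OF assms] by (metis real_sqrt_abs real_sqrt_le_iff real_sqrt_mult)

lemma nn_integral_sq_eq_sqn:
  "u \<in> L2 \<Longrightarrow> (\<integral>\<^sup>+ x. ennreal ((u x)\<^sup>2) \<partial>lborel) = ennreal (sqn u)"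
  by (simp add: sqn_def nn_integral_eq_integral L2D)

lemma L2_sqn_le_nn_integral:
  assumes "u \<in> borel_measurable borel" "(\<integral>\<^sup>+ x. ennreal ((u x)\<^sup>2) \<partial>lborel) \<le> ennreal C" "0 \<le> C"
  shows "u \<in> L2" "sqn u \<le> C"
proof -
  have "(\<integral>\<^sup>+ x. ennreal (norm ((u x)\<^sup>2)) \<partial>lborel) < \<infinity>"
    using assms(2) by (simp add: order_le_less_trans)
  then have i: "integrable lborel (\<lambda>x. (u x)\<^sup>2)"
    using assms(1) by (intro integrableI_bounded) auto
  then show "u \<in> L2" using assms(1) by (intro L2I)
  then show "sqn u \<le> C" using assms by (simp add: nn_integral_sq_eq_sqn)
qed

lemma L2_complete:
  fixes u :: "nat \<Rightarrow> R2 \<Rightarrow> real"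
  assumes L: "\<And>n. u n \<in> L2"
    and C: "\<And>e. e > 0 \<Longrightarrow> \<exists>N. \<forall>m\<ge>N. \<forall>n\<ge>N. sqn (\<lambda>x. u m x - u n x) < e"
  obtains w r where "w \<in> L2" "(\<lambda>n. sqn (\<lambda>x. u n x - w x)) \<longlonglongrightarrow> 0"
    "strict_mono (r :: nat \<Rightarrow> nat)" "AE x in lborel. (\<lambda>k. u (r k) x) \<longlonglongrightarrow> w x"
proof -
  have [measurable]: "u n \<in> borel_measurable borel" for n using L by (rule L2D)
  have "\<exists>N. \<forall>k. \<forall>m\<ge>N k. \<forall>n\<ge>N k. sqn (\<lambda>x. u m x - u n x) < (1/8)^k"
    by (intro choice allI C) simp
  then obtain N where N: "\<And>k m n. m \<ge> N k \<Longrightarrow> n \<ge> N k \<Longrightarrow> sqn (\<lambda>x. u m x - u n x) < (1/8)^k"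
    by blast
  define r where "r k = k + (\<Sum>i\<le>k. N i)" for k
  have sm: "strict_mono r" by (rule strict_mono_Suc_iff[THEN iffD2]) (simp add: r_def)
  have rN: "r k \<ge> N k" for k
    using member_le_sum[of k "{..k}" N] by (simp add: r_def)
  have rN': "r (Suc k) \<ge> N k" for k
    using rN[of k] sm by (meson lessI less_imp_le order_trans strict_mono_less)
  define d where "d k x = 4^k * (u (r (Suc k)) x - u (r k) x)\<^sup>2" for k x
  have dm[measurable]: "d k \<in> borel_measurable borel" for k unfolding d_def by measurable
  have d_int: "(\<integral>\<^sup>+x. ennreal (d k x) \<partial>lborel) \<le> ennreal ((1/2)^k)" for k
  proof -
    have "(\<integral>\<^sup>+x. ennreal (d k x) \<partial>lborel) = ennreal (4^k) * (\<integral>\<^sup>+x. ennreal ((u (r (Suc k)) x - u (r k) x)\<^sup>2) \<partial>lborel)"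
      unfolding d_def by (subst nn_integral_cmult[symmetric]) (auto simp: ennreal_mult)
    also have "\<dots> = ennreal (4^k) * ennreal (sqn (\<lambda>x. u (r (Suc k)) x - u (r k) x))"
      by (subst nn_integral_sq_eq_sqn) (auto intro: L2_diff L)
    also have "\<dots> \<le> ennreal (4^k) * ennreal ((1/8)^k)"
      using N[OF rN' rN, of k] by (intro mult_left_mono) auto
    also have "\<dots> = ennreal ((1/2)^k)"
      by (simp add: ennreal_mult[symmetric] power_mult_distrib[symmetric])
    finally show ?thesis .
  qed
  have "(\<integral>\<^sup>+x. (\<Sum>k. ennreal (d k x)) \<partial>lborel) = (\<Sum>k. \<integral>\<^sup>+x. ennreal (d k x) \<partial>lborel)"
    by (rule nn_integral_suminf) simp
  also have "\<dots> \<le> (\<Sum>k. ennreal ((1/2)^k))"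
    by (intro suminf_le d_int) auto
  also have "\<dots> = ennreal (\<Sum>k. (1/2)^k)"
    by (rule suminf_ennreal2) (auto intro: summable_geometric)
  finally have fin: "(\<integral>\<^sup>+x. (\<Sum>k. ennreal (d k x)) \<partial>lborel) \<noteq> \<infinity>"
    by (auto simp: top_unique)
  have AEfin: "AE x in lborel. (\<Sum>k. ennreal (d k x)) \<noteq> \<infinity>"
    by (rule nn_integral_noteq_infinite[OF _ fin]) simp
  define w where "w x = lim (\<lambda>k. u (r k) x)" for x
  have conv: "AE x in lborel. (\<lambda>k. u (r k) x) \<longlonglongrightarrow> w x"
    using AEfin
  proof eventually_elim
    case (elim x)
    have d0: "0 \<le> d k x" for k by (simp add: d_def)
    have sd: "summable (\<lambda>k. d k x)"
      using elim d0 by (intro summable_suminf_not_top) auto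
    then obtain B where B: "\<And>k. norm (d k x) \<le> B"
      using summable_imp_Bseq[OF sd] unfolding Bseq_def by auto
    have B0: "0 \<le> B" using B[of 0] by (rule order_trans[OF norm_ge_zero])
    have "\<bar>u (r (Suc k)) x - u (r k) x\<bar> \<le> sqrt B * (1/2)^k" for k
    proof -
      have "\<bar>2^k * (u (r (Suc k)) x - u (r k) x)\<bar> \<le> sqrt B"
      proof (rule real_le_rsqrt)
        have "\<bar>2^k * (u (r (Suc k)) x - u (r k) x)\<bar>\<^sup>2 = d k x"
          by (simp add: d_def power_mult_distrib power_mult[symmetric] mult.commute[of k] power_mult)
        then show "\<bar>2^k * (u (r (Suc k)) x - u (r k) x)\<bar>\<^sup>2 \<le> B" using B[of k] d0[of k] by simp
      qed
      then have "2^k * \<bar>u (r (Suc k)) x - u (r k) x\<bar> \<le> sqrt B" by (simp add: abs_mult)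
      then have "(1/2)^k * (2^k * \<bar>u (r (Suc k)) x - u (r k) x\<bar>) \<le> (1/2)^k * sqrt B"
        by (rule mult_left_mono) simp
      then show ?thesis by (simp add: power_divide mult.commute)
    qed
    then have "summable (\<lambda>k. u (r (Suc k)) x - u (r k) x)"
      by (intro summable_comparison_test'[where g="\<lambda>k. sqrt B * (1/2)^k" and N=0, OF summable_mult[OF summable_geometric]]) auto
    then have "convergent (\<lambda>n. (u (r n) x - u (r 0) x))"
      by (simp add: summable_iff_convergent sum_lessThan_telescope[of "\<lambda>i. u (r i) x"])
    then have "convergent (\<lambda>k. u (r k) x)"
      using convergent_add[OF _ convergent_const[of "u (r 0) x"]] by fastforce
    then show ?case unfolding w_def by (simp add: convergent_LIMSEQ_iff)
  qed
  have wm[measurable]: "w \<in> borel_measurable borel"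
    unfolding w_def[abs_def] by measurable
  have bd: "(\<integral>\<^sup>+x. ennreal ((u n x - w x)\<^sup>2) \<partial>lborel) \<le> ennreal e"
    if e: "e > 0" and N: "\<And>m. m \<ge> N \<Longrightarrow> sqn (\<lambda>x. u n x - u m x) < e" for e n N
  proof -
    have "(\<integral>\<^sup>+x. ennreal ((u n x - w x)\<^sup>2) \<partial>lborel) = (\<integral>\<^sup>+x. liminf (\<lambda>k. ennreal ((u n x - u (r k) x)\<^sup>2)) \<partial>lborel)"
    proof (rule nn_integral_cong_AE)
      show "AE x in lborel. ennreal ((u n x - w x)\<^sup>2) = liminf (\<lambda>k. ennreal ((u n x - u (r k) x)\<^sup>2))"
        using conv
      proof eventually_elim
        case (elim x)
        have "(\<lambda>k. ennreal ((u n x - u (r k) x)\<^sup>2)) \<longlonglongrightarrow> ennreal ((u n x - w x)\<^sup>2)"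
          by (intro tendsto_intros elim)
        then show ?case by (rule lim_imp_Liminf[symmetric, rotated]) simp
      qed
    qed
    also have "\<dots> \<le> liminf (\<lambda>k. \<integral>\<^sup>+x. ennreal ((u n x - u (r k) x)\<^sup>2) \<partial>lborel)"
      by (rule nn_integral_liminf) simp
    also have "\<dots> = liminf (\<lambda>k. ennreal (sqn (\<lambda>x. u n x - u (r k) x)))"
      by (simp add: nn_integral_sq_eq_sqn L2_diff L)
    also have "\<dots> \<le> limsup (\<lambda>k. ennreal (sqn (\<lambda>x. u n x - u (r k) x)))"
      by (rule Liminf_le_Limsup) simp
    also have "\<dots> \<le> ennreal e"
    proof (rule Limsup_bounded)
      have "\<And>k. k \<ge> N \<Longrightarrow> r k \<ge> N" using seq_suble[OF sm] order_trans by blast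
      then show "\<forall>\<^sub>F k in sequentially. ennreal (sqn (\<lambda>x. u n x - u (r k) x)) \<le> ennreal e"
        using N e by (intro eventually_sequentiallyI[of N] ennreal_leI) (auto intro: less_imp_le)
    qed
    finally show ?thesis .
  qed
  have key: "\<exists>N. \<forall>n\<ge>N. (\<lambda>x. u n x - w x) \<in> L2 \<and> sqn (\<lambda>x. u n x - w x) \<le> e" if e: "e > 0" for e
  proof -
    obtain N where N: "\<And>m n. m \<ge> N \<Longrightarrow> n \<ge> N \<Longrightarrow> sqn (\<lambda>x. u m x - u n x) < e" using C[OF e] by blast
    show ?thesis
      using L2_sqn_le_nn_integral[OF _ bd[OF e N]] e by (intro exI[of _ N]) auto
  qed
  obtain n0 where "(\<lambda>x. u n0 x - w x) \<in> L2" using key[of 1] by auto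
  then have wL: "w \<in> L2" using L2_diff[OF L[of n0], of "\<lambda>x. u n0 x - w x"] by simp
  have lim: "(\<lambda>n. sqn (\<lambda>x. u n x - w x)) \<longlonglongrightarrow> 0"
  proof (rule LIMSEQ_I)
    fix e :: real assume "e > 0"
    then obtain N where "\<forall>n\<ge>N. sqn (\<lambda>x. u n x - w x) \<le> e / 2" using key[of "e/2"] by auto
    then show "\<exists>N. \<forall>n\<ge>N. norm (sqn (\<lambda>x. u n x - w x) - 0) < e"
      using \<open>e > 0\<close> by (intro exI[of _ N]) fastforce
  qed
  show ?thesis by (rule that[OF wL lim sm conv])
qed

lemma integrable_shift_iff:
  fixes f :: "R2 \<Rightarrow> real"
  shows "integrable lborel (\<lambda>x. f (x + h)) \<longleftrightarrow> integrable lborel f"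
proof -
  have "integrable lborel (\<lambda>x. f (x + h))" if f: "integrable lborel f" for f :: "R2 \<Rightarrow> real" and h
  proof -
    have "integrable (distr lborel borel ((+) h)) f" using f by (simp add: lborel_distr_plus)
    then have "integrable lborel (\<lambda>x. f (h + x))"
      using f by (subst (asm) integrable_distr_eq) (auto dest: borel_measurable_integrable)
    then show ?thesis by (simp add: add.commute)
  qed
  from this[of f h] this[of "\<lambda>x. f (x + h)" "-h"] show ?thesis by auto
qed

lemma nn_integral_shift:
  fixes f :: "R2 \<Rightarrow> ennreal"
  assumes "f \<in> borel_measurable borel"
  shows "(\<integral>\<^sup>+x. f (x + h) \<partial>lborel) = (\<integral>\<^sup>+x. f x \<partial>lborel)"
proof -
  have "(\<integral>\<^sup>+x. f x \<partial>lborel) = (\<integral>\<^sup>+x. f x \<partial>distr lborel borel ((+) h))"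
    by (simp add: lborel_distr_plus)
  also have "\<dots> = (\<integral>\<^sup>+x. f (h + x) \<partial>lborel)"
    using assms by (subst nn_integral_distr) auto
  finally show ?thesis by (simp add: add.commute)
qed

lemma integral_shift:
  fixes f :: "R2 \<Rightarrow> real"
  assumes "f \<in> borel_measurable borel"
  shows "(\<integral>x. f (x + h) \<partial>lborel) = (\<integral>x. f x \<partial>lborel)"
proof -
  have "(\<integral>x. f x \<partial>lborel) = (\<integral>x. f x \<partial>distr lborel borel ((+) h))"
    by (simp add: lborel_distr_plus)
  also have "\<dots> = (\<integral>x. f (h + x) \<partial>lborel)"
    using assms by (subst integral_distr) auto
  finally show ?thesis by (simp add: add.commute)
qed

lemma L2_shift: "u \<in> L2 \<Longrightarrow> (\<lambda>x. u (x + h)) \<in> L2"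
  using integrable_shift_iff[of "\<lambda>x. (u x)\<^sup>2" h] by (auto simp: L2_def)

lemma sqn_shift: "u \<in> L2 \<Longrightarrow> sqn (\<lambda>x. u (x + h)) = sqn u"
  unfolding sqn_def using integral_shift[of "\<lambda>x. (u x)\<^sup>2" h] by (auto dest: L2D)

section \<open>Test functions\<close>

lemma has_real_derivative_pos_part_power:
  fixes s :: real
  shows "((\<lambda>s. (max 0 s) ^ Suc (Suc k)) has_real_derivative real (Suc (Suc k)) * (max 0 s) ^ Suc k) (at s)"
proof -
  consider "s < 0" | "s > 0" | "s = 0" by linarith
  then show ?thesis
  proof cases
    case 1
    have "((\<lambda>s. 0::real) has_real_derivative 0) (at s)" by simp
    then have "((\<lambda>s. (max 0 s) ^ Suc (Suc k)) has_real_derivative 0) (at s)"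
      by (rule has_field_derivative_transform_within_open[of _ _ _ "{..<0}"]) (use 1 in auto)
    then show ?thesis using 1 by simp
  next
    case 2
    have "((\<lambda>s. s ^ Suc (Suc k)) has_real_derivative real (Suc (Suc k)) * s ^ Suc k) (at s)"
      using DERIV_pow[of "Suc (Suc k)" s] by simp
    then have "((\<lambda>s. (max 0 s) ^ Suc (Suc k)) has_real_derivative real (Suc (Suc k)) * s ^ Suc k) (at s)"
      by (rule has_field_derivative_transform_within_open[of _ _ _ "{0<..}"]) (use 2 in auto)
    then show ?thesis using 2 by simp
  next
    case 3
    have "((\<lambda>h. ((max 0 (0 + h)) ^ Suc (Suc k) - (max 0 0) ^ Suc (Suc k)) / h) \<longlongrightarrow> 0) (at (0::real))"
    proof (rule Lim_null_comparison[where g="\<lambda>h. \<bar>h\<bar> ^ Suc k"])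
      show "\<forall>\<^sub>F h in at (0::real). norm (((max 0 (0 + h)) ^ Suc (Suc k) - (max 0 0) ^ Suc (Suc k)) / h) \<le> \<bar>h\<bar> ^ Suc k"
        by (intro always_eventually allI) (auto simp: max_def abs_mult power_abs intro: mult_nonpos_nonneg)
      show "((\<lambda>h. \<bar>h\<bar> ^ Suc k) \<longlongrightarrow> 0) (at (0::real))"
        by (rule tendsto_eq_intros | simp)+
    qed
    then show ?thesis using 3 by (simp add: DERIV_def)
  qed
qed

definition C1c :: "(real \<Rightarrow> real) \<Rightarrow> (real \<Rightarrow> real) \<Rightarrow> bool" where
  "C1c a a' \<longleftrightarrow> (\<forall>s. (a has_real_derivative a' s) (at s)) \<and> continuous_on UNIV a' \<and>
     (\<exists>R. \<forall>s. R < \<bar>s\<bar> \<longrightarrow> a s = 0)"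

lemma C1c_continuous: "C1c a a' \<Longrightarrow> continuous_on UNIV a"
  unfolding C1c_def by (meson DERIV_continuous_on UNIV_I has_field_derivative_at_within)

lemma test_fun_prod:
  fixes a a' :: "2 \<Rightarrow> real \<Rightarrow> real"
  assumes "\<And>i. C1c (a i) (a' i)"
  shows "test_fun (\<lambda>x. \<Prod>i\<in>UNIV. a i (x $ i))
           (\<lambda>x y. \<Sum>i\<in>UNIV. (a' i (x $ i) * y $ i) * (\<Prod>j\<in>UNIV - {i}. a j (x $ j)))"
  unfolding test_fun_def
proof (intro conjI allI)
  fix x :: R2
  show "((\<lambda>x. \<Prod>i\<in>UNIV. a i (x $ i)) has_derivative
      (\<lambda>y. \<Sum>i\<in>UNIV. (a' i (x $ i) * y $ i) * (\<Prod>j\<in>UNIV - {i}. a j (x $ j)))) (at x)"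
  proof (rule has_derivative_prod)
    fix i :: 2
    have "(a i has_derivative (\<lambda>h. a' i (x $ i) * h)) (at (x $ i))"
      using assms[of i] by (auto simp: C1c_def has_field_derivative_def)
    then show "((\<lambda>x. a i (x $ i)) has_derivative (\<lambda>y. a' i (x $ i) * y $ i)) (at x)"
      using has_derivative_compose[of "\<lambda>x. x $ i" "\<lambda>y. y $ i" x UNIV "a i"]
      by (simp add: bounded_linear_imp_has_derivative bounded_linear_vec_nth)
  qed
next
  fix j :: 2
  have ca: "continuous_on UNIV (\<lambda>x::R2. a i (x $ i))" and ca': "continuous_on UNIV (\<lambda>x::R2. a' i (x $ i))" for i
    using C1c_continuous[OF assms[of i]] assms[of i] unfolding C1c_def
    by (auto intro!: continuous_on_compose2[of UNIV _ UNIV "\<lambda>x. x $ i"] continuous_intros)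
  show "continuous_on UNIV (\<lambda>x. \<Sum>i\<in>UNIV. (a' i (x $ i) * axis j 1 $ i) * (\<Prod>j\<in>UNIV - {i}. a j (x $ j)))"
    by (intro continuous_intros ca ca')
next
  have "\<exists>R. \<forall>i s. R i < \<bar>s\<bar> \<longrightarrow> a i s = 0"
    using assms by (intro choice) (auto simp: C1c_def)
  then obtain R where R: "\<And>i s. R i < \<bar>s\<bar> \<Longrightarrow> a i s = 0" by blast
  have "(\<Prod>i\<in>UNIV. a i (x $ i)) = 0" if x: "x \<notin> cbox (\<chi> i. - R i) (\<chi> i. R i)" for x :: R2
  proof -
    obtain i where "\<not> (- R i \<le> x $ i \<and> x $ i \<le> R i)" using x unfolding mem_box_cart by auto
    then have "R i < \<bar>x $ i\<bar>" by auto
    then have "a i (x $ i) = 0" by (rule R)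
    then show ?thesis by (intro prod_zero) auto
  qed
  then show "\<exists>K. compact K \<and> (\<forall>x. x \<notin> K \<longrightarrow> (\<Prod>i\<in>UNIV. a i (x $ i)) = 0)"
    by (intro exI[of _ "cbox (\<chi> i. - R i) (\<chi> i. R i)"]) auto
qed

lemma test_fun_prod_partial:
  fixes a a' :: "2 \<Rightarrow> real \<Rightarrow> real" and x :: R2
  shows "(\<Sum>i\<in>UNIV. (a' i (x $ i) * axis j 1 $ i) * (\<Prod>j\<in>UNIV - {i}. a j (x $ j)))
    = a' j (x $ j) * (\<Prod>i\<in>UNIV - {j}. a i (x $ i))"
  by (subst sum.remove[of _ j]) (auto simp: axis_def intro!: sum.neutral)

lemma continuous_compact_support_L2:
  fixes f :: "R2 \<Rightarrow> real"
  assumes c: "continuous_on UNIV f" and K: "compact K" and z: "\<And>x. x \<notin> K \<Longrightarrow> f x = 0"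
  shows "f \<in> L2"
proof (rule L2I)
  show "f \<in> borel_measurable borel" using c by (rule borel_measurable_continuous_onI)
  have "integrable lborel (\<lambda>x. indicator K x *\<^sub>R (f x)\<^sup>2)"
    using c by (intro borel_integrable_compact K continuous_intros) (auto intro: continuous_on_subset)
  moreover have "(\<lambda>x. indicator K x *\<^sub>R (f x)\<^sup>2) = (\<lambda>x. (f x)\<^sup>2)"
    using z by (fastforce simp: indicator_def)
  ultimately show "integrable lborel (\<lambda>x. (f x)\<^sup>2)" by simp
qed

lemma test_fun_continuous: "test_fun \<phi> D \<Longrightarrow> continuous_on UNIV \<phi>"
  unfolding test_fun_def by (meson has_derivative_continuous continuous_at_imp_continuous_on)

lemma test_fun_support:
  assumes "test_fun \<phi> D"
  obtains K where "compact K" "\<And>x. x \<notin> K \<Longrightarrow> \<phi> x = 0" "\<And>x y. x \<notin> K \<Longrightarrow> D x y = 0"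
proof -
  obtain K where K: "compact K" "\<And>x. x \<notin> K \<Longrightarrow> \<phi> x = 0" using assms unfolding test_fun_def by blast
  have "D x y = 0" if x: "x \<notin> K" for x y
  proof -
    have "(\<phi> has_derivative D x) (at x)" using assms unfolding test_fun_def by blast
    moreover have "(\<phi> has_derivative (\<lambda>_. 0)) (at x)"
    proof (rule has_derivative_transform_within_open[OF has_derivative_const])
      show "open (- K)" using K(1) by (simp add: compact_imp_closed open_Compl)
      show "x \<in> - K" using x by simp
      show "\<And>y. y \<in> - K \<Longrightarrow> 0 = \<phi> y" using K(2) by simp
    qed
    ultimately have "D x = (\<lambda>_. 0)" by (rule has_derivative_unique)
    then show ?thesis by simp
  qed
  then show ?thesis using that K by blast
qed

lemma test_fun_L2:
  assumes "test_fun \<phi> D"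
  shows "\<phi> \<in> L2" "(\<lambda>x. D x (axis j 1)) \<in> L2"
proof -
  obtain K where K: "compact K" "\<And>x. x \<notin> K \<Longrightarrow> \<phi> x = 0" "\<And>x y. x \<notin> K \<Longrightarrow> D x y = 0"
    by (rule test_fun_support[OF assms]) blast
  show "\<phi> \<in> L2" using test_fun_continuous[OF assms] K by (intro continuous_compact_support_L2)
  show "(\<lambda>x. D x (axis j 1)) \<in> L2"
    using assms K by (intro continuous_compact_support_L2[of _ K]) (auto simp: test_fun_def)
qed

lemma ex_C1c_approx_indicator:
  fixes c d :: real
  obtains a a' :: "nat \<Rightarrow> real \<Rightarrow> real" where "\<And>n. C1c (a n) (a' n)"
    "\<And>n s. 0 \<le> a n s" "\<And>n s. a n s \<le> indicator {c<..<d} s"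
    "\<And>s. (\<lambda>n. a n s) \<longlonglongrightarrow> indicator {c<..<d} s"
proof -
  define q where "q s = (max 0 (s - c))\<^sup>2 * (max 0 (d - s))\<^sup>2" for s
  define q' where "q' s = 2 * max 0 (s - c) * (max 0 (d - s))\<^sup>2 - (max 0 (s - c))\<^sup>2 * (2 * max 0 (d - s))" for s
  define a where "a n s = real n * q s / (1 + real n * q s)" for n s
  define a' where "a' n s = real n * q' s / (1 + real n * q s)\<^sup>2" for n s
  have q0: "0 \<le> q s" for s by (simp add: q_def)
  have pos: "0 < 1 + real n * q s" for n s using q0[of s] by (simp add: add_pos_nonneg)
  have ne: "1 + real n * q s \<noteq> 0" for n s using pos[of n s] by simp
  have qz: "q s = 0 \<longleftrightarrow> s \<notin> {c<..<d}" for s by (auto simp: q_def max_def)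
  have P: "((\<lambda>s. (max 0 s)\<^sup>2) has_real_derivative 2 * max 0 s) (at s)" for s :: real
    using has_real_derivative_pos_part_power[of 0 s] by (simp add: numeral_2_eq_2)
  have q': "(q has_real_derivative q' s) (at s)" for s
  proof -
    have 1: "((\<lambda>s. (max 0 (s - c))\<^sup>2) has_real_derivative 2 * max 0 (s - c)) (at s)"
      using DERIV_chain2[where f="\<lambda>s. (max 0 s)\<^sup>2" and g="\<lambda>s. s - c" and Db="1" and x=s and s=UNIV, OF P]
      by (simp add: DERIV_cong[OF DERIV_diff[OF DERIV_ident DERIV_const]])
    have 2: "((\<lambda>s. (max 0 (d - s))\<^sup>2) has_real_derivative - (2 * max 0 (d - s))) (at s)"
      using DERIV_chain2[where f="\<lambda>s. (max 0 s)\<^sup>2" and g="\<lambda>s. d - s" and Db="-1" and x=s and s=UNIV, OF P]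
      by (simp add: DERIV_cong[OF DERIV_diff[OF DERIV_const DERIV_ident]])
    show ?thesis unfolding q_def[abs_def] q'_def
      by (rule DERIV_cong[OF DERIV_mult[OF 1 2]]) (simp add: algebra_simps)
  qed
  have cq: "continuous_on UNIV q" "continuous_on UNIV q'"
    unfolding q_def[abs_def] q'_def[abs_def] by (intro continuous_intros)+
  show ?thesis
  proof
    fix n s
    show "0 \<le> a n s" using q0 pos by (simp add: a_def less_imp_le)
    show "a n s \<le> indicator {c<..<d} s"
    proof (cases "s \<in> {c<..<d}")
      case True
      then show ?thesis using pos[of n s] by (simp add: a_def)
    next
      case False
      then show ?thesis using qz[of s] by (simp add: a_def)
    qed
    show "(\<lambda>n. a n s) \<longlonglongrightarrow> indicator {c<..<d} s"
    proof (cases "s \<in> {c<..<d}")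
      case True
      then have "q s > 0" using q0[of s] qz[of s] by auto
      then have lim: "filterlim (\<lambda>n. 1 + real n * q s) at_top sequentially"
        by (intro filterlim_tendsto_add_at_top[OF tendsto_const] filterlim_at_top_mult_tendsto_pos[OF tendsto_const _ filterlim_real_sequentially])
      have "(\<lambda>n. 1 - 1 / (1 + real n * q s)) \<longlonglongrightarrow> 1 - 0"
        by (intro tendsto_diff tendsto_const tendsto_divide_0[OF tendsto_const] filterlim_at_top_imp_at_infinity lim)
      moreover have "1 - 1 / (1 + real n * q s) = a n s" for n
        using ne[of n s] by (simp add: a_def field_simps)
      ultimately show ?thesis using True by simp
    next
      case False
      then show ?thesis using qz[of s] by (simp add: a_def)
    qed
    show "C1c (a n) (a' n)"
      unfolding C1c_def
    proof (intro conjI allI)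
      show "(a n has_real_derivative a' n s) (at s)" for s
        unfolding a_def[abs_def] a'_def using ne[of n s]
        by (auto intro!: derivative_eq_intros q' simp: power2_eq_square) (simp add: field_simps)
      show "continuous_on UNIV (a' n)"
        unfolding a'_def[abs_def] using cq ne by (intro continuous_intros) auto
      have "a n s = 0" if "\<bar>c\<bar> + \<bar>d\<bar> < \<bar>s\<bar>" for s
        using that qz[of s] by (auto simp: a_def)
      then show "\<exists>R. \<forall>s. R < \<bar>s\<bar> \<longrightarrow> a n s = 0" by blast
    qed
  qed
qed

lemma indicator_L2:
  assumes "A \<in> sets borel" "emeasure lborel A < \<infinity>"
  shows "(\<lambda>x::R2. indicator A x) \<in> L2"
proof (rule L2I)
  have "(\<lambda>x. (indicator A x)\<^sup>2) = (indicator A :: R2 \<Rightarrow> real)" by (auto simp: indicator_def fun_eq_iff)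
  then show "integrable lborel (\<lambda>x::R2. (indicator A x :: real)\<^sup>2)" using assms by simp
qed (use assms in measurable)

lemma fundamental_lemma:
  fixes f :: "R2 \<Rightarrow> real"
  assumes f: "f \<in> L2"
    and 0: "\<And>a a'. (\<And>i. C1c (a i) (a' i)) \<Longrightarrow> (\<integral>x. f x * (\<Prod>i\<in>UNIV. a i (x $ i)) \<partial>lborel) = 0"
  shows "AE x in lborel. f x = 0"
proof -
  have fm[measurable]: "f \<in> borel_measurable borel" using f by (rule L2D)
  have indL2: "(\<lambda>x. indicator (box l u) x) \<in> L2" for l u :: R2
    using emeasure_bounded_finite[OF bounded_box[of l u]] by (intro indicator_L2) auto
  have fint: "integrable lborel (\<lambda>x. f x * indicator (box l u) x)" for l u :: R2
    using L2_mult_integrable[OF f indL2] .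
  have box0: "(\<integral>x. f x * indicator (box l u) x \<partial>lborel) = 0" for l u :: R2
  proof -
    have "\<forall>i::2. \<exists>a a'. (\<forall>n. C1c (a n) (a' n)) \<and> (\<forall>n s. 0 \<le> a n s) \<and> (\<forall>n s. a n s \<le> indicator {l $ i<..<u $ i} s)
      \<and> (\<forall>s. (\<lambda>n. a n s) \<longlonglongrightarrow> indicator {l $ i<..<u $ i} s)"
    proof
      fix i :: 2
      show "\<exists>a a'. (\<forall>n. C1c (a n) (a' n)) \<and> (\<forall>n s. 0 \<le> a n s) \<and> (\<forall>n s. a n s \<le> indicator {l $ i<..<u $ i} s)
        \<and> (\<forall>s. (\<lambda>n. a n s) \<longlonglongrightarrow> indicator {l $ i<..<u $ i} s)"
        by (rule ex_C1c_approx_indicator[of "l $ i" "u $ i"]) blast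
    qed
    from this[unfolded choice_iff] obtain a a' where a: "\<And>i n. C1c (a i n) (a' i n)" "\<And>i n s. 0 \<le> a i n s"
      "\<And>i n s. a i n s \<le> indicator {l $ i<..<u $ i} s"
      "\<And>i s. (\<lambda>n. a i n s) \<longlonglongrightarrow> indicator {l $ i<..<u $ i} s" by blast
    have ind: "(\<Prod>i\<in>UNIV. indicator {l $ i<..<u $ i} (x $ i)) = (indicator (box l u) x :: real)" for x :: R2
      by (auto simp: indicator_def mem_box_cart)
    have cm[measurable]: "a i n \<in> borel_measurable borel" for i n
      using C1c_continuous[OF a(1)] by (rule borel_measurable_continuous_onI)
    have "(\<lambda>n. \<integral>x. f x * (\<Prod>i\<in>UNIV. a i n (x $ i)) \<partial>lborel) \<longlonglongrightarrow> (\<integral>x. f x * indicator (box l u) x \<partial>lborel)"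
    proof (rule integral_dominated_convergence[where w="\<lambda>x. norm (f x * indicator (box l u) x)"])
      show "(\<lambda>x. f x * indicator (box l u) x) \<in> borel_measurable lborel" by measurable
      show "(\<lambda>x. f x * (\<Prod>i\<in>UNIV. a i n (x $ i))) \<in> borel_measurable lborel" for n
        by measurable
      show "integrable lborel (\<lambda>x. norm (f x * indicator (box l u) x))" using fint by (rule integrable_norm)
      show "AE x in lborel. (\<lambda>n. f x * (\<Prod>i\<in>UNIV. a i n (x $ i))) \<longlonglongrightarrow> f x * indicator (box l u) x"
        unfolding ind[symmetric] by (intro AE_I2 tendsto_intros a)
      show "AE x in lborel. norm (f x * (\<Prod>i\<in>UNIV. a i n (x $ i))) \<le> norm (f x * indicator (box l u) x)" for n
      proof (rule AE_I2)
        fix x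
        have "(\<Prod>i\<in>UNIV. a i n (x $ i)) \<le> indicator (box l u) x"
          unfolding ind[symmetric] by (intro prod_mono conjI a)
        moreover have "0 \<le> (\<Prod>i\<in>UNIV. a i n (x $ i))" by (intro prod_nonneg a)
        ultimately show "norm (f x * (\<Prod>i\<in>UNIV. a i n (x $ i))) \<le> norm (f x * indicator (box l u) x)"
          by (auto simp: abs_mult intro!: mult_left_mono)
      qed
    qed
    moreover have "(\<integral>x. f x * (\<Prod>i\<in>UNIV. a i n (x $ i)) \<partial>lborel) = 0" for n
      by (rule 0) (rule a)
    ultimately show ?thesis by (simp add: LIMSEQ_const_iff)
  qed
  have "AE x in lborel. x \<in> W \<longrightarrow> f x = 0" if W: "W = box l u" for W and l u :: R2
  proof -
    define fp where "fp x = ennreal (f x * indicator W x)" for x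
    define fm' where "fm' x = ennreal (- (f x * indicator W x))" for x
    have [measurable]: "fp \<in> borel_measurable borel" "fm' \<in> borel_measurable borel"
      unfolding fp_def[abs_def] fm'_def[abs_def] W by measurable
    have eqB: "(\<integral>\<^sup>+x. fp x * indicator (box a b) x \<partial>lborel) = (\<integral>\<^sup>+x. fm' x * indicator (box a b) x \<partial>lborel)"
      and finB: "(\<integral>\<^sup>+x. fp x * indicator (box a b) x \<partial>lborel) \<noteq> \<infinity>" for a b
    proof -
      have "\<exists>l' u'. W \<inter> box a b = box l' u'" unfolding W box_Int_box by blast
      then obtain l' u' where I: "W \<inter> box a b = box l' u'" by blast
      let ?h = "\<lambda>x. f x * indicator (box l' u') x"
      have 1: "(\<integral>\<^sup>+x. fp x * indicator (box a b) x \<partial>lborel) = (\<integral>\<^sup>+x. ennreal (?h x) \<partial>lborel)"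
        unfolding fp_def I[symmetric] by (intro nn_integral_cong) (auto simp: indicator_def)
      have 2: "(\<integral>\<^sup>+x. fm' x * indicator (box a b) x \<partial>lborel) = (\<integral>\<^sup>+x. ennreal (- ?h x) \<partial>lborel)"
        unfolding fm'_def I[symmetric] by (intro nn_integral_cong) (auto simp: indicator_def)
      have fin: "(\<integral>\<^sup>+x. ennreal (?h x) \<partial>lborel) \<noteq> \<infinity>" "(\<integral>\<^sup>+x. ennreal (- ?h x) \<partial>lborel) \<noteq> \<infinity>"
        using fint[of l' u'] unfolding real_integrable_def by auto
      have "enn2real (\<integral>\<^sup>+x. ennreal (?h x) \<partial>lborel) = enn2real (\<integral>\<^sup>+x. ennreal (- ?h x) \<partial>lborel)"
        using box0[of l' u'] real_lebesgue_integral_def[OF fint[of l' u']] by simp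
      moreover have "A = B" if "enn2real A = enn2real B" "A \<noteq> \<infinity>" "B \<noteq> \<infinity>" for A B
        using that by (cases A; cases B) auto
      ultimately have "(\<integral>\<^sup>+x. ennreal (?h x) \<partial>lborel) = (\<integral>\<^sup>+x. ennreal (- ?h x) \<partial>lborel)"
        using fin by blast
      with 1 2 fin show "(\<integral>\<^sup>+x. fp x * indicator (box a b) x \<partial>lborel) = (\<integral>\<^sup>+x. fm' x * indicator (box a b) x \<partial>lborel)"
        "(\<integral>\<^sup>+x. fp x * indicator (box a b) x \<partial>lborel) \<noteq> \<infinity>" by auto
    qed
    have "density lborel fp = density lborel fm'"
    proof (rule measure_eqI_generator_eq)
      let ?E = "range (\<lambda>(a, b). box a b::R2 set)"
      show "Int_stable ?E" by (auto simp: Int_stable_def box_Int_box)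
      show "?E \<subseteq> Pow UNIV" "sets (density lborel fp) = sigma_sets UNIV ?E" "sets (density lborel fm') = sigma_sets UNIV ?E"
        by (simp_all add: borel_eq_box)
      let ?A = "\<lambda>n::nat. box (- (real n *\<^sub>R One)) (real n *\<^sub>R One) :: R2 set"
      show "range ?A \<subseteq> ?E" "(\<Union>i. ?A i) = UNIV" unfolding UN_box_eq_UNIV by auto
      show "emeasure (density lborel fp) (?A i) \<noteq> \<infinity>" for i
        using finB by (subst emeasure_density) auto
      show "emeasure (density lborel fp) X = emeasure (density lborel fm') X" if "X \<in> ?E" for X
        using that eqB by (auto simp: emeasure_density)
    qed
    moreover have "integral\<^sup>N lborel fp \<noteq> \<infinity>"
    proof -
      have "integral\<^sup>N lborel fp = (\<integral>\<^sup>+x. fp x * indicator (box l u) x \<partial>lborel)"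
        unfolding fp_def W by (intro nn_integral_cong) (auto simp: indicator_def)
      then show ?thesis using finB by simp
    qed
    ultimately have "AE x in lborel. fp x = fm' x"
      by (subst (asm) finite_density_unique) auto
    then show ?thesis
    proof eventually_elim
      case (elim x)
      show ?case
      proof
        assume "x \<in> W"
        then have "ennreal (f x) = ennreal (- f x)" using elim by (simp add: fp_def fm'_def)
        then show "f x = 0"
          by (cases "f x \<ge> 0") (auto simp: ennreal_neg)
      qed
    qed
  qed
  then have "AE x in lborel. \<forall>n::nat. x \<in> box (- (real n *\<^sub>R One)) (real n *\<^sub>R One) \<longrightarrow> f x = 0"
    unfolding AE_all_countable by blast
  then show ?thesis
  proof eventually_elim
    case (elim x)
    have "x \<in> (\<Union>n::nat. box (- (real n *\<^sub>R One)) (real n *\<^sub>R One))"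
      unfolding UN_box_eq_UNIV by simp
    then show ?case using elim by blast
  qed
qed

section \<open>Weak derivatives along lines\<close>

lemma ennreal_abs_integral_le:
  fixes f :: "'a \<Rightarrow> real"
  shows "ennreal \<bar>\<integral>x. f x \<partial>M\<bar> \<le> (\<integral>\<^sup>+x. ennreal \<bar>f x\<bar> \<partial>M)"
  using integral_norm_bound_ennreal[of M f] by (cases "integrable M f") (auto simp: not_integrable_integral_eq)

definition line_int :: "2 \<Rightarrow> real \<Rightarrow> (R2 \<Rightarrow> real) \<Rightarrow> R2 \<Rightarrow> real" where
  "line_int j t w x = (\<integral>s. indicator {0..t} s * w (x + s *\<^sub>R axis j 1) \<partial>lborel)"

lemma line_int_measurable:
  assumes [measurable]: "w \<in> borel_measurable borel"
  shows "line_int j t w \<in> borel_measurable borel"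
proof -
  have "(\<lambda>x. \<integral>s. indicator {0..t} s * w (x + s *\<^sub>R axis j 1) \<partial>lborel) \<in> borel_measurable lborel"
    by (rule lborel.borel_measurable_lebesgue_integral) measurable
  then show ?thesis by (simp add: line_int_def[abs_def])
qed

lemma line_int_sq_le:
  assumes [measurable]: "w \<in> borel_measurable borel" and t: "0 \<le> t"
  shows "ennreal ((line_int j t w x)\<^sup>2) \<le> ennreal t * (\<integral>\<^sup>+s. indicator {0..t} s * ennreal ((w (x + s *\<^sub>R axis j 1))\<^sup>2) \<partial>lborel)"
proof -
  have "ennreal \<bar>line_int j t w x\<bar> \<le> (\<integral>\<^sup>+s. ennreal \<bar>indicator {0..t} s * w (x + s *\<^sub>R axis j 1)\<bar> \<partial>lborel)"
    unfolding line_int_def by (rule ennreal_abs_integral_le)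
  also have "\<dots> = (\<integral>\<^sup>+s. indicator {0..t} s * (indicator {0..t} s * ennreal \<bar>w (x + s *\<^sub>R axis j 1)\<bar>) \<partial>lborel)"
    by (intro nn_integral_cong) (auto simp: indicator_def)
  finally have "(ennreal \<bar>line_int j t w x\<bar>)\<^sup>2 \<le> (\<integral>\<^sup>+s. indicator {0..t} s * (indicator {0..t} s * ennreal \<bar>w (x + s *\<^sub>R axis j 1)\<bar>) \<partial>lborel)\<^sup>2"
    by (rule power_mono) simp
  also have "\<dots> \<le> (\<integral>\<^sup>+s. (indicator {0..t} s)\<^sup>2 \<partial>lborel) * (\<integral>\<^sup>+s. (indicator {0..t} s * ennreal \<bar>w (x + s *\<^sub>R axis j 1)\<bar>)\<^sup>2 \<partial>lborel)"
    by (rule Cauchy_Schwarz_nn_integral) measurable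
  also have "(\<integral>\<^sup>+s. (indicator {0..t} s)\<^sup>2 \<partial>lborel) = (\<integral>\<^sup>+s. indicator {0..t} s \<partial>lborel)"
    by (intro nn_integral_cong) (auto simp: indicator_def)
  also have "\<dots> = ennreal t" using t by simp
  also have "(\<integral>\<^sup>+s. (indicator {0..t} s * ennreal \<bar>w (x + s *\<^sub>R axis j 1)\<bar>)\<^sup>2 \<partial>lborel)
    = (\<integral>\<^sup>+s. indicator {0..t} s * ennreal ((w (x + s *\<^sub>R axis j 1))\<^sup>2) \<partial>lborel)"
    by (intro nn_integral_cong) (auto simp: indicator_def ennreal_power)
  finally show ?thesis by (simp add: ennreal_power)
qed

lemma line_int_L2:
  assumes w: "w \<in> L2" and t: "0 \<le> t"
  shows "line_int j t w \<in> L2" "sqn (line_int j t w) \<le> t\<^sup>2 * sqn w"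
proof -
  have wm[measurable]: "w \<in> borel_measurable borel" using w by (rule L2D)
  have "(\<integral>\<^sup>+x. ennreal ((line_int j t w x)\<^sup>2) \<partial>lborel)
    \<le> (\<integral>\<^sup>+x. ennreal t * (\<integral>\<^sup>+s. indicator {0..t} s * ennreal ((w (x + s *\<^sub>R axis j 1))\<^sup>2) \<partial>lborel) \<partial>lborel)"
    by (intro nn_integral_mono line_int_sq_le wm t)
  also have "\<dots> = ennreal t * (\<integral>\<^sup>+x. (\<integral>\<^sup>+s. indicator {0..t} s * ennreal ((w (x + s *\<^sub>R axis j 1))\<^sup>2) \<partial>lborel) \<partial>lborel)"
    by (rule nn_integral_cmult) measurable
  also have "(\<integral>\<^sup>+x. (\<integral>\<^sup>+s. indicator {0..t} s * ennreal ((w (x + s *\<^sub>R axis j 1))\<^sup>2) \<partial>lborel) \<partial>lborel)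
     = (\<integral>\<^sup>+s. (\<integral>\<^sup>+x. indicator {0..t} s * ennreal ((w (x + s *\<^sub>R axis j 1))\<^sup>2) \<partial>lborel) \<partial>lborel)"
    by (rule lborel_pair.Fubini'[symmetric]) measurable
  also have "\<dots> = (\<integral>\<^sup>+s. indicator {0..t} s * ennreal (sqn w) \<partial>lborel)"
  proof (rule nn_integral_cong)
    fix s :: real
    have "(\<integral>\<^sup>+x. indicator {0..t} s * ennreal ((w (x + s *\<^sub>R axis j 1))\<^sup>2) \<partial>lborel)
      = indicator {0..t} s * (\<integral>\<^sup>+x. ennreal ((w (x + s *\<^sub>R axis j 1))\<^sup>2) \<partial>lborel)"
      by (rule nn_integral_cmult) measurable
    also have "(\<integral>\<^sup>+x. ennreal ((w (x + s *\<^sub>R axis j 1))\<^sup>2) \<partial>lborel) = ennreal (sqn w)"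
      using nn_integral_sq_eq_sqn[OF L2_shift[OF w, of "s *\<^sub>R axis j 1"]] sqn_shift[OF w] by simp
    finally show "(\<integral>\<^sup>+x. indicator {0..t} s * ennreal ((w (x + s *\<^sub>R axis j 1))\<^sup>2) \<partial>lborel)
      = indicator {0..t} s * ennreal (sqn w)" .
  qed
  also have "\<dots> = ennreal t * ennreal (sqn w)"
    using t by (subst nn_integral_multc) auto
  also have "ennreal t * (ennreal t * ennreal (sqn w)) = ennreal (t\<^sup>2 * sqn w)"
    using t by (simp add: ennreal_mult[symmetric] power2_eq_square mult.assoc)
  finally have *: "(\<integral>\<^sup>+x. ennreal ((line_int j t w x)\<^sup>2) \<partial>lborel) \<le> ennreal (t\<^sup>2 * sqn w)" .
  show "line_int j t w \<in> L2" "sqn (line_int j t w) \<le> t\<^sup>2 * sqn w"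
    by (rule L2_sqn_le_nn_integral[OF line_int_measurable[OF wm] *]; simp)+
qed

lemma integrable_pair_shifted_product:
  assumes p: "p \<in> L2" and q: "q \<in> L2" and t: "0 \<le> (t::real)"
  shows "integrable (lborel \<Otimes>\<^sub>M lborel) (\<lambda>(x, s). indicator {0..t} s * (p (x + s *\<^sub>R c) * q (x + s *\<^sub>R d)))"
proof -
  have [measurable]: "p \<in> borel_measurable borel" "q \<in> borel_measurable borel" using p q by (auto dest: L2D)
  let ?f = "\<lambda>(x, s). indicator {0..t} s * (p (x + s *\<^sub>R c) * q (x + s *\<^sub>R d))"
  have "(\<integral>\<^sup>+z. ennreal (norm (?f z)) \<partial>(lborel \<Otimes>\<^sub>M lborel)) = (\<integral>\<^sup>+s. (\<integral>\<^sup>+x. ennreal (norm (?f (x, s))) \<partial>lborel) \<partial>lborel)"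
    by (rule lborel_pair.nn_integral_snd[symmetric]) measurable
  also have "\<dots> \<le> (\<integral>\<^sup>+s. indicator {0..t} s * ennreal (sqn p + sqn q) \<partial>lborel)"
  proof (rule nn_integral_mono)
    fix s :: real
    have "(\<integral>\<^sup>+x. ennreal (norm (?f (x, s))) \<partial>lborel)
      \<le> (\<integral>\<^sup>+x. indicator {0..t} s * (ennreal ((p (x + s *\<^sub>R c))\<^sup>2) + ennreal ((q (x + s *\<^sub>R d))\<^sup>2)) \<partial>lborel)"
      using abs_mult_le_sum_squares
      by (intro nn_integral_mono) (auto simp: indicator_def ennreal_plus[symmetric] simp del: ennreal_plus intro!: ennreal_leI)
    also have "\<dots> = indicator {0..t} s * ((\<integral>\<^sup>+x. ennreal ((p (x + s *\<^sub>R c))\<^sup>2) \<partial>lborel) + (\<integral>\<^sup>+x. ennreal ((q (x + s *\<^sub>R d))\<^sup>2) \<partial>lborel))"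
      by (subst nn_integral_cmult) (auto simp: nn_integral_add)
    also have "\<dots> = indicator {0..t} s * ennreal (sqn p + sqn q)"
      using nn_integral_sq_eq_sqn[OF L2_shift[OF p, of "s *\<^sub>R c"]] sqn_shift[OF p]
        nn_integral_sq_eq_sqn[OF L2_shift[OF q, of "s *\<^sub>R d"]] sqn_shift[OF q] by simp
    finally show "(\<integral>\<^sup>+x. ennreal (norm (?f (x, s))) \<partial>lborel) \<le> indicator {0..t} s * ennreal (sqn p + sqn q)" .
  qed
  also have "\<dots> = ennreal t * ennreal (sqn p + sqn q)" using t by (subst nn_integral_multc) auto
  also have "\<dots> < \<infinity>" by (simp add: ennreal_mult_less_top)
  finally show ?thesis by (rule integrableI_bounded[rotated]) measurable
qed

lemma C1c_antiderivative_increment: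
  assumes a: "C1c a a'" and t: "0 \<le> t"
  defines "\<alpha> \<equiv> \<lambda>r. \<integral>s. indicator {0..t} s * a (r - s) \<partial>lborel"
  shows "C1c \<alpha> (\<lambda>r. a r - a (r - t))"
proof -
  have ca: "continuous_on UNIV a" using a by (rule C1c_continuous)
  have "\<exists>F. \<forall>x :: real. (-\<infinity>::ereal) < x \<longrightarrow> x < (\<infinity>::ereal) \<longrightarrow> (F has_vector_derivative a x) (at x)"
    using ca by (intro einterval_antiderivative) (auto simp: continuous_on_eq_continuous_at)
  then obtain F where F: "\<And>x. (F has_real_derivative a x) (at x)"
    by (auto simp: has_real_derivative_iff_has_vector_derivative)
  have F': "((\<lambda>x. F (x - c)) has_real_derivative a (r - c)) (at r)" for c r
    using DERIV_chain2[where f=F and g="\<lambda>x. x - c" and Db=1 and x=r and s=UNIV, OF F]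
    by (simp add: DERIV_cong[OF DERIV_diff[OF DERIV_ident DERIV_const]])
  have \<alpha>: "\<alpha> = (\<lambda>r. F r - F (r - t))"
  proof
    fix r
    have "(\<integral>s. a (r - s) * indicator {0..t} s \<partial>lborel) = (\<lambda>s. - F (r - s)) t - (\<lambda>s. - F (r - s)) 0"
    proof (rule integral_FTC_Icc_real)
      fix s
      have "((\<lambda>s. F (r - s)) has_real_derivative a (r - s) * (-1)) (at s)"
        by (rule DERIV_chain2[where f=F and g="\<lambda>s. r - s", OF F])
          (simp add: DERIV_cong[OF DERIV_diff[OF DERIV_const DERIV_ident]])
      then show "((\<lambda>s. - F (r - s)) has_real_derivative a (r - s)) (at s)"
        by (auto dest: DERIV_minus)
      show "isCont (\<lambda>s. a (r - s)) s"
        using ca by (intro continuous_intros isCont_o2[where f="\<lambda>s. r - s" and g=a]) (auto simp: continuous_on_eq_continuous_at)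
    qed (use t in auto)
    then show "\<alpha> r = F r - F (r - t)" by (simp add: \<alpha>_def mult.commute)
  qed
  show ?thesis
    unfolding C1c_def
  proof (intro conjI allI)
    show "(\<alpha> has_real_derivative a s - a (s - t)) (at s)" for s
      unfolding \<alpha> by (intro DERIV_diff F F')
    show "continuous_on UNIV (\<lambda>r. a r - a (r - t))"
      using ca by (intro continuous_intros continuous_on_compose2[OF ca]) auto
    obtain R where R: "\<And>s. R < \<bar>s\<bar> \<Longrightarrow> a s = 0" using a unfolding C1c_def by blast
    have "\<alpha> r = 0" if r: "R + t < \<bar>r\<bar>" for r
    proof -
      have "indicator {0..t} s * a (r - s) = 0" for s
        using r by (cases "s \<in> {0..t}") (auto intro!: R)
      then show ?thesis unfolding \<alpha>_def by (simp only: Bochner_Integration.integral_zero)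
    qed
    then show "\<exists>R. \<forall>s. R < \<bar>s\<bar> \<longrightarrow> \<alpha> s = 0" by blast
  qed
qed

lemma weak_grad_line_identity:
  assumes u: "u \<in> L2" and wg: "weak_grad u g" and g: "(\<lambda>x. g x $ j) \<in> L2" and t: "0 \<le> t"
  shows "AE x in lborel. u (x + t *\<^sub>R axis j 1) - u x = line_int j t (\<lambda>x. g x $ j) x"
proof -
  define e :: R2 where "e = axis j 1"
  define G where "G = line_int j t (\<lambda>x. g x $ j)"
  have GL: "G \<in> L2" unfolding G_def by (rule line_int_L2[OF g t])
  have uL: "(\<lambda>x. u (x + t *\<^sub>R e)) \<in> L2" using u by (rule L2_shift)
  have [measurable]: "u \<in> borel_measurable borel" "(\<lambda>x. g x $ j) \<in> borel_measurable borel" using u g by (auto dest: L2D)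
  have "AE x in lborel. u (x + t *\<^sub>R e) - u x - G x = 0"
  proof (rule fundamental_lemma)
    show "(\<lambda>x. u (x + t *\<^sub>R e) - u x - G x) \<in> L2" by (intro L2_diff uL u GL)
    fix a a' :: "2 \<Rightarrow> real \<Rightarrow> real"
    assume a: "\<And>i. C1c (a i) (a' i)"
    define \<phi> where "\<phi> x = (\<Prod>i\<in>UNIV. a i (x $ i))" for x :: R2
    define P where "P x = (\<Prod>i\<in>UNIV - {j}. a i (x $ i))" for x :: R2
    define \<alpha> where "\<alpha> r = (\<integral>s. indicator {0..t} s * a j (r - s) \<partial>lborel)" for r
    have \<phi>: "\<phi> x = a j (x $ j) * P x" for x
      unfolding \<phi>_def P_def by (rule prod.remove) auto
    have Pe: "P (x + s *\<^sub>R e) = P x" for x s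
      unfolding P_def e_def by (intro prod.cong) (auto simp: axis_def)
    have ej1: "e $ j = 1" by (simp add: e_def)
    have ej: "(x + s *\<^sub>R e) $ j = x $ j + s" for x s by (simp add: e_def axis_def)
    have \<phi>L: "\<phi> \<in> L2" unfolding \<phi>_def[abs_def] by (rule test_fun_L2(1)[OF test_fun_prod[OF a]])
    then have [measurable]: "\<phi> \<in> borel_measurable borel" by (rule L2D)
    let ?b = "a(j := \<alpha>)" and ?b' = "a'(j := \<lambda>r. a j r - a j (r - t))"
    have "C1c (?b i) (?b' i)" for i
      using C1c_antiderivative_increment[OF a t, of j] a[of i] by (auto simp: \<alpha>_def[abs_def])
    from test_fun_prod[of ?b ?b', OF this]
    have wk: "(\<integral>x. u x * (?b' j (x $ j) * (\<Prod>i\<in>UNIV - {j}. ?b i (x $ i))) \<partial>lborel)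
       = - (\<integral>x. g x $ j * (\<Prod>i\<in>UNIV. ?b i (x $ i)) \<partial>lborel)"
      using wg unfolding weak_grad_def test_fun_prod_partial[symmetric] by blast
    have P2: "(\<Prod>i\<in>UNIV - {j}. ?b i (x $ i)) = P x" for x :: R2
      unfolding P_def by (intro prod.cong) auto
    have P3: "(\<Prod>i\<in>UNIV. ?b i (x $ i)) = \<alpha> (x $ j) * P x" for x :: R2
      by (subst prod.remove[of _ j]) (auto simp: P2[symmetric])
    have wk': "(\<integral>x. u x * (\<phi> x - \<phi> (x - t *\<^sub>R e)) \<partial>lborel) = - (\<integral>x. g x $ j * (\<alpha> (x $ j) * P x) \<partial>lborel)"
    proof -
      have "\<phi> x - \<phi> (x - t *\<^sub>R e) = ?b' j (x $ j) * P x" for x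
        using Pe[of x "-t"] ej1 by (simp add: \<phi> algebra_simps)
      then show ?thesis using wk unfolding P2 P3 by simp
    qed
    have \<phi>t: "(\<lambda>x. \<phi> (x - t *\<^sub>R e)) \<in> L2" using L2_shift[OF \<phi>L, of "- (t *\<^sub>R e)"] by simp
    have sh: "(\<integral>x. u (x + t *\<^sub>R e) * \<phi> x \<partial>lborel) = (\<integral>x. u x * \<phi> (x - t *\<^sub>R e) \<partial>lborel)"
      using integral_shift[of "\<lambda>x. u (x + t *\<^sub>R e) * \<phi> x" "- (t *\<^sub>R e)"] by simp
    have "(\<integral>x. G x * \<phi> x \<partial>lborel) = (\<integral>x. (\<integral>s. indicator {0..t} s * (g (x + s *\<^sub>R e) $ j * \<phi> (x + s *\<^sub>R 0)) \<partial>lborel) \<partial>lborel)"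
      unfolding G_def line_int_def e_def by (simp add: mult.assoc[symmetric])
    also have "\<dots> = (\<integral>s. (\<integral>x. indicator {0..t} s * (g (x + s *\<^sub>R e) $ j * \<phi> (x + s *\<^sub>R 0)) \<partial>lborel) \<partial>lborel)"
      by (rule lborel_pair.Fubini_integral[symmetric]) (rule integrable_pair_shifted_product[OF g \<phi>L t])
    also have "\<dots> = (\<integral>s. (\<integral>x. indicator {0..t} s * (g (x + s *\<^sub>R 0) $ j * \<phi> (x + s *\<^sub>R (- e))) \<partial>lborel) \<partial>lborel)"
    proof (rule Bochner_Integration.integral_cong)
      fix s :: real
      show "(\<integral>x. indicator {0..t} s * (g (x + s *\<^sub>R e) $ j * \<phi> (x + s *\<^sub>R 0)) \<partial>lborel)
        = (\<integral>x. indicator {0..t} s * (g (x + s *\<^sub>R 0) $ j * \<phi> (x + s *\<^sub>R (- e))) \<partial>lborel)"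
        using integral_shift[of "\<lambda>x. indicator {0..t} s * (g (x + s *\<^sub>R e) $ j * \<phi> x)" "- (s *\<^sub>R e)"] by auto
    qed simp
    also have "\<dots> = (\<integral>x. (\<integral>s. indicator {0..t} s * (g (x + s *\<^sub>R 0) $ j * \<phi> (x + s *\<^sub>R (- e))) \<partial>lborel) \<partial>lborel)"
      by (rule lborel_pair.Fubini_integral) (rule integrable_pair_shifted_product[OF g \<phi>L t])
    also have "\<dots> = (\<integral>x. g x $ j * (\<alpha> (x $ j) * P x) \<partial>lborel)"
    proof (rule Bochner_Integration.integral_cong)
      fix x :: R2
      have "(\<integral>s. indicator {0..t} s * (g (x + s *\<^sub>R 0) $ j * \<phi> (x + s *\<^sub>R (- e))) \<partial>lborel)
        = (\<integral>s. (g x $ j * P x) * (indicator {0..t} s * a j (x $ j - s)) \<partial>lborel)"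
      proof (rule Bochner_Integration.integral_cong)
        fix s :: real
        show "indicator {0..t} s * (g (x + s *\<^sub>R 0) $ j * \<phi> (x + s *\<^sub>R (- e))) = (g x $ j * P x) * (indicator {0..t} s * a j (x $ j - s))"
          using Pe[of x "-s"] ej1 by (simp add: \<phi> algebra_simps)
      qed simp
      also have "\<dots> = (g x $ j * P x) * \<alpha> (x $ j)" unfolding \<alpha>_def by (rule integral_mult_right_zero)
      finally show "(\<integral>s. indicator {0..t} s * (g (x + s *\<^sub>R 0) $ j * \<phi> (x + s *\<^sub>R (- e))) \<partial>lborel) = g x $ j * (\<alpha> (x $ j) * P x)"
        by (simp add: algebra_simps)
    qed simp
    finally have GI: "(\<integral>x. G x * \<phi> x \<partial>lborel) = (\<integral>x. g x $ j * (\<alpha> (x $ j) * P x) \<partial>lborel)" .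
    have "(\<integral>x. (u (x + t *\<^sub>R e) - u x - G x) * \<phi> x \<partial>lborel)
      = (\<integral>x. u (x + t *\<^sub>R e) * \<phi> x \<partial>lborel) - (\<integral>x. u x * \<phi> x \<partial>lborel) - (\<integral>x. G x * \<phi> x \<partial>lborel)"
      using L2_mult_integrable[OF uL \<phi>L] L2_mult_integrable[OF u \<phi>L] L2_mult_integrable[OF GL \<phi>L]
      by (simp add: left_diff_distrib)
    also have "\<dots> = - (\<integral>x. u x * (\<phi> x - \<phi> (x - t *\<^sub>R e)) \<partial>lborel) - (\<integral>x. G x * \<phi> x \<partial>lborel)"
      using L2_mult_integrable[OF u \<phi>L] L2_mult_integrable[OF u \<phi>t] unfolding sh by (simp add: right_diff_distrib)
    also have "\<dots> = 0" using wk' GI by simp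
    finally show "(\<integral>x. (u (x + t *\<^sub>R e) - u x - G x) * (\<Prod>i\<in>UNIV. a i (x $ i)) \<partial>lborel) = 0"
      by (simp add: \<phi>_def)
  qed
  then show ?thesis unfolding e_def G_def by eventually_elim simp
qed

lemma sqn_shift_diff_axis:
  assumes u: "u \<in> L2" and wg: "weak_grad u g" and g: "(\<lambda>x. g x $ j) \<in> L2"
  shows "sqn (\<lambda>x. u (x + t *\<^sub>R axis j 1) - u x) \<le> t\<^sup>2 * sqn (\<lambda>x. g x $ j)"
proof -
  have pos: "sqn (\<lambda>x. u (x + t *\<^sub>R axis j 1) - u x) \<le> t\<^sup>2 * sqn (\<lambda>x. g x $ j)" if t: "0 \<le> t" for t
  proof -
    have "sqn (\<lambda>x. u (x + t *\<^sub>R axis j 1) - u x) = sqn (line_int j t (\<lambda>x. g x $ j))"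
      using weak_grad_line_identity[OF u wg g t] by (intro sqn_cong_AE L2_diff L2_shift u line_int_L2[OF g t])
    also have "\<dots> \<le> t\<^sup>2 * sqn (\<lambda>x. g x $ j)" by (rule line_int_L2[OF g t])
    finally show ?thesis .
  qed
  show ?thesis
  proof (cases "0 \<le> t")
    case False
    have "sqn (\<lambda>x. u (x + t *\<^sub>R axis j 1) - u x) = sqn (\<lambda>x. u (x + (-t) *\<^sub>R axis j 1 + t *\<^sub>R axis j 1) - u (x + (-t) *\<^sub>R axis j 1))"
      by (rule sqn_shift[symmetric]) (intro L2_diff L2_shift u)
    also have "\<dots> = sqn (\<lambda>x. u (x + (-t) *\<^sub>R axis j 1) - u x)"
      by (subst sqn_minus_commute) simp
    also have "\<dots> \<le> t\<^sup>2 * sqn (\<lambda>x. g x $ j)" using pos[of "-t"] False by simp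
    finally show ?thesis .
  qed (rule pos)
qed

lemma sqn_shift_diff:
  assumes u: "u \<in> L2" and wg: "weak_grad u g" and g: "\<And>j. (\<lambda>x. g x $ j) \<in> L2"
  shows "sqn (\<lambda>x. u (x + h) - u x) \<le> 2 * (norm h)\<^sup>2 * (sqn (\<lambda>x. g x $ 1) + sqn (\<lambda>x. g x $ 2))"
proof -
  have h: "h = (h $ 1) *\<^sub>R axis 1 1 + (h $ 2) *\<^sub>R axis 2 1"
    by (simp add: vec_eq_iff axis_def forall_2)
  let ?y = "(h $ 1) *\<^sub>R axis 1 1 :: R2" and ?z = "(h $ 2) *\<^sub>R axis 2 1 :: R2"
  have "(\<lambda>x. u (x + h) - u x) = (\<lambda>x. (u (x + ?y + ?z) - u (x + ?y)) + (u (x + ?y) - u x))"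
    using h by (auto simp: add.assoc)
  moreover have "(\<lambda>x. u (x + ?y + ?z) - u (x + ?y)) \<in> L2"
    using L2_diff[OF L2_shift[OF u, of "?y + ?z"] L2_shift[OF u, of ?y]] by (simp add: add.assoc)
  ultimately have "sqn (\<lambda>x. u (x + h) - u x) \<le> 2 * sqn (\<lambda>x. u (x + ?y + ?z) - u (x + ?y)) + 2 * sqn (\<lambda>x. u (x + ?y) - u x)"
    by (simp only:) (intro sqn_add_le L2_diff L2_shift u)
  also have "sqn (\<lambda>x. u (x + ?y + ?z) - u (x + ?y)) = sqn (\<lambda>x. u (x + ?z) - u x)"
    by (rule sqn_shift[of "\<lambda>x. u (x + ?z) - u x"]) (intro L2_diff L2_shift u)
  also have "2 * sqn (\<lambda>x. u (x + ?z) - u x) + 2 * sqn (\<lambda>x. u (x + ?y) - u x)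
    \<le> 2 * ((h $ 2)\<^sup>2 * sqn (\<lambda>x. g x $ 2)) + 2 * ((h $ 1)\<^sup>2 * sqn (\<lambda>x. g x $ 1))"
    using sqn_shift_diff_axis[OF u wg g] by (intro add_mono mult_left_mono) auto
  also have "\<dots> \<le> 2 * ((norm h)\<^sup>2 * sqn (\<lambda>x. g x $ 2)) + 2 * ((norm h)\<^sup>2 * sqn (\<lambda>x. g x $ 1))"
    using component_le_norm_cart[of h] by (intro add_mono mult_left_mono mult_right_mono) (auto simp: abs_le_square_iff[symmetric])
  finally show ?thesis by (simp add: algebra_simps)
qed

section \<open>Ladyzhenskaya's inequality\<close>

abbreviation vec2 :: "real \<Rightarrow> real \<Rightarrow> R2" where
  "vec2 a b \<equiv> a *\<^sub>R axis 1 1 + b *\<^sub>R axis 2 1"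

lemma lborel_R2_eq_distr:
  "(lborel :: R2 measure) = distr (lborel \<Otimes>\<^sub>M lborel) borel (\<lambda>(a, b). vec2 a b)"
proof (rule lborel_eqI)
  fix l u :: R2
  assume lu: "\<And>b. b \<in> Basis \<Longrightarrow> l \<bullet> b \<le> u \<bullet> b"
  have le: "l $ i \<le> u $ i" for i
    using lu[of "axis i 1"] by (simp add: inner_axis)
  have "(\<lambda>(a, b). vec2 a b) -` box l u \<inter> space (lborel \<Otimes>\<^sub>M lborel) = {l $ 1<..<u $ 1} \<times> {l $ 2<..<u $ 2}"
    by (auto simp: mem_box_cart forall_2 axis_def space_pair_measure)
  then have "emeasure (distr (lborel \<Otimes>\<^sub>M lborel) borel (\<lambda>(a, b). vec2 a b)) (box l u)
    = emeasure (lborel \<Otimes>\<^sub>M lborel) ({l $ 1<..<u $ 1} \<times> {l $ 2<..<u $ 2})"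
    by (subst emeasure_distr) auto
  also have "\<dots> = ennreal (u $ 1 - l $ 1) * ennreal (u $ 2 - l $ 2)"
    using le by (subst lborel.emeasure_pair_measure_Times) auto
  also have "\<dots> = ennreal (\<Prod>i\<in>UNIV. (u - l) $ i)"
    using le by (simp add: UNIV_2 ennreal_mult)
  also have "(\<Prod>i\<in>UNIV. (u - l) $ i) = (\<Prod>b\<in>Basis. (u - l) \<bullet> b)"
    by (rule prod.reindex_cong[of "\<lambda>i. axis i 1", symmetric])
      (auto simp: inj_on_def axis_eq_axis Basis_vec_def inner_axis)
  finally show "emeasure (distr (lborel \<Otimes>\<^sub>M lborel) borel (\<lambda>(a, b). vec2 a b)) (box l u) = ennreal (\<Prod>b\<in>Basis. (u - l) \<bullet> b)" .
qed simp

lemma nn_integral_R2: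
  assumes [measurable]: "f \<in> borel_measurable borel"
  shows "(\<integral>\<^sup>+x. f x \<partial>lborel) = (\<integral>\<^sup>+a. (\<integral>\<^sup>+b. f (vec2 a b) \<partial>lborel) \<partial>lborel)"
    "(\<integral>\<^sup>+x. f x \<partial>lborel) = (\<integral>\<^sup>+b. (\<integral>\<^sup>+a. f (vec2 a b) \<partial>lborel) \<partial>lborel)"
proof -
  have m: "(\<lambda>(a, b). f (vec2 a b)) \<in> borel_measurable (lborel \<Otimes>\<^sub>M lborel)" by measurable
  have "(\<integral>\<^sup>+x. f x \<partial>lborel) = (\<integral>\<^sup>+z. (\<lambda>(a, b). f (vec2 a b)) z \<partial>(lborel \<Otimes>\<^sub>M lborel))"
    by (subst lborel_R2_eq_distr) (subst nn_integral_distr; simp add: case_prod_unfold)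
  then show "(\<integral>\<^sup>+x. f x \<partial>lborel) = (\<integral>\<^sup>+a. (\<integral>\<^sup>+b. f (vec2 a b) \<partial>lborel) \<partial>lborel)"
    "(\<integral>\<^sup>+x. f x \<partial>lborel) = (\<integral>\<^sup>+b. (\<integral>\<^sup>+a. f (vec2 a b) \<partial>lborel) \<partial>lborel)"
    using lborel.nn_integral_fst[OF m] lborel_pair.nn_integral_snd[OF m] by simp_all
qed

lemma nn_integral_line_product:
  fixes F G :: "R2 \<Rightarrow> ennreal"
  assumes [measurable]: "F \<in> borel_measurable borel" "G \<in> borel_measurable borel"
  shows "(\<integral>\<^sup>+x. (\<integral>\<^sup>+s. F (x + s *\<^sub>R axis 1 1) \<partial>lborel) * (\<integral>\<^sup>+s. G (x + s *\<^sub>R axis 2 1) \<partial>lborel) \<partial>lborel)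
    = (\<integral>\<^sup>+x. F x \<partial>lborel) * (\<integral>\<^sup>+x. G x \<partial>lborel)"
proof -
  have 1: "(\<integral>\<^sup>+s. F (vec2 a b + s *\<^sub>R axis 1 1) \<partial>lborel) = (\<integral>\<^sup>+s. F (vec2 s b) \<partial>lborel)" for a b
  proof -
    have "(\<integral>\<^sup>+s. F (vec2 s b) \<partial>lborel) = (\<integral>\<^sup>+s. F (vec2 (a + 1 * s) b) \<partial>lborel)"
      by (subst nn_integral_real_affine[of _ 1 a]) auto
    then show ?thesis by (simp add: scaleR_left_distrib add.assoc add.commute add.left_commute)
  qed
  have 2: "(\<integral>\<^sup>+s. G (vec2 a b + s *\<^sub>R axis 2 1) \<partial>lborel) = (\<integral>\<^sup>+s. G (vec2 a s) \<partial>lborel)" for a b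
  proof -
    have "(\<integral>\<^sup>+s. G (vec2 a s) \<partial>lborel) = (\<integral>\<^sup>+s. G (vec2 a (b + 1 * s)) \<partial>lborel)"
      by (subst nn_integral_real_affine[of _ 1 b]) auto
    then show ?thesis by (simp add: scaleR_left_distrib add.assoc add.commute add.left_commute)
  qed
  have "(\<integral>\<^sup>+x. (\<integral>\<^sup>+s. F (x + s *\<^sub>R axis 1 1) \<partial>lborel) * (\<integral>\<^sup>+s. G (x + s *\<^sub>R axis 2 1) \<partial>lborel) \<partial>lborel)
    = (\<integral>\<^sup>+a. (\<integral>\<^sup>+b. (\<integral>\<^sup>+s. F (vec2 s b) \<partial>lborel) * (\<integral>\<^sup>+s. G (vec2 a s) \<partial>lborel) \<partial>lborel) \<partial>lborel)"
    by (subst nn_integral_R2(1)) (measurable, simp only: 1 2)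
  also have "\<dots> = (\<integral>\<^sup>+a. (\<integral>\<^sup>+b. (\<integral>\<^sup>+s. F (vec2 s b) \<partial>lborel) \<partial>lborel) * (\<integral>\<^sup>+s. G (vec2 a s) \<partial>lborel) \<partial>lborel)"
    by (intro nn_integral_cong nn_integral_multc) measurable
  also have "\<dots> = (\<integral>\<^sup>+b. (\<integral>\<^sup>+s. F (vec2 s b) \<partial>lborel) \<partial>lborel) * (\<integral>\<^sup>+a. (\<integral>\<^sup>+s. G (vec2 a s) \<partial>lborel) \<partial>lborel)"
    by (rule nn_integral_cmult) measurable
  finally show ?thesis by (simp add: nn_integral_R2(1)[of G] nn_integral_R2(2)[of F])
qed

lemma sq_le_line_integral:
  assumes u: "u \<in> L2" and wg: "weak_grad u g" and g: "(\<lambda>x. g x $ j) \<in> L2" and l: "0 < l"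
  shows "AE x in lborel. ennreal (l * (u x)\<^sup>2)
    \<le> (\<integral>\<^sup>+s. ennreal (2 * (u (x + s *\<^sub>R axis j 1))\<^sup>2 + 2 * l\<^sup>2 * (g (x + s *\<^sub>R axis j 1) $ j)\<^sup>2) \<partial>lborel)"
proof -
  have [measurable]: "u \<in> borel_measurable borel" "(\<lambda>x. g x $ j) \<in> borel_measurable borel" using u g by (auto dest: L2D)
  define G where "G x = (\<integral>\<^sup>+s. ennreal ((g (x + s *\<^sub>R axis j 1) $ j)\<^sup>2) \<partial>lborel)" for x
  have [measurable]: "G \<in> borel_measurable borel" unfolding G_def[abs_def] by measurable
  define P where "P x t \<longleftrightarrow> indicator {0..l} t * ennreal ((u x)\<^sup>2)
     \<le> indicator {0..l} t * (ennreal (2 * (u (x + t *\<^sub>R axis j 1))\<^sup>2) + 2 * ennreal l * G x)" for x t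
  have "AE x in lborel. P x t" for t
  proof (cases "t \<in> {0..l}")
    case True
    then have t: "0 \<le> t" "t \<le> l" by auto
    show ?thesis using weak_grad_line_identity[OF u wg g t(1)]
    proof eventually_elim
      case (elim x)
      have "ennreal ((line_int j t (\<lambda>x. g x $ j) x)\<^sup>2)
        \<le> ennreal t * (\<integral>\<^sup>+s. indicator {0..t} s * ennreal ((g (x + s *\<^sub>R axis j 1) $ j)\<^sup>2) \<partial>lborel)"
        by (rule line_int_sq_le) (use t in auto)
      also have "\<dots> \<le> ennreal l * G x"
        unfolding G_def using t by (intro mult_mono nn_integral_mono) (auto simp: indicator_def intro: ennreal_leI)
      finally have L: "ennreal ((line_int j t (\<lambda>x. g x $ j) x)\<^sup>2) \<le> ennreal l * G x" .
      have "(p - q)\<^sup>2 \<le> 2 * p\<^sup>2 + 2 * q\<^sup>2" for p q :: real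
        using zero_le_power2[of "p + q"] by (simp add: power2_eq_square algebra_simps)
      from this[of "u (x + t *\<^sub>R axis j 1)" "line_int j t (\<lambda>x. g x $ j) x"]
      have "ennreal ((u x)\<^sup>2) \<le> ennreal (2 * (u (x + t *\<^sub>R axis j 1))\<^sup>2 + 2 * (line_int j t (\<lambda>x. g x $ j) x)\<^sup>2)"
        using elim by (intro ennreal_leI) (simp add: algebra_simps)
      also have "\<dots> = ennreal (2 * (u (x + t *\<^sub>R axis j 1))\<^sup>2) + 2 * ennreal ((line_int j t (\<lambda>x. g x $ j) x)\<^sup>2)"
        by (simp add: ennreal_mult)
      also have "\<dots> \<le> ennreal (2 * (u (x + t *\<^sub>R axis j 1))\<^sup>2) + 2 * (ennreal l * G x)"
        by (intro add_left_mono mult_left_mono L) simp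
      finally show ?case using True by (simp add: P_def mult.assoc)
    qed
  qed (simp add: P_def)
  then have "AE t in lborel. AE x in lborel. P x t" by simp
  moreover have "{z \<in> space (lborel \<Otimes>\<^sub>M lborel). P (fst z) (snd z)} \<in> sets (lborel \<Otimes>\<^sub>M lborel)"
  proof -
    have "(\<lambda>z. indicator {0..l} (snd z) * ennreal ((u (fst z))\<^sup>2)) \<in> borel_measurable (lborel \<Otimes>\<^sub>M lborel)"
      by measurable
    moreover have "(\<lambda>z. indicator {0..l} (snd z) * (ennreal (2 * (u (fst z + snd z *\<^sub>R axis j 1))\<^sup>2) + 2 * ennreal l * G (fst z)))
      \<in> borel_measurable (lborel \<Otimes>\<^sub>M lborel)"
      by measurable
    ultimately show ?thesis unfolding P_def by (rule borel_measurable_le)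
  qed
  ultimately have "AE x in lborel. AE t in lborel. P x t"
    using lborel_pair.AE_commute[of P] by blast
  then show ?thesis
  proof eventually_elim
    case (elim x)
    have "ennreal (l * (u x)\<^sup>2) = (\<integral>\<^sup>+t. indicator {0..l} t * ennreal ((u x)\<^sup>2) \<partial>lborel)"
      using l by (subst nn_integral_multc) (auto simp: ennreal_mult)
    also have "\<dots> \<le> (\<integral>\<^sup>+t. indicator {0..l} t * (ennreal (2 * (u (x + t *\<^sub>R axis j 1))\<^sup>2) + 2 * ennreal l * G x) \<partial>lborel)"
      using elim by (intro nn_integral_mono_AE) (simp add: P_def)
    also have "\<dots> \<le> (\<integral>\<^sup>+t. ennreal (2 * (u (x + t *\<^sub>R axis j 1))\<^sup>2) + indicator {0..l} t * (2 * ennreal l * G x) \<partial>lborel)"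
      by (intro nn_integral_mono) (auto simp: indicator_def)
    also have "\<dots> = (\<integral>\<^sup>+t. ennreal (2 * (u (x + t *\<^sub>R axis j 1))\<^sup>2) \<partial>lborel) + ennreal l * (2 * ennreal l * G x)"
      using l by (subst nn_integral_add) (auto simp: nn_integral_multc)
    also have "ennreal l * (2 * ennreal l * G x) = ennreal (2 * l\<^sup>2) * G x"
      using l by (simp add: power2_eq_square ennreal_mult mult.assoc mult.left_commute)
    also have "\<dots> = (\<integral>\<^sup>+s. ennreal (2 * l\<^sup>2) * ennreal ((g (x + s *\<^sub>R axis j 1) $ j)\<^sup>2) \<partial>lborel)"
      unfolding G_def by (rule nn_integral_cmult[symmetric]) measurable
    also have "(\<integral>\<^sup>+t. ennreal (2 * (u (x + t *\<^sub>R axis j 1))\<^sup>2) \<partial>lborel) + \<dots>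
      = (\<integral>\<^sup>+s. ennreal (2 * (u (x + s *\<^sub>R axis j 1))\<^sup>2) + ennreal (2 * l\<^sup>2) * ennreal ((g (x + s *\<^sub>R axis j 1) $ j)\<^sup>2) \<partial>lborel)"
      by (rule nn_integral_add[symmetric]) measurable
    also have "\<dots> = (\<integral>\<^sup>+s. ennreal (2 * (u (x + s *\<^sub>R axis j 1))\<^sup>2 + 2 * l\<^sup>2 * (g (x + s *\<^sub>R axis j 1) $ j)\<^sup>2) \<partial>lborel)"
      by (intro nn_integral_cong) (simp add: ennreal_mult[symmetric] ennreal_plus[symmetric] del: ennreal_plus)
    finally show ?case .
  qed
qed

lemma real_le_16_mult:
  fixes X P R :: real
  assumes P: "0 \<le> P" and R: "0 \<le> R"
    and b: "\<And>l. 0 < l \<Longrightarrow> l\<^sup>2 * X \<le> (2 * P + 2 * l\<^sup>2 * R)\<^sup>2"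
  shows "X \<le> 16 * P * R"
proof -
  have e: "X \<le> 16 * (P + e) * (R + e)" if "e > 0" for e
  proof -
    define p r where "p = P + e" and "r = R + e"
    have pr: "p > 0" "r > 0" using P R that by (auto simp: p_def r_def)
    define l where "l = sqrt (p / r)"
    have l: "l > 0" "l\<^sup>2 = p / r" using pr by (auto simp: l_def)
    have "(2 * P + 2 * l\<^sup>2 * R)\<^sup>2 \<le> (2 * p + 2 * l\<^sup>2 * r)\<^sup>2"
      using P R that l(1) by (intro power_mono add_mono mult_mono) (auto simp: p_def r_def)
    also have "\<dots> = (4 * p)\<^sup>2" using l pr by simp
    finally have "p / r * X \<le> (4 * p)\<^sup>2" using b[OF l(1)] l(2) by simp
    then have "p * X \<le> p * (16 * p * r)" using pr by (simp add: field_simps power2_eq_square)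
    then have "X \<le> 16 * p * r" using pr by simp
    then show ?thesis by (simp add: p_def r_def)
  qed
  have "((\<lambda>e. 16 * (P + e) * (R + e)) \<longlongrightarrow> 16 * (P + 0) * (R + 0)) (at_right 0)"
    by (intro tendsto_intros)
  then have "X \<le> 16 * (P + 0) * (R + 0)"
    by (rule tendsto_lowerbound) (use e in \<open>auto intro: eventually_mono[OF eventually_at_right_less[of 0]]\<close>)
  then show ?thesis by simp
qed

lemma Ladyzhenskaya:
  assumes u: "u \<in> L2" and wg: "weak_grad u g" and g: "\<And>j. (\<lambda>x. g x $ j) \<in> L2"
  shows "integrable lborel (\<lambda>x. (u x)^4)"
    "(\<integral>x. (u x)^4 \<partial>lborel) \<le> 16 * sqn u * (sqn (\<lambda>x. g x $ 1) + sqn (\<lambda>x. g x $ 2))"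
proof -
  have [measurable]: "u \<in> borel_measurable borel" "(\<lambda>x. g x $ j) \<in> borel_measurable borel" for j
    using u g by (auto dest: L2D)
  define R where "R = sqn (\<lambda>x. g x $ 1) + sqn (\<lambda>x. g x $ 2)"
  have R: "0 \<le> R" by (simp add: R_def)
  have bound: "(\<integral>\<^sup>+x. ennreal (l\<^sup>2 * (u x)^4) \<partial>lborel) \<le> ennreal ((2 * sqn u + 2 * l\<^sup>2 * R)\<^sup>2)" if l: "0 < l" for l
  proof -
    define F where "F j x = ennreal (2 * (u x)\<^sup>2 + 2 * l\<^sup>2 * (g x $ j)\<^sup>2)" for j x
    have [measurable]: "F j \<in> borel_measurable borel" for j unfolding F_def[abs_def] by measurable
    have Fint: "(\<integral>\<^sup>+x. F j x \<partial>lborel) \<le> ennreal (2 * sqn u + 2 * l\<^sup>2 * R)" for j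
    proof -
      have "(\<integral>\<^sup>+x. F j x \<partial>lborel) = ennreal (\<integral>x. 2 * (u x)\<^sup>2 + 2 * l\<^sup>2 * (g x $ j)\<^sup>2 \<partial>lborel)"
        unfolding F_def using L2D(2)[OF u] L2D(2)[OF g[of j]] by (intro nn_integral_eq_integral) auto
      also have "(\<integral>x. 2 * (u x)\<^sup>2 + 2 * l\<^sup>2 * (g x $ j)\<^sup>2 \<partial>lborel) = 2 * sqn u + 2 * l\<^sup>2 * sqn (\<lambda>x. g x $ j)"
        unfolding sqn_def using L2D(2)[OF u] L2D(2)[OF g[of j]] by simp
      also have "\<dots> \<le> 2 * sqn u + 2 * l\<^sup>2 * R"
        using exhaust_2[of j] by (intro add_left_mono mult_left_mono) (auto simp: R_def)
      finally show ?thesis by (simp add: ennreal_leI)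
    qed
    have "(\<integral>\<^sup>+x. ennreal (l\<^sup>2 * (u x)^4) \<partial>lborel) = (\<integral>\<^sup>+x. ennreal (l * (u x)\<^sup>2) * ennreal (l * (u x)\<^sup>2) \<partial>lborel)"
      using l by (intro nn_integral_cong) (simp add: ennreal_mult[symmetric] power2_eq_square power4_eq_xxxx algebra_simps)
    also have "\<dots> \<le> (\<integral>\<^sup>+x. (\<integral>\<^sup>+s. F 1 (x + s *\<^sub>R axis 1 1) \<partial>lborel) * (\<integral>\<^sup>+s. F 2 (x + s *\<^sub>R axis 2 1) \<partial>lborel) \<partial>lborel)"
    proof (rule nn_integral_mono_AE)
      show "AE x in lborel. ennreal (l * (u x)\<^sup>2) * ennreal (l * (u x)\<^sup>2)
        \<le> (\<integral>\<^sup>+s. F 1 (x + s *\<^sub>R axis 1 1) \<partial>lborel) * (\<integral>\<^sup>+s. F 2 (x + s *\<^sub>R axis 2 1) \<partial>lborel)"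
        using sq_le_line_integral[OF u wg g[of 1] l] sq_le_line_integral[OF u wg g[of 2] l]
        by eventually_elim (unfold F_def, rule mult_mono, auto)
    qed
    also have "\<dots> = (\<integral>\<^sup>+x. F 1 x \<partial>lborel) * (\<integral>\<^sup>+x. F 2 x \<partial>lborel)"
      by (rule nn_integral_line_product) auto
    also have "\<dots> \<le> ennreal (2 * sqn u + 2 * l\<^sup>2 * R) * ennreal (2 * sqn u + 2 * l\<^sup>2 * R)"
      by (intro mult_mono Fint) auto
    also have "\<dots> = ennreal ((2 * sqn u + 2 * l\<^sup>2 * R)\<^sup>2)"
      using R by (subst ennreal_mult[symmetric]) (auto simp: power2_eq_square)
    finally show ?thesis .
  qed
  show i: "integrable lborel (\<lambda>x. (u x)^4)"
  proof (rule integrableI_bounded)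
    have "(\<integral>\<^sup>+x. ennreal (norm ((u x)^4)) \<partial>lborel) = (\<integral>\<^sup>+x. ennreal (1\<^sup>2 * (u x)^4) \<partial>lborel)" by simp
    also have "\<dots> < \<infinity>" using bound[of 1] by (simp add: order_le_less_trans)
    finally show "(\<integral>\<^sup>+x. ennreal (norm ((u x)^4)) \<partial>lborel) < \<infinity>" .
  qed simp
  show "(\<integral>x. (u x)^4 \<partial>lborel) \<le> 16 * sqn u * (sqn (\<lambda>x. g x $ 1) + sqn (\<lambda>x. g x $ 2))"
    unfolding R_def[symmetric]
  proof (rule real_le_16_mult)
    fix l :: real assume l: "0 < l"
    have "(\<integral>\<^sup>+x. ennreal (l\<^sup>2 * (u x)^4) \<partial>lborel) = ennreal (\<integral>x. l\<^sup>2 * (u x)^4 \<partial>lborel)"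
      using i by (intro nn_integral_eq_integral) auto
    then have "ennreal (l\<^sup>2 * (\<integral>x. (u x)^4 \<partial>lborel)) \<le> ennreal ((2 * sqn u + 2 * l\<^sup>2 * R)\<^sup>2)"
      using bound[OF l] by simp
    then show "l\<^sup>2 * (\<integral>x. (u x)^4 \<partial>lborel) \<le> (2 * sqn u + 2 * l\<^sup>2 * R)\<^sup>2"
      by (subst (asm) ennreal_le_iff) auto
  qed (use R in auto)
qed

section \<open>Weak gradients from difference quotients\<close>

lemma ip_tendsto:
  assumes u: "\<And>n. u n \<in> L2" and w: "w \<in> L2" and v: "v \<in> L2"
    and lim: "(\<lambda>n. sqn (\<lambda>x. u n x - w x)) \<longlonglongrightarrow> 0"
  shows "(\<lambda>n. ip (u n) v) \<longlonglongrightarrow> ip w v"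
proof -
  have "(\<lambda>n. ip (u n) v - ip w v) \<longlonglongrightarrow> 0"
  proof (rule Lim_null_comparison)
    show "\<forall>\<^sub>F n in sequentially. norm (ip (u n) v - ip w v) \<le> sqrt (sqn (\<lambda>x. u n x - w x)) * sqrt (sqn v)"
    proof (intro always_eventually allI)
      fix n
      have "ip (u n) v - ip w v = ip (\<lambda>x. u n x - w x) v"
        using ip_lincomb_right[OF u[of n] w v, of 1 "-1"] by (simp add: ip_commute)
      then show "norm (ip (u n) v - ip w v) \<le> sqrt (sqn (\<lambda>x. u n x - w x)) * sqrt (sqn v)"
        using abs_ip_le[OF L2_diff[OF u w] v, of n] by simp
    qed
    show "(\<lambda>n. sqrt (sqn (\<lambda>x. u n x - w x)) * sqrt (sqn v)) \<longlonglongrightarrow> 0"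
      using tendsto_mult_right[OF tendsto_real_sqrt[OF lim], of "sqrt (sqn v)"] by simp
  qed
  then show ?thesis by (simp add: LIM_zero_iff)
qed

lemma sqn_tendsto:
  assumes u: "\<And>n. u n \<in> L2" and w: "w \<in> L2"
    and lim: "(\<lambda>n. sqn (\<lambda>x. u n x - w x)) \<longlonglongrightarrow> 0"
  shows "(\<lambda>n. sqn (u n)) \<longlonglongrightarrow> sqn w"
proof -
  have "sqn (u n) = sqn (\<lambda>x. u n x - w x) + 2 * ip (u n) w - sqn w" for n
    by (simp add: sqn_diff u w)
  moreover have "(\<lambda>n. sqn (\<lambda>x. u n x - w x) + 2 * ip (u n) w - sqn w) \<longlonglongrightarrow> 0 + 2 * ip w w - sqn w"
    by (intro tendsto_intros lim ip_tendsto[OF u w w])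
  ultimately show ?thesis by (simp add: ip_self)
qed

lemma ip_eq_polarization:
  assumes "a \<in> L2" "b \<in> L2"
  shows "ip a b = (sqn (\<lambda>x. a x + b x) - sqn a - sqn b) / 2"
  using sqn_add[OF assms] by simp

lemma ip_tendsto_both:
  assumes a: "\<And>n. a n \<in> L2" "a' \<in> L2" "(\<lambda>n. sqn (\<lambda>x. a n x - a' x)) \<longlonglongrightarrow> 0"
    and b: "\<And>n. b n \<in> L2" "b' \<in> L2" "(\<lambda>n. sqn (\<lambda>x. b n x - b' x)) \<longlonglongrightarrow> 0"
  shows "(\<lambda>n. ip (a n) (b n)) \<longlonglongrightarrow> ip a' b'"
proof -
  have "(\<lambda>n. sqn (\<lambda>x. (a n x + b n x) - (a' x + b' x))) \<longlonglongrightarrow> 0"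
  proof (rule Lim_null_comparison)
    show "\<forall>\<^sub>F n in sequentially. norm (sqn (\<lambda>x. (a n x + b n x) - (a' x + b' x))) \<le> 2 * sqn (\<lambda>x. a n x - a' x) + 2 * sqn (\<lambda>x. b n x - b' x)"
      using sqn_add_le[OF L2_diff[OF a(1,2)] L2_diff[OF b(1,2)]]
      by (intro always_eventually allI) (simp add: algebra_simps)
    show "(\<lambda>n. 2 * sqn (\<lambda>x. a n x - a' x) + 2 * sqn (\<lambda>x. b n x - b' x)) \<longlonglongrightarrow> 0"
      using tendsto_add[OF tendsto_mult_left[OF a(3), of 2] tendsto_mult_left[OF b(3), of 2]] by simp
  qed
  note s = sqn_tendsto[OF L2_add[OF a(1) b(1)] L2_add[OF a(2) b(2)] this]
  have "(\<lambda>n. (sqn (\<lambda>x. a n x + b n x) - sqn (a n) - sqn (b n)) / 2) \<longlonglongrightarrow> (sqn (\<lambda>x. a' x + b' x) - sqn a' - sqn b') / 2"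
    by (intro tendsto_divide tendsto_diff s sqn_tendsto[OF a] sqn_tendsto[OF b] tendsto_const) simp
  then show ?thesis by (simp add: ip_eq_polarization a b)
qed

lemma Riesz_on_subspace:
  fixes S :: "(R2 \<Rightarrow> real) set" and l :: "(R2 \<Rightarrow> real) \<Rightarrow> real"
  assumes S: "S \<subseteq> L2" "S \<noteq> {}"
    and closed: "\<And>\<phi> \<psi> a b. \<phi> \<in> S \<Longrightarrow> \<psi> \<in> S \<Longrightarrow> (\<lambda>x. a * \<phi> x + b * \<psi> x) \<in> S"
    and lin: "\<And>\<phi> \<psi> a b. \<phi> \<in> S \<Longrightarrow> \<psi> \<in> S \<Longrightarrow> l (\<lambda>x. a * \<phi> x + b * \<psi> x) = a * l \<phi> + b * l \<psi>"
    and C: "0 \<le> C" and bd: "\<And>\<phi>. \<phi> \<in> S \<Longrightarrow> (l \<phi>)\<^sup>2 \<le> C * sqn \<phi>"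
  obtains g where "g \<in> L2" "\<And>\<phi>. \<phi> \<in> S \<Longrightarrow> ip g \<phi> = l \<phi>" "sqn g \<le> C"
proof -
  define J where "J \<phi> = sqn \<phi> - 2 * l \<phi>" for \<phi>
  have SL: "\<phi> \<in> L2" if "\<phi> \<in> S" for \<phi> using S that by auto
  have Jlow: "- C \<le> J \<phi>" if \<phi>: "\<phi> \<in> S" for \<phi>
  proof -
    have "\<bar>l \<phi>\<bar> \<le> sqrt C * sqrt (sqn \<phi>)"
      using bd[OF \<phi>] by (metis real_sqrt_abs real_sqrt_le_iff real_sqrt_mult)
    moreover have "2 * (sqrt C * sqrt (sqn \<phi>)) \<le> C + sqn \<phi>"
      using sum_squares_bound[of "sqrt C" "sqrt (sqn \<phi>)"] C by (simp add: mult.assoc)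
    ultimately show ?thesis unfolding J_def by linarith
  qed
  define m where "m = Inf (J ` S)"
  have bb: "bdd_below (J ` S)" using Jlow by (intro bdd_belowI[of _ "- C"]) auto
  have mle: "m \<le> J \<phi>" if "\<phi> \<in> S" for \<phi> unfolding m_def using bb that by (intro cInf_lower) auto
  have "\<exists>\<phi>. \<phi> \<in> S \<and> J \<phi> < m + 1 / real (Suc n)" for n
  proof -
    have "Inf (J ` S) < m + 1 / real (Suc n)" by (simp add: m_def)
    from cInf_lessD[OF _ this] show ?thesis using S by auto
  qed
  then obtain \<phi> where \<phi>S: "\<And>n. \<phi> n \<in> S" and \<phi>J: "\<And>n. J (\<phi> n) < m + 1 / real (Suc n)" by metis
  have \<phi>L: "\<phi> n \<in> L2" for n using \<phi>S SL by auto
  have cau: "sqn (\<lambda>x. \<phi> i x - \<phi> k x) \<le> 2 * (1 / real (Suc i)) + 2 * (1 / real (Suc k))" for i k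
  proof -
    let ?a = "\<lambda>x. (1/2) * \<phi> i x + (1/2) * \<phi> k x"
    have "m \<le> J ?a" by (rule mle) (intro closed \<phi>S)
    moreover have "J ?a = (sqn (\<phi> i) + 2 * ip (\<phi> i) (\<phi> k) + sqn (\<phi> k)) / 4 - l (\<phi> i) - l (\<phi> k)"
      unfolding J_def sqn_lincomb[OF \<phi>L \<phi>L] lin[OF \<phi>S \<phi>S] by (simp add: power2_eq_square field_simps)
    ultimately have "m \<le> (sqn (\<phi> i) + 2 * ip (\<phi> i) (\<phi> k) + sqn (\<phi> k)) / 4 - l (\<phi> i) - l (\<phi> k)" by simp
    moreover have "s \<le> 2 * p + 2 * q" if "m \<le> (a + 2 * b + c) / 4 - x - y" "a - 2 * x < m + p" "c - 2 * y < m + q"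
      "s = a - 2 * b + c" for a b c x y p q s :: real using that by (auto simp: field_simps)
    ultimately show ?thesis
      using \<phi>J[of i] \<phi>J[of k] sqn_diff[OF \<phi>L[of i] \<phi>L[of k]] unfolding J_def by blast
  qed
  have lim0: "(\<lambda>n. 1 / real (Suc n)) \<longlonglongrightarrow> 0" by (rule LIMSEQ_Suc[OF lim_1_over_n])
  obtain g r where g: "g \<in> L2" "(\<lambda>n. sqn (\<lambda>x. \<phi> n x - g x)) \<longlonglongrightarrow> 0"
  proof (rule L2_complete[of \<phi>])
    show "\<phi> n \<in> L2" for n by (rule \<phi>L)
    fix e :: real assume e: "e > 0"
    then obtain N where N: "\<And>n. n \<ge> N \<Longrightarrow> 1 / real (Suc n) < e / 4"
      using order_tendstoD(2)[OF lim0, of "e/4"] by (auto simp: eventually_sequentially)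
    show "\<exists>N. \<forall>m\<ge>N. \<forall>n\<ge>N. sqn (\<lambda>x. \<phi> m x - \<phi> n x) < e"
    proof (intro exI[of _ N] allI impI)
      fix i k assume "N \<le> i" "N \<le> k"
      then show "sqn (\<lambda>x. \<phi> i x - \<phi> k x) < e" using cau[of i k] N[of i] N[of k] by simp
    qed
  qed blast
  have rep: "ip g \<psi> = l \<psi>" if \<psi>: "\<psi> \<in> S" for \<psi>
  proof -
    have "(ip g \<psi> - l \<psi>)\<^sup>2 \<le> 0 * sqn \<psi>"
    proof (rule quadratic_nonneg_discriminant)
      fix t
      have "m \<le> J (\<phi> n) + (2 * t * (ip (\<phi> n) \<psi> - l \<psi>) + t\<^sup>2 * sqn \<psi>)" for n
      proof -
        have "m \<le> J (\<lambda>x. 1 * \<phi> n x + t * \<psi> x)" by (intro mle closed \<phi>S \<psi>)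
        also have "\<dots> = J (\<phi> n) + (2 * t * (ip (\<phi> n) \<psi> - l \<psi>) + t\<^sup>2 * sqn \<psi>)"
          unfolding J_def sqn_lincomb[OF \<phi>L SL[OF \<psi>]] lin[OF \<phi>S \<psi>] by (simp add: algebra_simps)
        finally show ?thesis .
      qed
      moreover have gen: "0 \<le> p + X" if "m \<le> j + X" "j < m + p" for X j p :: real using that by simp
      ultimately have "0 \<le> 1 / real (Suc n) + (2 * t * (ip (\<phi> n) \<psi> - l \<psi>) + t\<^sup>2 * sqn \<psi>)" for n
        using \<phi>J[of n] by blast
      moreover have "(\<lambda>n. 1 / real (Suc n) + (2 * t * (ip (\<phi> n) \<psi> - l \<psi>) + t\<^sup>2 * sqn \<psi>))
         \<longlonglongrightarrow> 0 + (2 * t * (ip g \<psi> - l \<psi>) + t\<^sup>2 * sqn \<psi>)"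
        by (intro tendsto_intros lim0 ip_tendsto[OF \<phi>L g(1) SL[OF \<psi>] g(2)])
      ultimately have "0 \<le> 0 + (2 * t * (ip g \<psi> - l \<psi>) + t\<^sup>2 * sqn \<psi>)"
        by (intro LIMSEQ_le_const) auto
      then show "0 \<le> 0 + 2 * t * (ip g \<psi> - l \<psi>) + t\<^sup>2 * sqn \<psi>" by simp
    qed simp
    then show ?thesis by simp
  qed
  have "sqn g \<le> C"
  proof -
    have "(ip (\<phi> n) g)\<^sup>2 \<le> C * sqn (\<phi> n)" for n
      using bd[OF \<phi>S[of n]] rep[OF \<phi>S[of n]] by (simp add: ip_commute)
    moreover have "(\<lambda>n. (ip (\<phi> n) g)\<^sup>2) \<longlonglongrightarrow> (ip g g)\<^sup>2"
      by (intro tendsto_intros ip_tendsto[OF \<phi>L g(1) g(1) g(2)])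
    moreover have "(\<lambda>n. C * sqn (\<phi> n)) \<longlonglongrightarrow> C * sqn g"
      by (intro tendsto_intros sqn_tendsto[OF \<phi>L g])
    ultimately have "(ip g g)\<^sup>2 \<le> C * sqn g" by (intro LIMSEQ_le) auto
    then have "sqn g * sqn g \<le> C * sqn g" by (simp add: ip_self power2_eq_square)
    then show ?thesis using C sqn_nonneg[of g] by (cases "sqn g = 0") auto
  qed
  with g(1) rep show ?thesis by (rule that)
qed

lemma test_fun_line_derivative:
  assumes "test_fun \<phi> D"
  shows "((\<lambda>s. \<phi> (x + s *\<^sub>R y)) has_real_derivative D (x + s *\<^sub>R y) y) (at s)"
proof -
  have d: "(\<phi> has_derivative D (x + s *\<^sub>R y)) (at (x + s *\<^sub>R y))" using assms by (simp add: test_fun_def)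
  have "((\<lambda>s. x + s *\<^sub>R y) has_derivative (\<lambda>h. h *\<^sub>R y)) (at s)" by (auto intro!: derivative_eq_intros)
  from has_derivative_compose[OF this d]
  have "((\<lambda>s. \<phi> (x + s *\<^sub>R y)) has_derivative (\<lambda>h. D (x + s *\<^sub>R y) (h *\<^sub>R y))) (at s)" .
  moreover have "D (x + s *\<^sub>R y) (h *\<^sub>R y) = D (x + s *\<^sub>R y) y * h" for h
    using linear_cmul[OF has_derivative_linear[OF d]] by simp
  ultimately show ?thesis by (simp add: has_field_derivative_def)
qed

lemma test_fun_difference_bound:
  assumes "test_fun \<phi> D"
  obtains M R where "0 \<le> M" "\<And>x t. \<bar>\<phi> (x + t *\<^sub>R axis j 1) - \<phi> x\<bar> \<le> M * \<bar>t\<bar>" "\<And>x. R < norm x \<Longrightarrow> \<phi> x = 0"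
proof -
  obtain K where K: "compact K" "\<And>x. x \<notin> K \<Longrightarrow> \<phi> x = 0" "\<And>x y. x \<notin> K \<Longrightarrow> D x y = 0"
    using test_fun_support[OF assms] by blast
  have c: "continuous_on UNIV (\<lambda>x. D x (axis j 1))" using assms by (simp add: test_fun_def)
  have "bounded ((\<lambda>x. D x (axis j 1)) ` K)"
    by (intro compact_imp_bounded compact_continuous_image K continuous_on_subset[OF c]) auto
  then obtain M0 where M0: "\<And>x. x \<in> K \<Longrightarrow> \<bar>D x (axis j 1)\<bar> \<le> M0" by (auto simp: bounded_iff)
  define M where "M = max 0 M0"
  have M: "\<bar>D x (axis j 1)\<bar> \<le> M" for x
    using M0[of x] K(3)[of x] by (cases "x \<in> K") (auto simp: M_def)
  obtain R where R: "\<And>x. x \<in> K \<Longrightarrow> norm x \<le> R" using compact_imp_bounded[OF K(1)] by (auto simp: bounded_iff)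
  have "\<bar>\<phi> (x + t *\<^sub>R axis j 1) - \<phi> x\<bar> \<le> M * \<bar>t\<bar>" for x t
    using field_differentiable_bound[of UNIV "\<lambda>s. \<phi> (x + s *\<^sub>R axis j 1)" "\<lambda>s. D (x + s *\<^sub>R axis j 1) (axis j 1)" M t 0]
      test_fun_line_derivative[OF assms] M by simp
  moreover have "\<phi> x = 0" if "R < norm x" for x using that R[of x] K(2)[of x] by force
  ultimately show ?thesis using that[of M R] by (auto simp: M_def)
qed

lemma test_fun_difference_quotient_tendsto:
  assumes \<phi>: "test_fun \<phi> D" and w: "w \<in> L2" and t: "t \<longlonglongrightarrow> 0" "\<And>n. t n \<noteq> 0" "\<And>n. \<bar>t n\<bar> \<le> 1"
  shows "(\<lambda>n. \<integral>x. w x * ((\<phi> (x + t n *\<^sub>R axis j 1) - \<phi> x) / t n) \<partial>lborel) \<longlonglongrightarrow> (\<integral>x. w x * D x (axis j 1) \<partial>lborel)"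
proof -
  obtain M R where M: "0 \<le> M" "\<And>x t. \<bar>\<phi> (x + t *\<^sub>R axis j 1) - \<phi> x\<bar> \<le> M * \<bar>t\<bar>" and R: "\<And>x. R < norm x \<Longrightarrow> \<phi> x = 0"
    using test_fun_difference_bound[OF \<phi>, of j] by blast
  have [measurable]: "w \<in> borel_measurable borel" "\<phi> \<in> borel_measurable borel" "(\<lambda>x. D x (axis j 1)) \<in> borel_measurable borel"
    using w test_fun_L2[OF \<phi>] by (auto dest: L2D)
  have cb: "(\<lambda>x::R2. indicator (cball 0 (R + 1)) x) \<in> L2"
    using emeasure_bounded_finite[OF bounded_cball[of "0::R2" "R+1"]] by (intro indicator_L2) auto
  show ?thesis
  proof (rule integral_dominated_convergence[where w="\<lambda>x. \<bar>w x * indicator (cball 0 (R + 1)) x\<bar> * M"])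
    show "integrable lborel (\<lambda>x. \<bar>w x * indicator (cball 0 (R + 1)) x\<bar> * M)"
      using L2_mult_integrable[OF w cb] by auto
    show "AE x in lborel. (\<lambda>n. w x * ((\<phi> (x + t n *\<^sub>R axis j 1) - \<phi> x) / t n)) \<longlonglongrightarrow> w x * D x (axis j 1)"
    proof (intro AE_I2 tendsto_mult tendsto_const)
      fix x
      have "((\<lambda>h. (\<phi> (x + h *\<^sub>R axis j 1) - \<phi> x) / h) \<longlongrightarrow> D x (axis j 1)) (at 0)"
        using test_fun_line_derivative[OF \<phi>, of x "axis j 1" 0] by (simp add: DERIV_def)
      moreover have "filterlim t (at 0) sequentially" using t by (intro filterlim_atI) auto
      ultimately show "(\<lambda>n. (\<phi> (x + t n *\<^sub>R axis j 1) - \<phi> x) / t n) \<longlonglongrightarrow> D x (axis j 1)"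
        by (rule filterlim_compose)
    qed
    show "AE x in lborel. norm (w x * ((\<phi> (x + t n *\<^sub>R axis j 1) - \<phi> x) / t n)) \<le> \<bar>w x * indicator (cball 0 (R + 1)) x\<bar> * M" for n
    proof (rule AE_I2)
      fix x
      show "norm (w x * ((\<phi> (x + t n *\<^sub>R axis j 1) - \<phi> x) / t n)) \<le> \<bar>w x * indicator (cball 0 (R + 1)) x\<bar> * M"
      proof (cases "norm x \<le> R + 1")
        case True
        have "\<bar>(\<phi> (x + t n *\<^sub>R axis j 1) - \<phi> x) / t n\<bar> \<le> M"
          using M(2)[of x "t n"] t(2)[of n] by (simp add: field_simps)
        then have "\<bar>w x\<bar> * \<bar>(\<phi> (x + t n *\<^sub>R axis j 1) - \<phi> x) / t n\<bar> \<le> \<bar>w x\<bar> * M"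
          by (rule mult_left_mono) simp
        then show ?thesis using True by (simp add: abs_mult)
      next
        case False
        have "norm (t n *\<^sub>R axis j (1::real) :: R2) \<le> 1" using t(3)[of n] by simp
        then have "R < norm (x + t n *\<^sub>R axis j 1)"
          using False norm_triangle_ineq2[of x "- (t n *\<^sub>R axis j 1)"] by simp
        then show ?thesis using False R by simp
      qed
    qed
  qed measurable
qed

lemma integral_mult_difference_quotient:
  assumes w: "w \<in> L2" and \<phi>: "\<phi> \<in> L2"
  shows "(\<integral>x. w x * ((\<phi> (x + h) - \<phi> x) / t) \<partial>lborel) = (\<integral>x. ((w (x - h) - w x) / t) * \<phi> x \<partial>lborel)"
proof -
  have wh: "(\<lambda>x. w (x - h)) \<in> L2" using L2_shift[OF w, of "- h"] by simp
  have [measurable]: "w \<in> borel_measurable borel" "\<phi> \<in> borel_measurable borel" using w \<phi> by (auto dest: L2D)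
  have "(\<integral>x. w x * ((\<phi> (x + h) - \<phi> x) / t) \<partial>lborel) = ((\<integral>x. w x * \<phi> (x + h) \<partial>lborel) - (\<integral>x. w x * \<phi> x \<partial>lborel)) / t"
    using L2_mult_integrable[OF w L2_shift[OF \<phi>, of h]] L2_mult_integrable[OF w \<phi>]
    by (simp add: right_diff_distrib)
  also have "(\<integral>x. w x * \<phi> (x + h) \<partial>lborel) = (\<integral>x. w (x - h) * \<phi> x \<partial>lborel)"
    using integral_shift[of "\<lambda>x. w (x - h) * \<phi> x" h] by simp
  also have "((\<integral>x. w (x - h) * \<phi> x \<partial>lborel) - (\<integral>x. w x * \<phi> x \<partial>lborel)) / t = (\<integral>x. ((w (x - h) - w x) / t) * \<phi> x \<partial>lborel)"
    using L2_mult_integrable[OF wh \<phi>] L2_mult_integrable[OF w \<phi>]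
    by (simp add: left_diff_distrib)
  finally show ?thesis .
qed

lemma test_fun_lincomb:
  assumes "test_fun \<phi> D" "test_fun \<psi> D'"
  shows "test_fun (\<lambda>x. a * \<phi> x + b * \<psi> x) (\<lambda>x y. a * D x y + b * D' x y)"
proof -
  obtain K K' where "compact K" "\<And>x. x \<notin> K \<Longrightarrow> \<phi> x = 0" "compact K'" "\<And>x. x \<notin> K' \<Longrightarrow> \<psi> x = 0"
    using assms unfolding test_fun_def by blast
  then have "compact (K \<union> K') \<and> (\<forall>x. x \<notin> K \<union> K' \<longrightarrow> a * \<phi> x + b * \<psi> x = 0)" by auto
  then show ?thesis using assms unfolding test_fun_def
    by (auto intro!: derivative_eq_intros continuous_intros)
qed

lemma weak_grad_of_difference_bound:
  assumes w: "w \<in> L2" and C: "\<And>j. 0 \<le> C j"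
    and bd: "\<And>j t. sqn (\<lambda>x. w (x + t *\<^sub>R axis j 1) - w x) \<le> t\<^sup>2 * C j"
  obtains g where "weak_grad w g" "\<And>j. (\<lambda>x. g x $ j) \<in> L2" "\<And>j. sqn (\<lambda>x. g x $ j) \<le> C j"
proof -
  define S where "S = {\<phi>. \<exists>D. test_fun \<phi> D}"
  define l where "l j \<phi> = - (\<integral>x. w x * frechet_derivative \<phi> (at x) (axis j 1) \<partial>lborel)" for j \<phi>
  have l: "l j \<phi> = - (\<integral>x. w x * D x (axis j 1) \<partial>lborel)" if "test_fun \<phi> D" for j \<phi> D
  proof -
    have "frechet_derivative \<phi> (at x) = D x" for x
      using that frechet_derivative_at[of \<phi> "D x" x] by (simp add: test_fun_def)
    then show ?thesis by (simp add: l_def)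
  qed
  have "\<exists>g. g \<in> L2 \<and> (\<forall>\<phi>\<in>S. ip g \<phi> = l j \<phi>) \<and> sqn g \<le> C j" for j
  proof -
    obtain g where "g \<in> L2" "\<And>\<phi>. \<phi> \<in> S \<Longrightarrow> ip g \<phi> = l j \<phi>" "sqn g \<le> C j"
    proof (rule Riesz_on_subspace[of S "l j" "C j"])
      show "S \<subseteq> L2" using test_fun_L2 by (auto simp: S_def)
      have "test_fun (\<lambda>x. 0) (\<lambda>x y. 0)" by (auto simp: test_fun_def intro!: exI[of _ "{}"])
      then show "S \<noteq> {}" unfolding S_def by blast
      show "(\<lambda>x. a * \<phi> x + b * \<psi> x) \<in> S" if "\<phi> \<in> S" "\<psi> \<in> S" for \<phi> \<psi> a b
        using that test_fun_lincomb unfolding S_def by blast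
      show "l j (\<lambda>x. a * \<phi> x + b * \<psi> x) = a * l j \<phi> + b * l j \<psi>" if S2: "\<phi> \<in> S" "\<psi> \<in> S" for \<phi> \<psi> a b
      proof -
        obtain D D' where D: "test_fun \<phi> D" "test_fun \<psi> D'" using S2 by (auto simp: S_def)
        have "(\<integral>x. w x * (a * D x (axis j 1) + b * D' x (axis j 1)) \<partial>lborel)
          = a * (\<integral>x. w x * D x (axis j 1) \<partial>lborel) + b * (\<integral>x. w x * D' x (axis j 1) \<partial>lborel)"
          using ip_lincomb_right[OF test_fun_L2(2)[OF D(1)] test_fun_L2(2)[OF D(2)] w] by (simp add: ip_def)
        then show ?thesis using l[OF D(1)] l[OF D(2)] l[OF test_fun_lincomb[OF D]] by simp
      qed
      show "(l j \<phi>)\<^sup>2 \<le> C j * sqn \<phi>" if S1: "\<phi> \<in> S" for \<phi>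
      proof -
        obtain D where D: "test_fun \<phi> D" using S1 by (auto simp: S_def)
        have \<phi>L: "\<phi> \<in> L2" by (rule test_fun_L2[OF D])
        define t where "t n = 1 / real (Suc n)" for n
        have t: "t \<longlonglongrightarrow> 0" "\<And>n. t n \<noteq> 0" "\<And>n. \<bar>t n\<bar> \<le> 1"
          unfolding t_def by (rule LIMSEQ_Suc[OF lim_1_over_n]) auto
        let ?I = "\<lambda>n. \<integral>x. w x * ((\<phi> (x + t n *\<^sub>R axis j 1) - \<phi> x) / t n) \<partial>lborel"
        have "(?I n)\<^sup>2 \<le> C j * sqn \<phi>" for n
        proof -
          let ?q = "\<lambda>x. (1 / t n) * (w (x + (- t n) *\<^sub>R axis j 1) - w x)"
          have qL: "?q \<in> L2" by (intro L2_scale L2_diff L2_shift w)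
          have "?I n = ip ?q \<phi>"
            using integral_mult_difference_quotient[OF w \<phi>L, of "t n *\<^sub>R axis j 1" "t n"] by (simp add: ip_def)
          then have "(?I n)\<^sup>2 \<le> sqn ?q * sqn \<phi>" using ip_Cauchy_Schwarz[OF qL \<phi>L] by simp
          also have "sqn ?q \<le> (1 / t n)\<^sup>2 * ((- t n)\<^sup>2 * C j)"
            unfolding sqn_scale by (intro mult_left_mono bd) simp
          also have "\<dots> = C j" using t(2)[of n] by (simp add: field_simps power2_eq_square)
          finally show ?thesis by (simp add: mult_right_mono)
        qed
        moreover have "(\<lambda>n. (?I n)\<^sup>2) \<longlonglongrightarrow> (\<integral>x. w x * D x (axis j 1) \<partial>lborel)\<^sup>2"
          by (intro tendsto_power test_fun_difference_quotient_tendsto[OF D w t])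
        ultimately have "(\<integral>x. w x * D x (axis j 1) \<partial>lborel)\<^sup>2 \<le> C j * sqn \<phi>"
          by (intro LIMSEQ_le_const2) auto
        then show ?thesis by (simp add: l[OF D])
      qed
    qed (use C in auto)
    then show ?thesis by blast
  qed
  then obtain G where G: "\<And>j. G j \<in> L2" "\<And>j \<phi>. \<phi> \<in> S \<Longrightarrow> ip (G j) \<phi> = l j \<phi>" "\<And>j. sqn (G j) \<le> C j" by metis
  define g :: "R2 \<Rightarrow> R2" where "g x = (\<chi> j. G j x)" for x
  have gj: "(\<lambda>x. g x $ j) = G j" for j by (auto simp: g_def)
  have "weak_grad w g"
    unfolding weak_grad_def
  proof (intro conjI allI impI)
    have "(\<lambda>x. g x \<bullet> b) \<in> borel_measurable borel" if b: "b \<in> Basis" for b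
    proof -
      obtain j where "b = axis j 1" using b by (auto simp: Basis_vec_def)
      then have "(\<lambda>x. g x \<bullet> b) = G j" using gj[of j] by (simp add: inner_axis)
      then show ?thesis using L2D(1)[OF G(1)[of j]] by simp
    qed
    then show "g \<in> borel_measurable lborel" by (subst borel_measurable_euclidean_space) auto
    fix \<phi> D j assume D: "test_fun \<phi> D"
    then have "ip (G j) \<phi> = l j \<phi>" by (intro G) (auto simp: S_def)
    then show "(\<integral>x. w x * D x (axis j 1) \<partial>lborel) = - (\<integral>x. g x $ j * \<phi> x \<partial>lborel)"
      by (simp add: l[OF D] ip_def g_def)
  qed
  then show ?thesis using that[of g] G gj by simp
qed

lemma weak_grad_abs:
  assumes u: "u \<in> L2" and wg: "weak_grad u g" and g: "\<And>j. (\<lambda>x. g x $ j) \<in> L2"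
  obtains h where "weak_grad (\<lambda>x. \<bar>u x\<bar>) h" "\<And>j. (\<lambda>x. h x $ j) \<in> L2" "\<And>j. sqn (\<lambda>x. h x $ j) \<le> sqn (\<lambda>x. g x $ j)"
proof (rule weak_grad_of_difference_bound[OF L2_abs[OF u], of "\<lambda>j. sqn (\<lambda>x. g x $ j)"])
  fix j t
  have "sqn (\<lambda>x. \<bar>u (x + t *\<^sub>R axis j 1)\<bar> - \<bar>u x\<bar>) \<le> sqn (\<lambda>x. u (x + t *\<^sub>R axis j 1) - u x)"
    unfolding sqn_def
  proof (rule integral_mono)
    show "integrable lborel (\<lambda>x. (\<bar>u (x + t *\<^sub>R axis j 1)\<bar> - \<bar>u x\<bar>)\<^sup>2)"
      by (intro L2D L2_diff L2_abs L2_shift[of "\<lambda>x. \<bar>u x\<bar>"] u)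
    show "integrable lborel (\<lambda>x. (u (x + t *\<^sub>R axis j 1) - u x)\<^sup>2)" by (intro L2D L2_diff L2_shift u)
    show "(\<bar>u (x + t *\<^sub>R axis j 1)\<bar> - \<bar>u x\<bar>)\<^sup>2 \<le> (u (x + t *\<^sub>R axis j 1) - u x)\<^sup>2" for x
      by (simp add: abs_le_square_iff[symmetric])
  qed
  also have "\<dots> \<le> t\<^sup>2 * sqn (\<lambda>x. g x $ j)" by (rule sqn_shift_diff_axis[OF u wg g])
  finally show "sqn (\<lambda>x. \<bar>u (x + t *\<^sub>R axis j 1)\<bar> - \<bar>u x\<bar>) \<le> t\<^sup>2 * sqn (\<lambda>x. g x $ j)" .
qed (use that in auto)

section \<open>Compactness\<close>

definition ball_avg :: "real \<Rightarrow> (R2 \<Rightarrow> real) \<Rightarrow> R2 \<Rightarrow> real" where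
  "ball_avg d u x = ip (\<lambda>h. indicator (cball 0 d) h) (\<lambda>h. u (h + x)) / measure lborel (cball 0 d :: R2 set)"

lemma indicator_cball_L2: "(\<lambda>h::R2. indicator (cball 0 d) h) \<in> L2"
  using emeasure_bounded_finite[OF bounded_cball[of "0::R2" d]] by (intro indicator_L2) auto

lemma sqn_indicator_cball: "sqn (\<lambda>h. indicator (cball 0 d) h) = measure lborel (cball 0 d :: R2 set)"
proof -
  have "(\<lambda>x. (indicator (cball 0 d) x)\<^sup>2) = (indicator (cball 0 d) :: R2 \<Rightarrow> real)" by (auto simp: indicator_def fun_eq_iff)
  then show ?thesis by (simp add: sqn_def)
qed

lemma ball_avg_sq_le:
  assumes u: "u \<in> L2" and d: "0 < d"
  shows "(ball_avg d u x)\<^sup>2 \<le> sqn u / measure lborel (cball 0 d :: R2 set)"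
proof -
  let ?m = "measure lborel (cball 0 d :: R2 set)"
  have m: "0 < ?m" using content_cball_pos[OF d] by simp
  have "(ip (\<lambda>h. indicator (cball 0 d) h) (\<lambda>h. u (h + x)))\<^sup>2 \<le> ?m * sqn u"
    using ip_Cauchy_Schwarz[OF indicator_cball_L2[of d] L2_shift[OF u, of x]] sqn_indicator_cball[of d] sqn_shift[OF u, of x] by simp
  then have "(ip (\<lambda>h. indicator (cball 0 d) h) (\<lambda>h. u (h + x)))\<^sup>2 / ?m\<^sup>2 \<le> ?m * sqn u / ?m\<^sup>2"
    by (rule divide_right_mono) simp
  also have "?m * sqn u / ?m\<^sup>2 = sqn u / ?m" using m by (simp add: power2_eq_square)
  finally show ?thesis by (simp add: ball_avg_def power_divide)
qed

lemma ball_avg_diff: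
  assumes u: "u \<in> L2"
  shows "ball_avg d u (x + y) - ball_avg d u x = ball_avg d (\<lambda>x. u (x + y) - u x) x"
  using ip_lincomb_right[OF L2_shift[OF u, of "x + y"] L2_shift[OF u, of x] indicator_cball_L2[of d], of 1 "-1"]
  by (simp add: ball_avg_def diff_divide_distrib add.assoc)

lemma ball_avg_minus_self:
  assumes u: "u \<in> L2" and d: "0 < d"
    and tr: "\<And>h. sqn (\<lambda>x. u (x + h) - u x) \<le> C * (norm h)\<^sup>2" and C: "0 \<le> C"
  shows "(\<lambda>x. ball_avg d u x - u x) \<in> L2" "sqn (\<lambda>x. ball_avg d u x - u x) \<le> C * d\<^sup>2"
proof -
  have um[measurable]: "u \<in> borel_measurable borel" using u by (rule L2D)
  have [measurable]: "cball (0::R2) d \<in> sets borel" by (simp add: borel_closed)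
  let ?m = "measure lborel (cball 0 d :: R2 set)"
  let ?I = "\<lambda>h::R2. indicator (cball 0 d) h :: real"
  have m: "0 < ?m" using content_cball_pos[OF d] by simp
  have em: "emeasure lborel (cball 0 d :: R2 set) = ennreal ?m"
    using emeasure_bounded_finite[OF bounded_cball[of "0::R2" d]] by (intro emeasure_eq_ennreal_measure) auto
  have "(\<lambda>x. \<integral>h. ?I h * u (h + x) \<partial>lborel) \<in> borel_measurable lborel"
    by (rule lborel.borel_measurable_lebesgue_integral) measurable
  then have [measurable]: "ball_avg d u \<in> borel_measurable borel"
    unfolding ball_avg_def[abs_def] ip_def by simp
  have pt: "ennreal ((ball_avg d u x - u x)\<^sup>2) \<le> ennreal (1 / ?m) * (\<integral>\<^sup>+h. indicator (cball 0 d) h * ennreal ((u (x + h) - u x)\<^sup>2) \<partial>lborel)" for x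
  proof -
    have i: "integrable lborel (\<lambda>h. ?I h * u (h + x))"
      by (rule L2_mult_integrable[OF indicator_cball_L2 L2_shift[OF u]])
    have Ii: "integrable lborel ?I" using em by (intro integrable_real_indicator) auto
    have "ball_avg d u x - u x = (\<integral>h. ?I h * (u (x + h) - u x) \<partial>lborel) / ?m"
    proof -
      have "(\<integral>h. ?I h * (u (x + h) - u x) \<partial>lborel) = (\<integral>h. ?I h * u (h + x) - u x * ?I h \<partial>lborel)"
        by (simp add: algebra_simps)
      also have "\<dots> = (\<integral>h. ?I h * u (h + x) \<partial>lborel) - u x * ?m" using i Ii by simp
      finally show ?thesis using m by (simp add: ball_avg_def ip_def field_simps)
    qed
    then have "ennreal ((ball_avg d u x - u x)\<^sup>2) = ennreal (1 / ?m\<^sup>2) * (ennreal \<bar>\<integral>h. ?I h * (u (x + h) - u x) \<partial>lborel\<bar>)\<^sup>2"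
      by (simp add: power_divide ennreal_power ennreal_mult'[symmetric])
    also have "(ennreal \<bar>\<integral>h. ?I h * (u (x + h) - u x) \<partial>lborel\<bar>)\<^sup>2
       \<le> (\<integral>\<^sup>+h. indicator (cball 0 d) h * (indicator (cball 0 d) h * ennreal \<bar>u (x + h) - u x\<bar>) \<partial>lborel)\<^sup>2"
    proof (rule power_mono)
      have "ennreal \<bar>\<integral>h. ?I h * (u (x + h) - u x) \<partial>lborel\<bar> \<le> (\<integral>\<^sup>+h. ennreal \<bar>?I h * (u (x + h) - u x)\<bar> \<partial>lborel)"
        by (rule ennreal_abs_integral_le)
      also have "\<dots> = (\<integral>\<^sup>+h. indicator (cball 0 d) h * (indicator (cball 0 d) h * ennreal \<bar>u (x + h) - u x\<bar>) \<partial>lborel)"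
        by (intro nn_integral_cong) (auto simp: indicator_def)
      finally show "ennreal \<bar>\<integral>h. ?I h * (u (x + h) - u x) \<partial>lborel\<bar> \<le> (\<integral>\<^sup>+h. indicator (cball 0 d) h * (indicator (cball 0 d) h * ennreal \<bar>u (x + h) - u x\<bar>) \<partial>lborel)" .
    qed simp
    also have "\<dots> \<le> (\<integral>\<^sup>+h. (indicator (cball (0::R2) d) h)\<^sup>2 \<partial>lborel) * (\<integral>\<^sup>+h. (indicator (cball 0 d) h * ennreal \<bar>u (x + h) - u x\<bar>)\<^sup>2 \<partial>lborel)"
      by (rule Cauchy_Schwarz_nn_integral) measurable
    also have "(\<integral>\<^sup>+h. (indicator (cball (0::R2) d) h)\<^sup>2 \<partial>lborel) = (\<integral>\<^sup>+h. indicator (cball (0::R2) d) h \<partial>lborel)"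
      by (intro nn_integral_cong) (auto simp: indicator_def)
    also have "\<dots> = ennreal ?m" using em by simp
    also have "(\<integral>\<^sup>+h. (indicator (cball 0 d) h * ennreal \<bar>u (x + h) - u x\<bar>)\<^sup>2 \<partial>lborel)
      = (\<integral>\<^sup>+h. indicator (cball 0 d) h * ennreal ((u (x + h) - u x)\<^sup>2) \<partial>lborel)"
      by (intro nn_integral_cong) (auto simp: indicator_def ennreal_power)
    finally have "ennreal ((ball_avg d u x - u x)\<^sup>2) \<le> ennreal (1 / ?m\<^sup>2) * (ennreal ?m * (\<integral>\<^sup>+h. indicator (cball 0 d) h * ennreal ((u (x + h) - u x)\<^sup>2) \<partial>lborel))"
      by (simp add: mult_left_mono)
    moreover have "ennreal (1 / ?m\<^sup>2) * ennreal ?m = ennreal (1 / ?m)"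
      using m by (simp add: ennreal_mult[symmetric] power2_eq_square)
    ultimately show ?thesis by (simp add: mult.assoc[symmetric])
  qed
  have "(\<integral>\<^sup>+x. ennreal ((ball_avg d u x - u x)\<^sup>2) \<partial>lborel)
    \<le> (\<integral>\<^sup>+x. ennreal (1 / ?m) * (\<integral>\<^sup>+h. indicator (cball 0 d) h * ennreal ((u (x + h) - u x)\<^sup>2) \<partial>lborel) \<partial>lborel)"
    by (intro nn_integral_mono pt)
  also have "\<dots> = ennreal (1 / ?m) * (\<integral>\<^sup>+x. (\<integral>\<^sup>+h. indicator (cball 0 d) h * ennreal ((u (x + h) - u x)\<^sup>2) \<partial>lborel) \<partial>lborel)"
    by (rule nn_integral_cmult) measurable
  also have "(\<integral>\<^sup>+x. (\<integral>\<^sup>+h. indicator (cball 0 d) h * ennreal ((u (x + h) - u x)\<^sup>2) \<partial>lborel) \<partial>lborel)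
     = (\<integral>\<^sup>+h. (\<integral>\<^sup>+x. indicator (cball 0 d) h * ennreal ((u (x + h) - u x)\<^sup>2) \<partial>lborel) \<partial>lborel)"
    by (rule lborel_pair.Fubini'[symmetric]) measurable
  also have "\<dots> \<le> (\<integral>\<^sup>+h. indicator (cball (0::R2) d) h * ennreal (C * d\<^sup>2) \<partial>lborel)"
  proof (rule nn_integral_mono)
    fix h :: R2
    have "(\<integral>\<^sup>+x. indicator (cball 0 d) h * ennreal ((u (x + h) - u x)\<^sup>2) \<partial>lborel)
      = indicator (cball 0 d) h * ennreal (sqn (\<lambda>x. u (x + h) - u x))"
      by (subst nn_integral_cmult) (auto simp: nn_integral_sq_eq_sqn L2_diff L2_shift u)
    also have "\<dots> \<le> indicator (cball 0 d) h * ennreal (C * d\<^sup>2)"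
    proof (cases "norm h \<le> d")
      case True
      have "sqn (\<lambda>x. u (x + h) - u x) \<le> C * (norm h)\<^sup>2" by (rule tr)
      also have "\<dots> \<le> C * d\<^sup>2" using True C by (intro mult_left_mono power_mono) auto
      finally show ?thesis by (intro mult_left_mono ennreal_leI) auto
    qed simp
    finally show "(\<integral>\<^sup>+x. indicator (cball 0 d) h * ennreal ((u (x + h) - u x)\<^sup>2) \<partial>lborel) \<le> indicator (cball 0 d) h * ennreal (C * d\<^sup>2)" .
  qed
  also have "\<dots> = ennreal ?m * ennreal (C * d\<^sup>2)" using em by (subst nn_integral_multc) auto
  finally have "(\<integral>\<^sup>+x. ennreal ((ball_avg d u x - u x)\<^sup>2) \<partial>lborel) \<le> ennreal (1 / ?m) * (ennreal ?m * ennreal (C * d\<^sup>2))"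
    by (simp add: mult_left_mono)
  also have "\<dots> = ennreal (C * d\<^sup>2)"
    using m C by (simp add: ennreal_mult[symmetric])
  finally have *: "(\<integral>\<^sup>+x. ennreal ((ball_avg d u x - u x)\<^sup>2) \<partial>lborel) \<le> ennreal (C * d\<^sup>2)" .
  show "(\<lambda>x. ball_avg d u x - u x) \<in> L2" "sqn (\<lambda>x. ball_avg d u x - u x) \<le> C * d\<^sup>2"
    by (rule L2_sqn_le_nn_integral[OF _ *]; use C in simp)+
qed

lemma L2_compactness:
  fixes u :: "nat \<Rightarrow> R2 \<Rightarrow> real"
  assumes L: "\<And>n. u n \<in> L2" and C: "0 \<le> C" and sq: "\<And>n. sqn (u n) \<le> C"
    and tr: "\<And>n h. sqn (\<lambda>x. u n (x + h) - u n x) \<le> C * (norm h)\<^sup>2"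
    and tail: "\<And>e. 0 < e \<Longrightarrow> \<exists>R. \<forall>n. (\<integral>x. indicator (- cball 0 R) x * (u n x)\<^sup>2 \<partial>lborel) \<le> e"
  obtains r where "strict_mono (r :: nat \<Rightarrow> nat)"
    "\<And>e. 0 < e \<Longrightarrow> \<exists>N. \<forall>m\<ge>N. \<forall>n\<ge>N. sqn (\<lambda>x. u (r m) x - u (r n) x) < e"
proof -
  have [measurable]: "u n \<in> borel_measurable borel" for n using L by (rule L2D)
  define d where "d k = 1 / real (Suc k)" for k
  have d: "0 < d k" for k by (simp add: d_def)
  define A where "A k n = ball_avg (d k) (u n)" for k n
  define P where "P k s \<longleftrightarrow> (\<forall>e>0. \<exists>N. \<forall>m\<ge>N. \<forall>n\<ge>N. \<forall>x\<in>cball 0 (real k). \<bar>A k (s m) x - A k (s n) x\<bar> < e)"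
    for k and s :: "nat \<Rightarrow> nat"
  obtain r where r: "strict_mono r" "\<And>k. P k (id \<circ> r)"
  proof (rule subsequence_diagonalization_lemma[of P id])
    fix k and s :: "nat \<Rightarrow> nat"
    let ?m = "measure lborel (cball 0 (d k) :: R2 set)"
    have m: "0 < ?m" using content_cball_pos[OF d] by simp
    define M where "M = sqrt (C / ?m)"
    have M0: "0 \<le> M" using C m by (simp add: M_def)
    have lip: "\<bar>A k n x - A k n y\<bar> \<le> M * norm (x - y)" for n x y
    proof -
      have "A k n x - A k n y = ball_avg (d k) (\<lambda>z. u n (z + (x - y)) - u n z) y"
        using ball_avg_diff[OF L[of n], of "d k" y "x - y"] by (simp add: A_def)
      then have "(A k n x - A k n y)\<^sup>2 \<le> sqn (\<lambda>z. u n (z + (x - y)) - u n z) / ?m"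
        using ball_avg_sq_le[OF L2_diff[OF L2_shift[OF L[of n], of "x - y"] L[of n]] d[of k], of y] by simp
      also have "\<dots> \<le> C * (norm (x - y))\<^sup>2 / ?m" using m by (intro divide_right_mono tr) simp
      finally have "\<bar>A k n x - A k n y\<bar> \<le> sqrt (C * (norm (x - y))\<^sup>2 / ?m)"
        by (intro real_le_rsqrt) simp
      also have "\<dots> = M * norm (x - y)" unfolding M_def by (simp add: real_sqrt_mult real_sqrt_divide)
      finally show ?thesis .
    qed
    have bd: "\<bar>A k n x\<bar> \<le> M" for n x
    proof -
      have "(A k n x)\<^sup>2 \<le> sqn (u n) / ?m" unfolding A_def by (rule ball_avg_sq_le[OF L d])
      also have "\<dots> \<le> C / ?m" using m sq by (intro divide_right_mono) auto
      finally show ?thesis unfolding M_def by (intro real_le_rsqrt) simp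
    qed
    obtain g t where t: "strict_mono (t :: nat \<Rightarrow> nat)"
      "\<And>e. 0 < e \<Longrightarrow> \<exists>N. \<forall>n x. n \<ge> N \<and> x \<in> cball 0 (real k) \<longrightarrow> norm (A k (s (t n)) x - g x) < e"
    proof (rule Arzela_Ascoli[of "cball (0::R2) (real k)" "\<lambda>n. A k (s n)" M])
      show "norm (A k (s n) x) \<le> M" for n x using bd by simp
      fix x :: R2 and e :: real assume e: "0 < e"
      show "\<exists>d>0. \<forall>n y. y \<in> cball 0 (real k) \<and> norm (x - y) < d \<longrightarrow> norm (A k (s n) x - A k (s n) y) < e"
      proof (intro exI[of _ "e / (M + 1)"] conjI allI impI)
        show "0 < e / (M + 1)" using e M0 by simp
        fix n y assume y: "y \<in> cball 0 (real k) \<and> norm (x - y) < e / (M + 1)"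
        have "norm (A k (s n) x - A k (s n) y) \<le> M * norm (x - y)" using lip by simp
        also have "\<dots> \<le> (M + 1) * norm (x - y)" by (intro mult_right_mono) auto
        also have "\<dots> < (M + 1) * (e / (M + 1))" using y M0 by (intro mult_strict_left_mono) auto
        also have "\<dots> = e" using M0 by simp
        finally show "norm (A k (s n) x - A k (s n) y) < e" .
      qed
    qed auto
    have "P k (s \<circ> t)"
      unfolding P_def
    proof (intro allI impI)
      fix e :: real assume "0 < e"
      then obtain N where N: "\<And>n x. n \<ge> N \<Longrightarrow> x \<in> cball 0 (real k) \<Longrightarrow> norm (A k (s (t n)) x - g x) < e / 2"
        using t(2)[of "e/2"] by auto
      show "\<exists>N. \<forall>m\<ge>N. \<forall>n\<ge>N. \<forall>x\<in>cball 0 (real k). \<bar>A k ((s \<circ> t) m) x - A k ((s \<circ> t) n) x\<bar> < e"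
      proof (intro exI[of _ N] allI impI ballI)
        fix m n x assume "N \<le> m" "N \<le> n" "x \<in> cball (0::R2) (real k)"
        then show "\<bar>A k ((s \<circ> t) m) x - A k ((s \<circ> t) n) x\<bar> < e"
          using N[of m x] N[of n x] unfolding real_norm_def o_def by linarith
      qed
    qed
    then show "\<exists>t. strict_mono t \<and> P k (s \<circ> t)" using t(1) by blast
  next
    fix k N and s k1 k2 :: "nat \<Rightarrow> nat"
    assume P1: "P k (s \<circ> k1)" and sub: "\<And>j. N \<le> j \<Longrightarrow> \<exists>j'\<ge>j. k2 j = k1 j'"
    show "P k (s \<circ> k2)"
      unfolding P_def
    proof (intro allI impI)
      fix e :: real assume "0 < e"
      then obtain N' where N': "\<And>m n x. m \<ge> N' \<Longrightarrow> n \<ge> N' \<Longrightarrow> x \<in> cball 0 (real k) \<Longrightarrow> \<bar>A k ((s \<circ> k1) m) x - A k ((s \<circ> k1) n) x\<bar> < e"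
        using P1 unfolding P_def by blast
      show "\<exists>N. \<forall>m\<ge>N. \<forall>n\<ge>N. \<forall>x\<in>cball 0 (real k). \<bar>A k ((s \<circ> k2) m) x - A k ((s \<circ> k2) n) x\<bar> < e"
      proof (intro exI[of _ "max N N'"] allI impI ballI)
        fix m n x assume mn: "max N N' \<le> m" "max N N' \<le> n" and x: "x \<in> cball (0::R2) (real k)"
        obtain m' n' where "m' \<ge> m" "k2 m = k1 m'" "n' \<ge> n" "k2 n = k1 n'" using sub[of m] sub[of n] mn by auto
        then show "\<bar>A k ((s \<circ> k2) m) x - A k ((s \<circ> k2) n) x\<bar> < e" using N'[of m' n' x] mn x by simp
      qed
    qed
  qed blast
  show ?thesis
  proof (rule that[OF r(1)])
    fix e :: real assume e: "0 < e"
    obtain R where R: "\<And>n. (\<integral>x. indicator (- cball 0 R) x * (u n x)\<^sup>2 \<partial>lborel) \<le> e / 16"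
      using tail[of "e/16"] e by auto
    have "(\<lambda>k. 6 * C * (d k)\<^sup>2) \<longlonglongrightarrow> 6 * C * 0\<^sup>2"
      unfolding d_def by (intro tendsto_intros LIMSEQ_Suc[OF lim_1_over_n])
    then have "\<forall>\<^sub>F k in sequentially. 6 * C * (d k)\<^sup>2 < e / 4" using e by (intro order_tendstoD) auto
    moreover have "\<forall>\<^sub>F k in sequentially. R \<le> real k"
      using filterlim_real_sequentially unfolding filterlim_at_top by blast
    ultimately have "\<forall>\<^sub>F k in sequentially. 6 * C * (d k)\<^sup>2 < e / 4 \<and> R \<le> real k" by (rule eventually_conj)
    then obtain k where k: "6 * C * (d k)\<^sup>2 < e / 4" "R \<le> real k" by (auto simp: eventually_sequentially)
    let ?B = "cball (0::R2) (real k)"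
    have emB: "emeasure lborel ?B < \<infinity>" using emeasure_bounded_finite[OF bounded_cball[of "0::R2" "real k"]] .
    define vol where "vol = measure lborel ?B"
    have vol: "0 \<le> vol" by (simp add: vol_def)
    define e' where "e' = sqrt (e / (12 * (vol + 1)))"
    have e': "0 < e'" "e'\<^sup>2 = e / (12 * (vol + 1))" using e vol by (auto simp: e'_def)
    have ev: "3 * e'\<^sup>2 * vol \<le> e / 4"
    proof -
      have "3 * e'\<^sup>2 * vol = e / 4 * (vol / (vol + 1))" using e'(2) vol by (simp add: field_simps)
      also have "\<dots> \<le> e / 4 * 1" using e vol by (intro mult_left_mono) auto
      finally show ?thesis by simp
    qed
    obtain N where N: "\<And>m n x. m \<ge> N \<Longrightarrow> n \<ge> N \<Longrightarrow> x \<in> ?B \<Longrightarrow> \<bar>A k (r m) x - A k (r n) x\<bar> < e'"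
      using r(2)[of k] e'(1) unfolding P_def by fastforce
    have tk: "integrable lborel (\<lambda>x. indicator (- ?B) x * (u n x)\<^sup>2)"
      "(\<integral>x. indicator (- ?B) x * (u n x)\<^sup>2 \<partial>lborel) \<le> e / 16" for n
    proof -
      have i: "integrable lborel (\<lambda>x. indicator (- cball 0 \<rho>) x * (u n x)\<^sup>2)" for \<rho> :: real
        by (rule Bochner_Integration.integrable_bound[OF L2D(2)[OF L[of n]]]) (auto simp: indicator_def)
      then show "integrable lborel (\<lambda>x. indicator (- ?B) x * (u n x)\<^sup>2)" .
      have "(\<integral>x. indicator (- ?B) x * (u n x)\<^sup>2 \<partial>lborel) \<le> (\<integral>x. indicator (- cball 0 R) x * (u n x)\<^sup>2 \<partial>lborel)"
        by (intro integral_mono i) (use k(2) in \<open>auto simp: indicator_def\<close>)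
      also have "\<dots> \<le> e / 16" by (rule R)
      finally show "(\<integral>x. indicator (- ?B) x * (u n x)\<^sup>2 \<partial>lborel) \<le> e / 16" .
    qed
    show "\<exists>N. \<forall>m\<ge>N. \<forall>n\<ge>N. sqn (\<lambda>x. u (r m) x - u (r n) x) < e"
    proof (intro exI[of _ N] allI impI)
      fix m n assume mn: "N \<le> m" "N \<le> n"
      let ?p = "\<lambda>n x. A k (r n) x - u (r n) x"
      have pL: "?p n \<in> L2" "sqn (?p n) \<le> C * (d k)\<^sup>2" for n
        unfolding A_def using ball_avg_minus_self[OF L d tr C] by auto
      have ind: "integrable lborel (indicator ?B :: R2 \<Rightarrow> real)" using emB by (intro integrable_real_indicator) auto
      let ?F = "\<lambda>x. 3 * (?p m x)\<^sup>2 + 3 * (?p n x)\<^sup>2 + 3 * e'\<^sup>2 * indicator ?B x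
        + (2 * (indicator (- ?B) x * (u (r m) x)\<^sup>2) + 2 * (indicator (- ?B) x * (u (r n) x)\<^sup>2))"
      have iF: "integrable lborel ?F"
        using L2D(2)[OF pL(1)[of m]] L2D(2)[OF pL(1)[of n]] ind tk(1)[of "r m"] tk(1)[of "r n"] by simp
      have "sqn (\<lambda>x. u (r m) x - u (r n) x) \<le> (\<integral>x. ?F x \<partial>lborel)"
        unfolding sqn_def
      proof (rule integral_mono[OF _ iF])
        show "integrable lborel (\<lambda>x. (u (r m) x - u (r n) x)\<^sup>2)" by (intro L2D L2_diff L)
        fix x
        show "(u (r m) x - u (r n) x)\<^sup>2 \<le> ?F x"
        proof (cases "x \<in> ?B")
          case True
          have "\<bar>A k (r m) x - A k (r n) x\<bar>\<^sup>2 \<le> e'\<^sup>2"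
            using N[OF mn True] by (intro power_mono) auto
          then have q: "(A k (r m) x - A k (r n) x)\<^sup>2 \<le> e'\<^sup>2" by simp
          have gen: "(c - a + b)\<^sup>2 \<le> 3 * a\<^sup>2 + 3 * b\<^sup>2 + 3 * c\<^sup>2" for a b c :: real
            using zero_le_power2[of "a + b"] zero_le_power2[of "a + c"] zero_le_power2[of "b - c"]
            by (simp add: power2_eq_square algebra_simps)
          have "u (r m) x - u (r n) x = (A k (r m) x - A k (r n) x) - ?p m x + ?p n x" by simp
          then have "(u (r m) x - u (r n) x)\<^sup>2 \<le> 3 * (?p m x)\<^sup>2 + 3 * (?p n x)\<^sup>2 + 3 * (A k (r m) x - A k (r n) x)\<^sup>2"
            using gen[of "A k (r m) x - A k (r n) x" "?p m x" "?p n x"] by simp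
          then show ?thesis using True q by simp
        next
          case False
          have "(a - b)\<^sup>2 \<le> 2 * a\<^sup>2 + 2 * b\<^sup>2" for a b :: real
            using zero_le_power2[of "a + b"] by (simp add: power2_eq_square algebra_simps)
          from this[of "u (r m) x" "u (r n) x"] show ?thesis using False
            by (simp add: add_increasing)
        qed
      qed
      also have "\<dots> = 3 * sqn (?p m) + 3 * sqn (?p n) + 3 * e'\<^sup>2 * vol
         + (2 * (\<integral>x. indicator (- ?B) x * (u (r m) x)\<^sup>2 \<partial>lborel) + 2 * (\<integral>x. indicator (- ?B) x * (u (r n) x)\<^sup>2 \<partial>lborel))"
        unfolding sqn_def vol_def
        using L2D(2)[OF pL(1)[of m]] L2D(2)[OF pL(1)[of n]] ind tk(1)[of "r m"] tk(1)[of "r n"] by simp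
      also have "\<dots> < e"
        using pL(2)[of m] pL(2)[of n] ev tk(2)[of "r m"] tk(2)[of "r n"] k(1) e by simp
      finally show "sqn (\<lambda>x. u (r m) x - u (r n) x) < e" .
    qed
  qed
qed

section \<open>The form domain\<close>

lemma norm_sq_R2: "(norm (v::R2))\<^sup>2 = (v $ 1)\<^sup>2 + (v $ 2)\<^sup>2"
  by (simp only: power2_norm_eq_inner inner_vec_def) (simp add: UNIV_2 power2_eq_square)

lemma H1D:
  assumes "u \<in> H1"
  shows "u \<in> L2" "weak_grad u (wgrad u)" "(\<lambda>x. wgrad u x $ j) \<in> L2"
proof -
  show "u \<in> L2" using assms by (auto simp: H1_def L2_def)
  have *: "weak_grad u (wgrad u) \<and> integrable lborel (\<lambda>x. (norm (wgrad u x))\<^sup>2)"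
    unfolding wgrad_def
    by (rule someI_ex[of "\<lambda>g. weak_grad u g \<and> integrable lborel (\<lambda>x. (norm (g x))\<^sup>2)"]) (use assms in \<open>simp add: H1_def\<close>)
  then show "weak_grad u (wgrad u)" by blast
  then have m: "wgrad u \<in> borel_measurable borel" by (simp add: weak_grad_def)
  have mj: "(\<lambda>x. wgrad u x $ j) \<in> borel_measurable borel"
    by (rule measurable_compose[OF m]) (intro borel_measurable_continuous_onI continuous_intros)
  show "(\<lambda>x. wgrad u x $ j) \<in> L2"
  proof (rule L2I[OF mj])
    show "integrable lborel (\<lambda>x. (wgrad u x $ j)\<^sup>2)"
    proof (rule Bochner_Integration.integrable_bound[OF conjunct2[OF *]])
      show "(\<lambda>x. (wgrad u x $ j)\<^sup>2) \<in> borel_measurable lborel" using mj by measurable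
      show "AE x in lborel. norm ((wgrad u x $ j)\<^sup>2) \<le> norm ((norm (wgrad u x))\<^sup>2)"
        using component_le_norm_cart[of _ j] by (intro AE_I2) (auto simp: abs_le_square_iff[symmetric])
    qed
  qed
qed

lemma H1I:
  assumes "u \<in> L2" "weak_grad u g" "\<And>j. (\<lambda>x. g x $ j) \<in> L2"
  shows "u \<in> H1"
proof -
  have "integrable lborel (\<lambda>x. (norm (g x))\<^sup>2)"
    unfolding norm_sq_R2 using L2D(2)[OF assms(3)[of 1]] L2D(2)[OF assms(3)[of 2]] by simp
  then show ?thesis using assms by (auto simp: H1_def L2_def)
qed

lemma weak_grad_testD:
  assumes "weak_grad u g" "test_fun \<phi> D"
  shows "(\<integral>x. u x * D x (axis j 1) \<partial>lborel) = - (\<integral>x. g x $ j * \<phi> x \<partial>lborel)"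
  using assms unfolding weak_grad_def by blast

lemma wgrad_unique:
  assumes u: "u \<in> L2" and wg: "weak_grad u g" and g: "\<And>j. (\<lambda>x. g x $ j) \<in> L2"
  shows "AE x in lborel. wgrad u x $ j = g x $ j"
proof -
  note h = H1D[OF H1I[OF assms]]
  have "AE x in lborel. wgrad u x $ j - g x $ j = 0"
  proof (rule fundamental_lemma)
    show "(\<lambda>x. wgrad u x $ j - g x $ j) \<in> L2" by (intro L2_diff h g)
    fix a a' :: "2 \<Rightarrow> real \<Rightarrow> real" assume a: "\<And>i. C1c (a i) (a' i)"
    let ?\<phi> = "\<lambda>x::R2. \<Prod>i\<in>UNIV. a i (x $ i)"
    note T = test_fun_prod[of a a', OF a]
    have \<phi>L: "?\<phi> \<in> L2" by (rule test_fun_L2[OF T])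
    have "- (\<integral>x. wgrad u x $ j * ?\<phi> x \<partial>lborel) = - (\<integral>x. g x $ j * ?\<phi> x \<partial>lborel)"
      using weak_grad_testD[where j=j, OF h(2) T] weak_grad_testD[where j=j, OF wg T] by (rule trans[OF sym])
    then show "(\<integral>x. (wgrad u x $ j - g x $ j) * ?\<phi> x \<partial>lborel) = 0"
      using L2_mult_integrable[OF h(3) \<phi>L] L2_mult_integrable[OF g \<phi>L] by (simp add: left_diff_distrib)
  qed
  then show ?thesis by eventually_elim simp
qed

lemma borel_measurable_vec2I:
  fixes g :: "R2 \<Rightarrow> R2"
  assumes "\<And>j. (\<lambda>x. g x $ j) \<in> borel_measurable borel"
  shows "g \<in> borel_measurable borel"
proof (subst borel_measurable_euclidean_space, intro ballI)
  fix b :: R2 assume "b \<in> Basis"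
  then obtain j where "b = axis j 1" by (auto simp: Basis_vec_def)
  then show "(\<lambda>x. g x \<bullet> b) \<in> borel_measurable borel" using assms[of j] by (simp add: inner_axis)
qed

lemma weak_grad_lincomb:
  assumes u: "u \<in> H1" and v: "v \<in> H1"
  shows "weak_grad (\<lambda>x. a * u x + b * v x) (\<lambda>x. a *\<^sub>R wgrad u x + b *\<^sub>R wgrad v x)"
  unfolding weak_grad_def
proof (intro conjI allI impI)
  show "(\<lambda>x. a *\<^sub>R wgrad u x + b *\<^sub>R wgrad v x) \<in> borel_measurable lborel"
    using H1D(2)[OF u] H1D(2)[OF v] by (auto simp: weak_grad_def)
  fix \<phi> D j assume T: "test_fun \<phi> D"
  note L = test_fun_L2[OF T]
  have 1: "ip (\<lambda>x. D x (axis j 1)) u = - ip \<phi> (\<lambda>x. wgrad u x $ j)"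
    "ip (\<lambda>x. D x (axis j 1)) v = - ip \<phi> (\<lambda>x. wgrad v x $ j)"
    using H1D(2)[OF u] H1D(2)[OF v] T by (auto simp: weak_grad_def ip_def mult.commute)
  show "(\<integral>x. (a * u x + b * v x) * D x (axis j 1) \<partial>lborel) = - (\<integral>x. (a *\<^sub>R wgrad u x + b *\<^sub>R wgrad v x) $ j * \<phi> x \<partial>lborel)"
    using ip_lincomb_right[OF H1D(1)[OF u] H1D(1)[OF v] L(2)[of j], of a b]
      ip_lincomb_right[OF H1D(3)[OF u] H1D(3)[OF v] L(1), of a j b j] 1
    by (simp add: ip_def mult.commute)
qed

lemma H1_lincomb:
  assumes u: "u \<in> H1" and v: "v \<in> H1"
  shows "(\<lambda>x. a * u x + b * v x) \<in> H1"
    "AE x in lborel. wgrad (\<lambda>x. a * u x + b * v x) x $ j = a * wgrad u x $ j + b * wgrad v x $ j"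
proof -
  have L: "(\<lambda>x. a * u x + b * v x) \<in> L2" by (intro L2_lincomb H1D u v)
  have gL: "(\<lambda>x. (a *\<^sub>R wgrad u x + b *\<^sub>R wgrad v x) $ j) \<in> L2" for j
    using L2_lincomb[OF H1D(3)[OF u] H1D(3)[OF v]] by simp
  show "(\<lambda>x. a * u x + b * v x) \<in> H1" by (rule H1I[OF L weak_grad_lincomb[OF u v] gL])
  show "AE x in lborel. wgrad (\<lambda>x. a * u x + b * v x) x $ j = a * wgrad u x $ j + b * wgrad v x $ j"
    using wgrad_unique[OF L weak_grad_lincomb[OF u v] gL, of j] by simp
qed

definition Qf :: "(R2 \<Rightarrow> real) \<Rightarrow> (R2 \<Rightarrow> real) \<Rightarrow> real" where
  "Qf V u = sqn (\<lambda>x. wgrad u x $ 1) + sqn (\<lambda>x. wgrad u x $ 2) + sqn (\<lambda>x. sqrt (V x) * u x)"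

definition Bf :: "(R2 \<Rightarrow> real) \<Rightarrow> (R2 \<Rightarrow> real) \<Rightarrow> (R2 \<Rightarrow> real) \<Rightarrow> real" where
  "Bf V u v = ip (\<lambda>x. wgrad u x $ 1) (\<lambda>x. wgrad v x $ 1) + ip (\<lambda>x. wgrad u x $ 2) (\<lambda>x. wgrad v x $ 2)
     + ip (\<lambda>x. sqrt (V x) * u x) (\<lambda>x. sqrt (V x) * v x)"

definition Kf :: "(R2 \<Rightarrow> real) \<Rightarrow> (R2 \<Rightarrow> real) \<Rightarrow> real" where
  "Kf V u = sqn u + Qf V u"

lemma Qf_nonneg [simp]: "0 \<le> Qf V u"
  by (simp add: Qf_def)

lemma Kf_nonneg [simp]: "0 \<le> Kf V u"
  by (simp add: Kf_def)

locale trapping_potential =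
  fixes V :: "R2 \<Rightarrow> real"
  assumes Linf: "Linf_loc V" and at_top: "filterlim V at_top at_infinity"
    and bdd: "bdd_below (range V)" and inf0: "(INF x. V x) = 0"
begin

lemma V_nonneg [simp]: "0 \<le> V x"
  using cINF_lower[OF bdd, of x] inf0 by simp

lemma V_measurable [measurable]: "V \<in> borel_measurable borel"
  using Linf by (simp add: Linf_loc_def)

lemma Hspace_iff: "u \<in> Hspace V \<longleftrightarrow> u \<in> H1 \<and> (\<lambda>x. sqrt (V x) * u x) \<in> L2"
proof (cases "u \<in> H1")
  case True
  have [measurable]: "u \<in> borel_measurable borel" using L2D(1)[OF H1D(1)[OF True]] .
  have eq: "(\<integral>\<^sup>+x. ennreal (V x * (u x)\<^sup>2) \<partial>lborel) = (\<integral>\<^sup>+x. ennreal (norm ((sqrt (V x) * u x)\<^sup>2)) \<partial>lborel)"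
    by (simp add: power_mult_distrib)
  show ?thesis
    using True unfolding Hspace_def L2_def integrable_iff_bounded eq by (auto simp: power_mult_distrib)
qed (simp add: Hspace_def)

lemma HspaceD:
  assumes "u \<in> Hspace V"
  shows "u \<in> H1" "u \<in> L2" "(\<lambda>x. sqrt (V x) * u x) \<in> L2"
  using assms H1D by (auto simp: Hspace_iff)

lemma Hspace_lincomb:
  assumes u: "u \<in> Hspace V" and v: "v \<in> Hspace V"
  shows "(\<lambda>x. a * u x + b * v x) \<in> Hspace V"
    "Qf V (\<lambda>x. a * u x + b * v x) = a\<^sup>2 * Qf V u + 2 * a * b * Bf V u v + b\<^sup>2 * Qf V v"
proof -
  note uD = HspaceD[OF u] and vD = HspaceD[OF v]
  have eq: "(\<lambda>x. sqrt (V x) * (a * u x + b * v x)) = (\<lambda>x. a * (sqrt (V x) * u x) + b * (sqrt (V x) * v x))"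
    by (auto simp: algebra_simps)
  note H = H1_lincomb[OF uD(1) vD(1), of a b]
  show "(\<lambda>x. a * u x + b * v x) \<in> Hspace V"
    unfolding Hspace_iff eq by (intro conjI H L2_lincomb uD vD)
  have "sqn (\<lambda>x. wgrad (\<lambda>x. a * u x + b * v x) x $ j) = sqn (\<lambda>x. a * wgrad u x $ j + b * wgrad v x $ j)" for j
    by (intro sqn_cong_AE H1D H L2_lincomb uD vD)
  then show "Qf V (\<lambda>x. a * u x + b * v x) = a\<^sup>2 * Qf V u + 2 * a * b * Bf V u v + b\<^sup>2 * Qf V v"
    unfolding Qf_def Bf_def eq using sqn_lincomb[OF H1D(3)[OF uD(1)] H1D(3)[OF vD(1)], of a _ b] sqn_lincomb[OF uD(3) vD(3)]
    by (simp add: algebra_simps)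
qed

lemma Hspace_scale: "u \<in> Hspace V \<Longrightarrow> (\<lambda>x. a * u x) \<in> Hspace V"
  using Hspace_lincomb(1)[of u u a 0] by simp

lemma Hspace_add: "u \<in> Hspace V \<Longrightarrow> v \<in> Hspace V \<Longrightarrow> (\<lambda>x. u x + v x) \<in> Hspace V"
  using Hspace_lincomb(1)[of u v 1 1] by simp

lemma Hspace_diff: "u \<in> Hspace V \<Longrightarrow> v \<in> Hspace V \<Longrightarrow> (\<lambda>x. u x - v x) \<in> Hspace V"
  using Hspace_lincomb(1)[of u v 1 "-1"] by simp

lemma Qf_scale: "u \<in> Hspace V \<Longrightarrow> Qf V (\<lambda>x. a * u x) = a\<^sup>2 * Qf V u"
  using Hspace_lincomb(2)[of u u a 0] by simp

lemma Qf_parallelogram: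
  assumes "u \<in> Hspace V" "v \<in> Hspace V"
  shows "Qf V (\<lambda>x. u x + v x) + Qf V (\<lambda>x. u x - v x) = 2 * Qf V u + 2 * Qf V v"
  using Hspace_lincomb(2)[OF assms, of 1 1] Hspace_lincomb(2)[OF assms, of 1 "-1"] by simp

lemma Kf_parallelogram:
  assumes "u \<in> Hspace V" "v \<in> Hspace V"
  shows "Kf V (\<lambda>x. u x + v x) + Kf V (\<lambda>x. u x - v x) = 2 * Kf V u + 2 * Kf V v"
  using Qf_parallelogram[OF assms] sqn_parallelogram[OF HspaceD(2)[OF assms(1)] HspaceD(2)[OF assms(2)]]
  by (simp add: Kf_def)

lemma Kf_scale: "u \<in> Hspace V \<Longrightarrow> Kf V (\<lambda>x. a * u x) = a\<^sup>2 * Kf V u"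
  by (simp add: Kf_def Qf_scale sqn_scale algebra_simps)

lemma Hspace_abs:
  assumes "u \<in> Hspace V"
  shows "(\<lambda>x. \<bar>u x\<bar>) \<in> Hspace V" "Qf V (\<lambda>x. \<bar>u x\<bar>) \<le> Qf V u"
proof -
  note uD = HspaceD[OF assms]
  have eq: "(\<lambda>x. sqrt (V x) * \<bar>u x\<bar>) = (\<lambda>x. \<bar>sqrt (V x) * u x\<bar>)" by (auto simp: abs_mult)
  obtain h where h: "weak_grad (\<lambda>x. \<bar>u x\<bar>) h" "\<And>j. (\<lambda>x. h x $ j) \<in> L2" "\<And>j. sqn (\<lambda>x. h x $ j) \<le> sqn (\<lambda>x. wgrad u x $ j)"
    using weak_grad_abs[OF uD(2) H1D(2)[OF uD(1)] H1D(3)[OF uD(1)]] by blast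
  have H: "(\<lambda>x. \<bar>u x\<bar>) \<in> H1" by (rule H1I[OF L2_abs[OF uD(2)] h(1,2)])
  then show "(\<lambda>x. \<bar>u x\<bar>) \<in> Hspace V" unfolding Hspace_iff eq using L2_abs[OF uD(3)] by simp
  have "sqn (\<lambda>x. wgrad (\<lambda>x. \<bar>u x\<bar>) x $ j) = sqn (\<lambda>x. h x $ j)" for j
    by (intro sqn_cong_AE H1D H h wgrad_unique L2_abs uD)
  then have 1: "sqn (\<lambda>x. wgrad (\<lambda>x. \<bar>u x\<bar>) x $ j) \<le> sqn (\<lambda>x. wgrad u x $ j)" for j using h(3) by simp
  have 2: "sqn (\<lambda>x. sqrt (V x) * \<bar>u x\<bar>) = sqn (\<lambda>x. sqrt (V x) * u x)"
    unfolding sqn_def by (simp add: power_mult_distrib)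
  show "Qf V (\<lambda>x. \<bar>u x\<bar>) \<le> Qf V u"
    unfolding Qf_def 2 using 1[of 1] 1[of 2] by simp
qed

lemma Hspace_complete:
  assumes u: "\<And>n. u n \<in> Hspace V"
    and C: "\<And>e. e > 0 \<Longrightarrow> \<exists>N. \<forall>m\<ge>N. \<forall>n\<ge>N. Kf V (\<lambda>x. u m x - u n x) < e"
  obtains w r where "w \<in> Hspace V" "strict_mono (r :: nat \<Rightarrow> nat)"
    "(\<lambda>k. Kf V (\<lambda>x. u (r k) x - w x)) \<longlonglongrightarrow> 0" "AE x in lborel. (\<lambda>k. u (r k) x) \<longlonglongrightarrow> w x"
proof -
  note uD = HspaceD[OF u]
  have dL: "sqn (\<lambda>x. u m x - u n x) \<le> Kf V (\<lambda>x. u m x - u n x)" for m n by (simp add: Kf_def)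
  have c: "\<exists>N. \<forall>m\<ge>N. \<forall>n\<ge>N. sqn (\<lambda>x. u m x - u n x) < e" if e: "e > 0" for e
    using C[OF e] dL le_less_trans by blast
  obtain w r where w: "w \<in> L2" "strict_mono (r::nat\<Rightarrow>nat)" "(\<lambda>n. sqn (\<lambda>x. u n x - w x)) \<longlonglongrightarrow> 0"
    "AE x in lborel. (\<lambda>k. u (r k) x) \<longlonglongrightarrow> w x"
    by (rule L2_complete[OF uD(2) c]) blast
  define v where "v k = u (r k)" for k
  have v: "v k \<in> Hspace V" for k using u by (simp add: v_def)
  note vD = HspaceD[OF v]
  have Cv: "\<exists>N. \<forall>m\<ge>N. \<forall>n\<ge>N. Kf V (\<lambda>x. v m x - v n x) < e" if e: "e > 0" for e
  proof -
    obtain N where N: "\<And>m n. m \<ge> N \<Longrightarrow> n \<ge> N \<Longrightarrow> Kf V (\<lambda>x. u m x - u n x) < e" using C[OF e] by blast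
    have "\<And>k. k \<ge> N \<Longrightarrow> r k \<ge> N" using seq_suble[OF w(2)] order_trans by blast
    then show ?thesis using N unfolding v_def by blast
  qed
  have vw: "(\<lambda>k. sqn (\<lambda>x. v k x - w x)) \<longlonglongrightarrow> 0"
    unfolding v_def using LIMSEQ_subseq_LIMSEQ[OF w(3) w(2)] by (simp add: o_def)
  have exG: "\<exists>G. G \<in> L2 \<and> (\<lambda>k. sqn (\<lambda>x. wgrad (v k) x $ j - G x)) \<longlonglongrightarrow> 0" for j
  proof -
    have "sqn (\<lambda>x. wgrad (v m) x $ j - wgrad (v n) x $ j) \<le> Kf V (\<lambda>x. v m x - v n x)" for m n
    proof -
      have "sqn (\<lambda>x. wgrad (v m) x $ j - wgrad (v n) x $ j) = sqn (\<lambda>x. wgrad (\<lambda>x. v m x - v n x) x $ j)"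
        using H1_lincomb(2)[OF vD(1)[of m] vD(1)[of n], of 1 "-1" j] HspaceD(1)[OF Hspace_diff[OF v[of m] v[of n]]]
        by (intro sqn_cong_AE L2_diff H1D vD) auto
      also have "\<dots> \<le> Qf V (\<lambda>x. v m x - v n x)" using exhaust_2[of j] by (auto simp: Qf_def)
      finally show ?thesis by (simp add: Kf_def add_increasing)
    qed
    then have c: "\<exists>N. \<forall>m\<ge>N. \<forall>n\<ge>N. sqn (\<lambda>x. wgrad (v m) x $ j - wgrad (v n) x $ j) < e" if e: "e > 0" for e
      using Cv[OF e] le_less_trans by blast
    show ?thesis
    proof (rule L2_complete[OF H1D(3)[OF vD(1)] c])
      fix G q assume "G \<in> L2" "(\<lambda>n. sqn (\<lambda>x. wgrad (v n) x $ j - G x)) \<longlonglongrightarrow> 0"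
      then show ?thesis by (intro exI[of _ G] conjI)
    qed
  qed
  from choice[OF allI, OF exG] obtain G
    where "\<forall>j. G j \<in> L2 \<and> (\<lambda>k. sqn (\<lambda>x. wgrad (v k) x $ j - G j x)) \<longlonglongrightarrow> 0" by (rule exE)
  then have G: "\<And>j. G j \<in> L2" "\<And>j. (\<lambda>k. sqn (\<lambda>x. wgrad (v k) x $ j - G j x)) \<longlonglongrightarrow> 0" by simp_all
  have "sqn (\<lambda>x. sqrt (V x) * v m x - sqrt (V x) * v n x) \<le> Kf V (\<lambda>x. v m x - v n x)" for m n
    by (simp add: Kf_def Qf_def right_diff_distrib add_increasing)
  then have c: "\<exists>N. \<forall>m\<ge>N. \<forall>n\<ge>N. sqn (\<lambda>x. sqrt (V x) * v m x - sqrt (V x) * v n x) < e" if e: "e > 0" for e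
    using Cv[OF e] le_less_trans by blast
  obtain s q where s: "s \<in> L2" "(\<lambda>k. sqn (\<lambda>x. sqrt (V x) * v k x - s x)) \<longlonglongrightarrow> 0" "strict_mono (q::nat\<Rightarrow>nat)"
    "AE x in lborel. (\<lambda>k. sqrt (V x) * v (q k) x) \<longlonglongrightarrow> s x"
    by (rule L2_complete[OF vD(3) c]) blast
  have sw: "AE x in lborel. s x = sqrt (V x) * w x"
    using s(4) w(4)
  proof eventually_elim
    case (elim x)
    have "(\<lambda>k. v (q k) x) \<longlonglongrightarrow> w x"
      using LIMSEQ_subseq_LIMSEQ[OF elim(2) s(3)] by (simp add: v_def o_def)
    then have "(\<lambda>k. sqrt (V x) * v (q k) x) \<longlonglongrightarrow> sqrt (V x) * w x" by (intro tendsto_intros)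
    then show ?case using elim(1) LIMSEQ_unique by blast
  qed
  define g :: "R2 \<Rightarrow> R2" where "g x = (\<chi> j. G j x)" for x
  have gj: "(\<lambda>x. g x $ j) = G j" for j by (simp add: g_def)
  have gL: "(\<lambda>x. g x $ j) \<in> L2" for j unfolding gj by (rule G)
  have wg: "weak_grad w g"
    unfolding weak_grad_def
  proof (intro conjI allI impI)
    show "g \<in> borel_measurable lborel" using L2D(1)[OF gL] by (simp add: borel_measurable_vec2I)
    fix \<phi> D j assume T: "test_fun \<phi> D"
    have 1: "(\<lambda>k. ip (v k) (\<lambda>x. D x (axis j 1))) \<longlonglongrightarrow> ip w (\<lambda>x. D x (axis j 1))"
      by (rule ip_tendsto[OF vD(2) w(1) test_fun_L2(2)[OF T] vw])
    have 2: "(\<lambda>k. - ip (\<lambda>x. wgrad (v k) x $ j) \<phi>) \<longlonglongrightarrow> - ip (G j) \<phi>"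
      by (intro tendsto_minus ip_tendsto[OF H1D(3)[OF vD(1)] G(1) test_fun_L2(1)[OF T] G(2)])
    have "ip (v k) (\<lambda>x. D x (axis j 1)) = - ip (\<lambda>x. wgrad (v k) x $ j) \<phi>" for k
      using H1D(2)[OF vD(1)[of k]] T unfolding weak_grad_def ip_def by blast
    then have "ip w (\<lambda>x. D x (axis j 1)) = - ip (G j) \<phi>" using 1 2 LIMSEQ_unique by simp
    then show "(\<integral>x. w x * D x (axis j 1) \<partial>lborel) = - (\<integral>x. g x $ j * \<phi> x \<partial>lborel)"
      by (simp add: ip_def g_def)
  qed
  have wH1: "w \<in> H1" by (rule H1I[OF w(1) wg gL])
  have wm[measurable]: "w \<in> borel_measurable borel" by (rule L2D(1)[OF w(1)])
  have sm[measurable]: "s \<in> borel_measurable borel" by (rule L2D(1)[OF s(1)])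
  have VwL: "(\<lambda>x. sqrt (V x) * w x) \<in> L2"
  proof (rule L2I)
    show "integrable lborel (\<lambda>x. (sqrt (V x) * w x)\<^sup>2)"
      using L2D(2)[OF s(1)] by (rule integrable_cong_AE_imp) (use sw in auto)
  qed measurable
  have wH: "w \<in> Hspace V" using wH1 VwL by (simp add: Hspace_iff)
  have "Kf V (\<lambda>x. v k x - w x) = sqn (\<lambda>x. v k x - w x)
     + (sqn (\<lambda>x. wgrad (v k) x $ 1 - G 1 x) + sqn (\<lambda>x. wgrad (v k) x $ 2 - G 2 x) + sqn (\<lambda>x. sqrt (V x) * v k x - s x))" for k
  proof -
    have "sqn (\<lambda>x. wgrad (\<lambda>x. v k x - w x) x $ j) = sqn (\<lambda>x. wgrad (v k) x $ j - G j x)" for j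
    proof (rule sqn_cong_AE)
      show "(\<lambda>x. wgrad (\<lambda>x. v k x - w x) x $ j) \<in> L2" by (intro H1D HspaceD Hspace_diff v wH)
      show "(\<lambda>x. wgrad (v k) x $ j - G j x) \<in> L2" by (intro L2_diff H1D vD G)
      show "AE x in lborel. wgrad (\<lambda>x. v k x - w x) x $ j = wgrad (v k) x $ j - G j x"
        using H1_lincomb(2)[OF vD(1)[of k] wH1, of 1 "-1" j] wgrad_unique[OF w(1) wg gL, of j]
        by eventually_elim (simp add: g_def)
    qed
    moreover have "sqn (\<lambda>x. sqrt (V x) * (v k x - w x)) = sqn (\<lambda>x. sqrt (V x) * v k x - s x)"
    proof (rule sqn_cong_AE)
      show "(\<lambda>x. sqrt (V x) * (v k x - w x)) \<in> L2" by (intro HspaceD Hspace_diff v wH)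
      show "(\<lambda>x. sqrt (V x) * v k x - s x) \<in> L2" by (intro L2_diff vD s)
      show "AE x in lborel. sqrt (V x) * (v k x - w x) = sqrt (V x) * v k x - s x"
        using sw by eventually_elim (simp add: algebra_simps)
    qed
    ultimately show ?thesis by (simp add: Kf_def Qf_def)
  qed
  moreover have "(\<lambda>k. sqn (\<lambda>x. v k x - w x)
     + (sqn (\<lambda>x. wgrad (v k) x $ 1 - G 1 x) + sqn (\<lambda>x. wgrad (v k) x $ 2 - G 2 x) + sqn (\<lambda>x. sqrt (V x) * v k x - s x))) \<longlonglongrightarrow> 0 + (0 + 0 + 0)"
    by (intro tendsto_add vw G s)
  ultimately have "(\<lambda>k. Kf V (\<lambda>x. v k x - w x)) \<longlonglongrightarrow> 0" by simp
  then show ?thesis using that[OF wH w(2) _ w(4)] by (simp add: v_def)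
qed

lemma Hspace_compact:
  assumes u: "\<And>n. u n \<in> Hspace V" and C: "\<And>n. Kf V (u n) \<le> C"
  obtains r where "strict_mono (r :: nat \<Rightarrow> nat)"
    "\<And>e. 0 < e \<Longrightarrow> \<exists>N. \<forall>m\<ge>N. \<forall>n\<ge>N. sqn (\<lambda>x. u (r m) x - u (r n) x) < e"
proof -
  note uD = HspaceD[OF u]
  have C0: "0 \<le> C" using C[of 0] Kf_nonneg[of V "u 0"] by linarith
  have Kd: "sqn (u n) + (sqn (\<lambda>x. wgrad (u n) x $ 1) + sqn (\<lambda>x. wgrad (u n) x $ 2)) + sqn (\<lambda>x. sqrt (V x) * u n x) \<le> C" for n
    using C[of n] by (simp add: Kf_def Qf_def algebra_simps)
  show ?thesis
  proof (rule L2_compactness[OF uD(2), of "2 * C"])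
    fix n
    show "sqn (u n) \<le> 2 * C"
      using C[of n] C0 Qf_nonneg[of V "u n"] unfolding Kf_def by linarith
    fix h
    have "sqn (\<lambda>x. u n (x + h) - u n x) \<le> 2 * (norm h)\<^sup>2 * (sqn (\<lambda>x. wgrad (u n) x $ 1) + sqn (\<lambda>x. wgrad (u n) x $ 2))"
      by (rule sqn_shift_diff[OF uD(2) H1D(2)[OF uD(1)] H1D(3)[OF uD(1)]])
    also have "\<dots> \<le> 2 * (norm h)\<^sup>2 * C"
      using Kd[of n] sqn_nonneg[of "u n"] sqn_nonneg[of "\<lambda>x. sqrt (V x) * u n x"] by (intro mult_left_mono) (linarith, simp)
    finally show "sqn (\<lambda>x. u n (x + h) - u n x) \<le> 2 * C * (norm h)\<^sup>2" by (simp add: algebra_simps)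
  next
    fix e :: real assume e: "0 < e"
    have "eventually (\<lambda>x. C / e \<le> V x) at_infinity" using at_top by (simp add: filterlim_at_top)
    then obtain R where R: "\<And>x. R \<le> norm x \<Longrightarrow> C / e \<le> V x" by (auto simp: eventually_at_infinity)
    have "(\<integral>x. indicator (- cball 0 R) x * (u n x)\<^sup>2 \<partial>lborel) \<le> e" for n
    proof (cases "C = 0")
      case True
      then have "sqn (u n) = 0" using C[of n] Qf_nonneg[of V "u n"] sqn_nonneg[of "u n"] unfolding Kf_def by linarith
      then have "AE x in lborel. u n x = 0" by (intro sqn_eq_0 uD)
      then have "(\<integral>x. indicator (- cball 0 R) x * (u n x)\<^sup>2 \<partial>lborel) = 0" by (intro integral_eq_zero_AE) auto
      then show ?thesis using e by simp
    next
      case False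
      then have Cp: "0 < C" using C0 by simp
      have iV: "integrable lborel (\<lambda>x. (sqrt (V x) * u n x)\<^sup>2)" by (rule L2D(2)[OF uD(3)])
      have "(\<integral>x. indicator (- cball 0 R) x * (u n x)\<^sup>2 \<partial>lborel) \<le> (\<integral>x. (e / C) * (sqrt (V x) * u n x)\<^sup>2 \<partial>lborel)"
      proof (rule integral_mono)
        have [measurable]: "u n \<in> borel_measurable borel" "cball (0::R2) R \<in> sets borel" using L2D(1)[OF uD(2)] by auto
        show "integrable lborel (\<lambda>x. indicator (- cball 0 R) x * (u n x)\<^sup>2)"
          by (rule Bochner_Integration.integrable_bound[OF L2D(2)[OF uD(2)[of n]]]) (auto simp: indicator_def)
        show "integrable lborel (\<lambda>x. (e / C) * (sqrt (V x) * u n x)\<^sup>2)" using iV by simp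
        fix x
        show "indicator (- cball 0 R) x * (u n x)\<^sup>2 \<le> (e / C) * (sqrt (V x) * u n x)\<^sup>2"
        proof (cases "norm x \<le> R")
          case True
          then show ?thesis using e Cp by simp
        next
          case False
          then have "1 \<le> (e / C) * V x" using R[of x] e Cp by (simp add: field_simps)
          then have "1 * (u n x)\<^sup>2 \<le> (e / C) * V x * (u n x)\<^sup>2" by (rule mult_right_mono) simp
          then show ?thesis using False by (simp add: power_mult_distrib)
        qed
      qed
      also have "\<dots> = (e / C) * sqn (\<lambda>x. sqrt (V x) * u n x)" using iV by (simp add: sqn_def)
      also have "\<dots> \<le> (e / C) * C"
        using Kd[of n] e Cp sqn_nonneg[of "u n"] sqn_nonneg[of "\<lambda>x. wgrad (u n) x $ 1"] sqn_nonneg[of "\<lambda>x. wgrad (u n) x $ 2"]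
        by (intro mult_left_mono) (linarith, simp)
      also have "\<dots> = e" using Cp by simp
      finally show ?thesis .
    qed
    then show "\<exists>R. \<forall>n. (\<integral>x. indicator (- cball 0 R) x * (u n x)\<^sup>2 \<partial>lborel) \<le> e" by blast
  qed (use C0 that in auto)
qed

lemma Hspace_fourth_power:
  assumes u: "u \<in> Hspace V"
  shows "integrable lborel (\<lambda>x. (u x)^4)" "(\<integral>x. (u x)^4 \<partial>lborel) \<le> 16 * sqn u * Qf V u"
    "(\<integral>x. (u x)^4 \<partial>lborel) \<le> (4 * Kf V u)\<^sup>2 / 4"
proof -
  note uD = HspaceD[OF u]
  note L = Ladyzhenskaya[OF uD(2) H1D(2)[OF uD(1)] H1D(3)[OF uD(1)]]
  show "integrable lborel (\<lambda>x. (u x)^4)" by (rule L)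
  have "16 * sqn u * (sqn (\<lambda>x. wgrad u x $ 1) + sqn (\<lambda>x. wgrad u x $ 2)) \<le> 16 * sqn u * Qf V u"
    by (intro mult_left_mono) (auto simp: Qf_def)
  then show 1: "(\<integral>x. (u x)^4 \<partial>lborel) \<le> 16 * sqn u * Qf V u" using L(2) by linarith
  have "4 * (p * q) \<le> (p + q)\<^sup>2" for p q :: real
    using zero_le_power2[of "p - q"] by (simp add: power2_eq_square algebra_simps)
  from this[of "sqn u" "Qf V u"] have "16 * sqn u * Qf V u \<le> (4 * Kf V u)\<^sup>2 / 4"
    unfolding Kf_def power_mult_distrib by simp
  then show "(\<integral>x. (u x)^4 \<partial>lborel) \<le> (4 * Kf V u)\<^sup>2 / 4" using 1 by linarith
qed

end

definition prodint :: "(R2 \<Rightarrow> real) \<Rightarrow> (R2 \<Rightarrow> real) \<Rightarrow> real" where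
  "prodint u v = (\<integral>x. (u x)\<^sup>2 * (v x)\<^sup>2 \<partial>lborel)"

lemma prodint_le:
  assumes V: "trapping_potential V" and W: "trapping_potential W"
    and u: "u \<in> Hspace V" and v: "v \<in> Hspace W"
  shows "(\<lambda>x. (u x)\<^sup>2) \<in> L2" "integrable lborel (\<lambda>x. (u x)\<^sup>2 * (v x)\<^sup>2)" "prodint u v \<le> 4 * Kf V u * Kf W v"
proof -
  have sq: "(\<lambda>x. (u x)\<^sup>2) \<in> L2 \<and> sqn (\<lambda>x. (u x)\<^sup>2) \<le> (4 * Kf V u)\<^sup>2 / 4" if "trapping_potential V" "u \<in> Hspace V" for u V
  proof
    interpret trapping_potential V by fact
    note F = Hspace_fourth_power[OF that(2)]
    have [measurable]: "u \<in> borel_measurable borel" by (rule L2D(1)[OF HspaceD(2)[OF that(2)]])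
    show "(\<lambda>x. (u x)\<^sup>2) \<in> L2" by (rule L2I) (use F in auto)
    show "sqn (\<lambda>x. (u x)\<^sup>2) \<le> (4 * Kf V u)\<^sup>2 / 4" using F(3) by (simp add: sqn_def)
  qed
  note su = sq[OF V u] and sv = sq[OF W v]
  show "(\<lambda>x. (u x)\<^sup>2) \<in> L2" using su by simp
  show "integrable lborel (\<lambda>x. (u x)\<^sup>2 * (v x)\<^sup>2)" using su sv by (intro L2_mult_integrable) auto
  have "(ip (\<lambda>x. (u x)\<^sup>2) (\<lambda>x. (v x)\<^sup>2))\<^sup>2 \<le> sqn (\<lambda>x. (u x)\<^sup>2) * sqn (\<lambda>x. (v x)\<^sup>2)"
    using su sv by (intro ip_Cauchy_Schwarz) auto
  also have "\<dots> \<le> ((4 * Kf V u)\<^sup>2 / 4) * ((4 * Kf W v)\<^sup>2 / 4)" using su sv by (intro mult_mono) auto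
  also have "\<dots> = (4 * Kf V u * Kf W v)\<^sup>2" by (simp add: power2_eq_square)
  finally have "\<bar>ip (\<lambda>x. (u x)\<^sup>2) (\<lambda>x. (v x)\<^sup>2)\<bar> \<le> \<bar>4 * Kf V u * Kf W v\<bar>" by (simp only: abs_le_square_iff)
  then show "prodint u v \<le> 4 * Kf V u * Kf W v" by (simp add: prodint_def ip_def abs_mult)
qed

section \<open>Positivity of ground states\<close>

lemma test_fun_weak_grad:
  assumes T: "test_fun \<phi> D"
  shows "weak_grad \<phi> (\<lambda>x. \<chi> j. D x (axis j 1))"
  unfolding weak_grad_def
proof (intro conjI allI impI)
  show "(\<lambda>x. \<chi> j. D x (axis j 1)) \<in> borel_measurable lborel"
    using L2D(1)[OF test_fun_L2(2)[OF T]] by (simp add: borel_measurable_vec2I)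
  fix \<psi> D' j assume T': "test_fun \<psi> D'"
  define t where "t n = 1 / real (Suc n)" for n
  have t: "t \<longlonglongrightarrow> 0" "\<And>n. t n \<noteq> 0" "\<And>n. \<bar>t n\<bar> \<le> 1"
    unfolding t_def by (rule LIMSEQ_Suc[OF lim_1_over_n]) auto
  have t': "(\<lambda>n. - t n) \<longlonglongrightarrow> 0" "\<And>n. - t n \<noteq> 0" "\<And>n. \<bar>- t n\<bar> \<le> 1"
    using tendsto_minus[OF t(1)] t by auto
  have 1: "(\<lambda>n. \<integral>x. \<phi> x * ((\<psi> (x + t n *\<^sub>R axis j 1) - \<psi> x) / t n) \<partial>lborel) \<longlonglongrightarrow> (\<integral>x. \<phi> x * D' x (axis j 1) \<partial>lborel)"
    by (rule test_fun_difference_quotient_tendsto[OF T' test_fun_L2(1)[OF T] t])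
  have 2: "(\<lambda>n. \<integral>x. \<psi> x * ((\<phi> (x + (- t n) *\<^sub>R axis j 1) - \<phi> x) / (- t n)) \<partial>lborel) \<longlonglongrightarrow> (\<integral>x. \<psi> x * D x (axis j 1) \<partial>lborel)"
    by (rule test_fun_difference_quotient_tendsto[OF T test_fun_L2(1)[OF T'] t'])
  have eq: "(\<integral>x. \<phi> x * ((\<psi> (x + t n *\<^sub>R axis j 1) - \<psi> x) / t n) \<partial>lborel)
    = - (\<integral>x. \<psi> x * ((\<phi> (x + (- t n) *\<^sub>R axis j 1) - \<phi> x) / (- t n)) \<partial>lborel)" for n
    using integral_mult_difference_quotient[OF test_fun_L2(1)[OF T] test_fun_L2(1)[OF T'], of "t n *\<^sub>R axis j 1" "t n"]
    by (simp add: mult.commute)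
  from 1 have "(\<lambda>n. - (\<integral>x. \<psi> x * ((\<phi> (x + (- t n) *\<^sub>R axis j 1) - \<phi> x) / (- t n)) \<partial>lborel)) \<longlonglongrightarrow> (\<integral>x. \<phi> x * D' x (axis j 1) \<partial>lborel)"
    by (simp only: eq)
  from LIMSEQ_unique[OF this tendsto_minus[OF 2]]
  show "(\<integral>x. \<phi> x * D' x (axis j 1) \<partial>lborel) = - (\<integral>x. (\<chi> j. D x (axis j 1)) $ j * \<psi> x \<partial>lborel)"
    by (simp add: mult.commute)
qed

lemma (in trapping_potential) test_fun_Hspace:
  assumes T: "test_fun \<phi> D"
  shows "\<phi> \<in> Hspace V" "AE x in lborel. wgrad \<phi> x $ j = D x (axis j 1)"
proof -
  have [measurable]: "\<phi> \<in> borel_measurable borel" by (rule L2D(1)[OF test_fun_L2(1)[OF T]])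
  have gL: "(\<lambda>x. (\<chi> j. D x (axis j 1)) $ j) \<in> L2" for j using test_fun_L2(2)[OF T] by simp
  have H: "\<phi> \<in> H1" by (rule H1I[OF test_fun_L2(1)[OF T] test_fun_weak_grad[OF T] gL])
  obtain K where K: "compact K" "\<And>x. x \<notin> K \<Longrightarrow> \<phi> x = 0" using T by (auto simp: test_fun_def)
  obtain C where C: "AE x in lborel. x \<in> K \<longrightarrow> \<bar>V x\<bar> \<le> C" using Linf K(1) by (auto simp: Linf_loc_def)
  have "integrable lborel (\<lambda>x. (sqrt (V x) * \<phi> x)\<^sup>2)"
  proof (rule Bochner_Integration.integrable_bound)
    show "integrable lborel (\<lambda>x. C * (\<phi> x)\<^sup>2)" using L2D(2)[OF test_fun_L2(1)[OF T]] by simp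
    show "AE x in lborel. norm ((sqrt (V x) * \<phi> x)\<^sup>2) \<le> norm (C * (\<phi> x)\<^sup>2)"
      using C
    proof eventually_elim
      case (elim x)
      show ?case
      proof (cases "x \<in> K")
        case True
        then have "V x \<le> C" using elim by auto
        moreover from this have "0 \<le> C" using V_nonneg[of x] by linarith
        ultimately show ?thesis by (simp add: power_mult_distrib abs_mult mult_right_mono)
      qed (simp add: K(2))
    qed
  qed measurable
  then have "(\<lambda>x. sqrt (V x) * \<phi> x) \<in> L2" by (intro L2I) auto
  then show "\<phi> \<in> Hspace V" using H by (simp add: Hspace_iff)
  show "AE x in lborel. wgrad \<phi> x $ j = D x (axis j 1)"
    using wgrad_unique[OF test_fun_L2(1)[OF T] test_fun_weak_grad[OF T] gL, of j] by simp
qed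

definition bump :: "R2 \<Rightarrow> real \<Rightarrow> R2 \<Rightarrow> real" where
  "bump c \<tau> x = max 0 (\<tau> - (norm (x - c))\<^sup>2)"

lemma bump_nonneg [simp]: "0 \<le> bump c \<tau> x"
  by (simp add: bump_def)

lemma bump_continuous: "continuous_on UNIV (bump c \<tau>)"
  unfolding bump_def[abs_def] by (intro continuous_intros)

lemma bump_measurable [measurable]: "bump c \<tau> \<in> borel_measurable borel"
  by (intro borel_measurable_continuous_onI bump_continuous)

lemma bump_eq_0_iff: "0 < \<tau> \<Longrightarrow> bump c \<tau> x = 0 \<longleftrightarrow> sqrt \<tau> \<le> norm (x - c)"
  using real_sqrt_le_iff[of \<tau> "(norm (x - c))\<^sup>2"] by (auto simp: bump_def max_def)

lemma bump_power_derivative: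
  "((\<lambda>x. bump c \<tau> x ^ Suc (Suc k)) has_derivative
     (\<lambda>y. real (Suc (Suc k)) * bump c \<tau> x ^ Suc k * (- 2 * ((x - c) \<bullet> y)))) (at x)"
proof -
  have "((\<lambda>x. \<tau> - (x - c) \<bullet> (x - c)) has_derivative (\<lambda>y. - 2 * ((x - c) \<bullet> y))) (at x)"
    by (auto intro!: derivative_eq_intros simp: inner_commute)
  from has_derivative_compose[OF this has_field_derivative_imp_has_derivative[OF has_real_derivative_pos_part_power]]
  show ?thesis unfolding bump_def power2_norm_eq_inner by (simp add: mult.assoc)
qed

lemma test_fun_bump_cube:
  assumes \<tau>: "0 < \<tau>"
  shows "test_fun (\<lambda>x. bump c \<tau> x ^ 3) (\<lambda>x y. - 6 * (bump c \<tau> x)\<^sup>2 * ((x - c) \<bullet> y))"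
  unfolding test_fun_def
proof (intro conjI allI)
  show "((\<lambda>x. bump c \<tau> x ^ 3) has_derivative (\<lambda>y. - 6 * (bump c \<tau> x)\<^sup>2 * ((x - c) \<bullet> y))) (at x)" for x
    using bump_power_derivative[of c \<tau> 1 x] by (simp add: numeral_3_eq_3 numeral_2_eq_2 algebra_simps)
  show "continuous_on UNIV (\<lambda>x. - 6 * (bump c \<tau> x)\<^sup>2 * ((x - c) \<bullet> axis j 1))" for j
    by (intro continuous_intros bump_continuous)
  have "bump c \<tau> x ^ 3 = 0" if "x \<notin> cball c (sqrt \<tau>)" for x
    using that bump_eq_0_iff[OF \<tau>, of c x] by (simp add: dist_norm norm_minus_commute)
  then show "\<exists>K. compact K \<and> (\<forall>x. x \<notin> K \<longrightarrow> bump c \<tau> x ^ 3 = 0)" by (intro exI[of _ "cball c (sqrt \<tau>)"]) auto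
qed

lemma test_fun_bump_square:
  assumes \<tau>: "0 < \<tau>"
  shows "test_fun (\<lambda>x. - 6 * (bump c \<tau> x)\<^sup>2 * ((x - c) \<bullet> axis j 1))
    (\<lambda>x y. - 6 * ((bump c \<tau> x)\<^sup>2 * (y \<bullet> axis j 1) - 4 * bump c \<tau> x * ((x - c) \<bullet> y) * ((x - c) \<bullet> axis j 1)))"
  unfolding test_fun_def
proof (intro conjI allI)
  fix x
  have d: "((\<lambda>x. (bump c \<tau> x)\<^sup>2) has_derivative (\<lambda>y. - 4 * bump c \<tau> x * ((x - c) \<bullet> y))) (at x)"
    using bump_power_derivative[of c \<tau> 0 x] by (simp add: numeral_2_eq_2 algebra_simps)
  show "((\<lambda>x. - 6 * (bump c \<tau> x)\<^sup>2 * ((x - c) \<bullet> axis j 1)) has_derivative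
    (\<lambda>y. - 6 * ((bump c \<tau> x)\<^sup>2 * (y \<bullet> axis j 1) - 4 * bump c \<tau> x * ((x - c) \<bullet> y) * ((x - c) \<bullet> axis j 1)))) (at x)"
    by (rule derivative_eq_intros d refl | simp add: algebra_simps)+
next
  show "continuous_on UNIV (\<lambda>x. - 6 * ((bump c \<tau> x)\<^sup>2 * (axis i 1 \<bullet> axis j 1) - 4 * bump c \<tau> x * ((x - c) \<bullet> axis i 1) * ((x - c) \<bullet> axis j 1)))" for i
    by (intro continuous_intros bump_continuous)
  have "- 6 * (bump c \<tau> x)\<^sup>2 * ((x - c) \<bullet> axis j 1) = 0" if "x \<notin> cball c (sqrt \<tau>)" for x
    using that bump_eq_0_iff[OF \<tau>, of c x] by (simp add: dist_norm norm_minus_commute)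
  then show "\<exists>K. compact K \<and> (\<forall>x. x \<notin> K \<longrightarrow> - 6 * (bump c \<tau> x)\<^sup>2 * ((x - c) \<bullet> axis j 1) = 0)"
    by (intro exI[of _ "cball c (sqrt \<tau>)"]) auto
qed

lemma bump_power_L2:
  assumes \<tau>: "0 < \<tau>"
  shows "(\<lambda>x. bump c \<tau> x ^ Suc k) \<in> L2"
proof (rule continuous_compact_support_L2[of _ "cball c (sqrt \<tau>)"])
  show "continuous_on UNIV (\<lambda>x. bump c \<tau> x ^ Suc k)" by (intro continuous_intros bump_continuous)
  show "bump c \<tau> x ^ Suc k = 0" if "x \<notin> cball c (sqrt \<tau>)" for x
    using that bump_eq_0_iff[OF \<tau>, of c x] by (simp add: dist_norm norm_minus_commute)
qed simp

lemma pos_part_square_increment: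
  fixes a h :: real
  shows "\<bar>(max 0 (a + h))\<^sup>2 - (max 0 a)\<^sup>2 - 2 * h * max 0 a\<bar> \<le> h\<^sup>2"
proof -
  consider "0 \<le> a" "0 \<le> a + h" | "0 \<le> a" "a + h < 0" | "a < 0" "0 \<le> a + h" | "a < 0" "a + h < 0" by linarith
  then show ?thesis
  proof cases
    case 1
    then show ?thesis by (simp add: power2_eq_square algebra_simps)
  next
    case 2
    have "0 \<le> a * (- 2 * h - a)" using 2 by (intro mult_nonneg_nonneg) auto
    moreover have "a * (- 2 * h - a) \<le> h\<^sup>2" using zero_le_power2[of "a + h"] by (simp add: power2_eq_square algebra_simps)
    ultimately show ?thesis using 2 by (simp add: power2_eq_square algebra_simps)
  next
    case 3
    have "(a + h)\<^sup>2 \<le> h\<^sup>2" using 3 by (intro power_mono) auto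
    then show ?thesis using 3 by simp
  qed simp
qed

lemma bump_moment_derivative:
  assumes v: "v \<in> L2" and \<tau>: "0 < \<tau>"
  shows "((\<lambda>\<tau>. \<integral>x. v x * (bump c \<tau> x)\<^sup>2 \<partial>lborel) has_real_derivative 2 * (\<integral>x. v x * bump c \<tau> x \<partial>lborel)) (at \<tau>)"
proof -
  let ?M = "\<lambda>\<tau>. \<integral>x. v x * (bump c \<tau> x)\<^sup>2 \<partial>lborel" and ?M1 = "\<integral>x. v x * bump c \<tau> x \<partial>lborel"
  let ?B = "cball c (sqrt (\<tau> + 1))"
  have BL: "(\<lambda>x::R2. indicator ?B x) \<in> L2"
    using emeasure_bounded_finite[OF bounded_cball[of c "sqrt (\<tau> + 1)"]] by (intro indicator_L2) auto
  have iB: "integrable lborel (\<lambda>x. \<bar>v x\<bar> * indicator ?B x)" by (rule L2_mult_integrable[OF L2_abs[OF v] BL])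
  define A where "A = (\<integral>x. \<bar>v x\<bar> * indicator ?B x \<partial>lborel)"
  have i2: "integrable lborel (\<lambda>x. v x * (bump c \<sigma> x)\<^sup>2)" and i1: "integrable lborel (\<lambda>x. v x * bump c \<sigma> x)" if "0 < \<sigma>" for \<sigma>
    using L2_mult_integrable[OF v bump_power_L2[OF that, of c 1]] L2_mult_integrable[OF v bump_power_L2[OF that, of c 0]]
    by (simp_all add: power2_eq_square)
  have est: "\<bar>?M (\<tau> + h) - ?M \<tau> - 2 * h * ?M1\<bar> \<le> h\<^sup>2 * A" if h: "\<bar>h\<bar> < min \<tau> 1" for h
  proof -
    have \<tau>h: "0 < \<tau> + h" using h by auto
    have "?M (\<tau> + h) - ?M \<tau> - 2 * h * ?M1 = (\<integral>x. v x * ((bump c (\<tau> + h) x)\<^sup>2 - (bump c \<tau> x)\<^sup>2 - 2 * h * bump c \<tau> x) \<partial>lborel)"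
    proof -
      have "(\<integral>x. v x * ((bump c (\<tau> + h) x)\<^sup>2 - (bump c \<tau> x)\<^sup>2 - 2 * h * bump c \<tau> x) \<partial>lborel)
        = (\<integral>x. v x * (bump c (\<tau> + h) x)\<^sup>2 - v x * (bump c \<tau> x)\<^sup>2 - 2 * h * (v x * bump c \<tau> x) \<partial>lborel)"
        by (simp add: algebra_simps)
      also have "\<dots> = ?M (\<tau> + h) - ?M \<tau> - 2 * h * ?M1" using i2[OF \<tau>] i2[OF \<tau>h] i1[OF \<tau>] by simp
      finally show ?thesis by simp
    qed
    also have "\<bar>\<dots>\<bar> \<le> (\<integral>x. h\<^sup>2 * (\<bar>v x\<bar> * indicator ?B x) \<partial>lborel)"
    proof (rule integral_abs_bound[THEN order_trans], rule integral_mono')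
      show "integrable lborel (\<lambda>x. h\<^sup>2 * (\<bar>v x\<bar> * indicator ?B x))" using iB by simp
      fix x
      show "\<bar>v x * ((bump c (\<tau> + h) x)\<^sup>2 - (bump c \<tau> x)\<^sup>2 - 2 * h * bump c \<tau> x)\<bar> \<le> h\<^sup>2 * (\<bar>v x\<bar> * indicator ?B x)"
      proof (cases "x \<in> ?B")
        case True
        have "\<bar>(bump c (\<tau> + h) x)\<^sup>2 - (bump c \<tau> x)\<^sup>2 - 2 * h * bump c \<tau> x\<bar> \<le> h\<^sup>2"
          using pos_part_square_increment[of "\<tau> - (norm (x - c))\<^sup>2" h] by (simp add: bump_def algebra_simps)
        from mult_left_mono[OF this abs_ge_zero[of "v x"]] show ?thesis using True by (simp add: abs_mult mult.commute)
      next
        case False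
        then have "sqrt (\<tau> + 1) \<le> norm (x - c)" by (simp add: dist_norm norm_minus_commute)
        moreover have "sqrt \<tau> \<le> sqrt (\<tau> + 1)" "sqrt (\<tau> + h) \<le> sqrt (\<tau> + 1)" using h by auto
        ultimately have "bump c \<tau> x = 0" "bump c (\<tau> + h) x = 0" unfolding bump_eq_0_iff[OF \<tau>] bump_eq_0_iff[OF \<tau>h] by linarith+
        then show ?thesis using False by simp
      qed
    qed simp
    also have "\<dots> = h\<^sup>2 * A" using iB by (simp add: A_def)
    finally show ?thesis .
  qed
  have "((\<lambda>h. (?M (\<tau> + h) - ?M \<tau>) / h - 2 * ?M1) \<longlongrightarrow> 0) (at 0)"
  proof (rule Lim_null_comparison[where g="\<lambda>h. \<bar>h\<bar> * A"])
    have "\<forall>\<^sub>F h in at (0::real). h \<noteq> 0 \<and> \<bar>h\<bar> < min \<tau> 1"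
      using \<tau> by (auto simp: eventually_at dist_real_def intro!: exI[of _ "min \<tau> 1"])
    then show "\<forall>\<^sub>F h in at (0::real). norm ((?M (\<tau> + h) - ?M \<tau>) / h - 2 * ?M1) \<le> \<bar>h\<bar> * A"
    proof eventually_elim
      case (elim h)
      then have h: "h \<noteq> 0" by simp
      have "(?M (\<tau> + h) - ?M \<tau>) / h - 2 * ?M1 = (?M (\<tau> + h) - ?M \<tau> - 2 * h * ?M1) / h" using h by (simp add: field_simps)
      also have "norm \<dots> \<le> h\<^sup>2 * A / \<bar>h\<bar>" using est[of h] elim by (simp add: divide_right_mono)
      also have "\<dots> = \<bar>h\<bar> * A" using h by (simp add: field_simps power2_eq_square abs_if)
      finally show ?case .
    qed
    show "((\<lambda>h. \<bar>h\<bar> * A) \<longlongrightarrow> 0) (at 0)" by (rule tendsto_eq_intros | simp)+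
  qed
  then show ?thesis by (simp add: DERIV_def LIM_zero_iff)
qed


context trapping_potential
begin

definition ground_state :: "real \<Rightarrow> (R2 \<Rightarrow> real) \<Rightarrow> bool" where
  "ground_state lam v \<longleftrightarrow> 0 \<le> lam \<and> (\<forall>u\<in>Hspace V. lam * sqn u \<le> Qf V u) \<and> v \<in> Hspace V \<and> Qf V v = lam * sqn v"

lemma ground_state_Euler_Lagrange:
  assumes g: "ground_state lam v" and \<phi>: "\<phi> \<in> Hspace V"
  shows "Bf V v \<phi> = lam * ip v \<phi>"
proof -
  have v: "v \<in> Hspace V" "Qf V v = lam * sqn v" and low: "\<And>u. u \<in> Hspace V \<Longrightarrow> lam * sqn u \<le> Qf V u"
    using g by (auto simp: ground_state_def)
  have "(Bf V v \<phi> - lam * ip v \<phi>)\<^sup>2 \<le> 0 * (Qf V \<phi> - lam * sqn \<phi>)"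
  proof (rule quadratic_nonneg_discriminant)
    fix t
    have "lam * sqn (\<lambda>x. 1 * v x + t * \<phi> x) \<le> Qf V (\<lambda>x. 1 * v x + t * \<phi> x)"
      by (intro low Hspace_lincomb v \<phi>)
    then show "0 \<le> 0 + 2 * t * (Bf V v \<phi> - lam * ip v \<phi>) + t\<^sup>2 * (Qf V \<phi> - lam * sqn \<phi>)"
      unfolding Hspace_lincomb(2)[OF v(1) \<phi>] sqn_lincomb[OF HspaceD(2)[OF v(1)] HspaceD(2)[OF \<phi>]] v(2)
      by (simp add: algebra_simps)
    show "0 \<le> Qf V \<phi> - lam * sqn \<phi>" using low[OF \<phi>] by simp
  qed
  then show ?thesis by simp
qed

text \<open>Testing the eigenvalue equation with \<open>(\<tau> - \<bar>x - c\<bar>\<^sup>2)\<^sub>+\<^sup>3\<close>, whose Laplacian is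
  \<open>24 \<tau> m - 36 m\<^sup>2\<close> with \<open>m = (\<tau> - \<bar>x - c\<bar>\<^sup>2)\<^sub>+\<close>.\<close>

lemma ground_state_moment_inequality:
  assumes g: "ground_state lam v" and pos: "AE x in lborel. 0 \<le> v x" and \<tau>: "0 < \<tau>" and C: "0 \<le> C"
    and VC: "AE x in lborel. x \<in> cball c (sqrt \<tau>) \<longrightarrow> V x \<le> C"
  shows "24 * \<tau> * (\<integral>x. v x * bump c \<tau> x \<partial>lborel) - 36 * (\<integral>x. v x * (bump c \<tau> x)\<^sup>2 \<partial>lborel)
    \<le> C * \<tau> * (\<integral>x. v x * (bump c \<tau> x)\<^sup>2 \<partial>lborel)"
proof -
  have v: "v \<in> Hspace V" and lam: "0 \<le> lam" using g by (auto simp: ground_state_def)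
  note vD = HspaceD[OF v]
  note T3 = test_fun_bump_cube[OF \<tau>, of c]
  let ?m = "bump c \<tau>" and ?\<phi> = "\<lambda>x. bump c \<tau> x ^ 3"
  have \<phi>: "?\<phi> \<in> Hspace V" by (rule test_fun_Hspace[OF T3])
  have i1: "integrable lborel (\<lambda>x. v x * ?m x)" and i2: "integrable lborel (\<lambda>x. v x * (?m x)\<^sup>2)"
    and i3: "integrable lborel (\<lambda>x. v x * ?m x ^ 3)"
    using L2_mult_integrable[OF vD(2) bump_power_L2[OF \<tau>, of c 0]] L2_mult_integrable[OF vD(2) bump_power_L2[OF \<tau>, of c 1]]
      L2_mult_integrable[OF vD(2) bump_power_L2[OF \<tau>, of c 2]]
    by (simp_all add: power2_eq_square power3_eq_cube mult.assoc)
  let ?L = "\<lambda>j x. - 6 * ((?m x)\<^sup>2 - 4 * ?m x * ((x - c) $ j)\<^sup>2)"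
  have grad: "ip (\<lambda>x. wgrad v x $ j) (\<lambda>x. wgrad ?\<phi> x $ j) = - (\<integral>x. v x * ?L j x \<partial>lborel)" for j
  proof -
    have "ip (\<lambda>x. wgrad v x $ j) (\<lambda>x. wgrad ?\<phi> x $ j) = (\<integral>x. wgrad v x $ j * (- 6 * (?m x)\<^sup>2 * ((x - c) \<bullet> axis j 1)) \<partial>lborel)"
      unfolding ip_def
    proof (rule integral_cong_AE)
      have [measurable]: "(\<lambda>x. wgrad v x $ j) \<in> borel_measurable borel" "(\<lambda>x. wgrad ?\<phi> x $ j) \<in> borel_measurable borel"
        using L2D(1)[OF H1D(3)[OF vD(1)]] L2D(1)[OF H1D(3)[OF HspaceD(1)[OF \<phi>]]] by auto
      show "(\<lambda>x. wgrad v x $ j * wgrad ?\<phi> x $ j) \<in> borel_measurable lborel" by measurable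
      show "(\<lambda>x. wgrad v x $ j * (- 6 * (?m x)\<^sup>2 * ((x - c) \<bullet> axis j 1))) \<in> borel_measurable lborel" by measurable
      show "AE x in lborel. wgrad v x $ j * wgrad ?\<phi> x $ j = wgrad v x $ j * (- 6 * (?m x)\<^sup>2 * ((x - c) \<bullet> axis j 1))"
        using test_fun_Hspace(2)[OF T3, of j] by eventually_elim simp
    qed
    also have "\<dots> = - (\<integral>x. v x * (- 6 * ((?m x)\<^sup>2 * (axis j 1 \<bullet> axis j (1::real)) - 4 * ?m x * ((x - c) \<bullet> axis j 1) * ((x - c) \<bullet> axis j 1))) \<partial>lborel)"
      using weak_grad_testD[where j=j, OF H1D(2)[OF vD(1)] test_fun_bump_square[OF \<tau>, of c j]] by simp
    finally show ?thesis by (simp add: inner_axis inner_axis_axis power2_eq_square mult.assoc)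
  qed
  have Li: "integrable lborel (\<lambda>x. v x * ?L j x)" for j
    using L2_mult_integrable[OF vD(2) test_fun_L2(2)[OF test_fun_bump_square[OF \<tau>, of c j], of j]]
    by (simp add: inner_axis inner_axis_axis power2_eq_square mult.assoc)
  have "(\<integral>x. v x * ?L 1 x \<partial>lborel) + (\<integral>x. v x * ?L 2 x \<partial>lborel) = (\<integral>x. v x * ?L 1 x + v x * ?L 2 x \<partial>lborel)"
    using Li[of 1] Li[of 2] by (rule Bochner_Integration.integral_add[symmetric])
  also have "\<dots> = (\<integral>x. 24 * \<tau> * (v x * ?m x) - 36 * (v x * (?m x)\<^sup>2) \<partial>lborel)"
  proof (rule Bochner_Integration.integral_cong)
    fix x
    have ms: "?m x * (((x - c) $ 1)\<^sup>2 + ((x - c) $ 2)\<^sup>2) = ?m x * (\<tau> - ?m x)"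
      unfolding norm_sq_R2[symmetric] by (auto simp: bump_def max_def)
    have "?L 1 x + ?L 2 x = - 12 * (?m x)\<^sup>2 + 24 * (?m x * (((x - c) $ 1)\<^sup>2 + ((x - c) $ 2)\<^sup>2))"
      by (simp add: algebra_simps)
    also have "\<dots> = 24 * \<tau> * ?m x - 36 * (?m x)\<^sup>2" unfolding ms by (simp add: power2_eq_square algebra_simps)
    finally have "v x * (?L 1 x + ?L 2 x) = v x * (24 * \<tau> * ?m x - 36 * (?m x)\<^sup>2)" by (rule arg_cong)
    then show "v x * ?L 1 x + v x * ?L 2 x = 24 * \<tau> * (v x * ?m x) - 36 * (v x * (?m x)\<^sup>2)"
      by (simp add: algebra_simps)
  qed simp
  also have "\<dots> = 24 * \<tau> * (\<integral>x. v x * ?m x \<partial>lborel) - 36 * (\<integral>x. v x * (?m x)\<^sup>2 \<partial>lborel)" using i1 i2 by simp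
  finally have LS: "(\<integral>x. v x * ?L 1 x \<partial>lborel) + (\<integral>x. v x * ?L 2 x \<partial>lborel)
     = 24 * \<tau> * (\<integral>x. v x * ?m x \<partial>lborel) - 36 * (\<integral>x. v x * (?m x)\<^sup>2 \<partial>lborel)" .
  have "Bf V v ?\<phi> = - ((\<integral>x. v x * ?L 1 x \<partial>lborel) + (\<integral>x. v x * ?L 2 x \<partial>lborel)) + ip (\<lambda>x. sqrt (V x) * v x) (\<lambda>x. sqrt (V x) * ?\<phi> x)"
    unfolding Bf_def grad by simp
  moreover have "Bf V v ?\<phi> = lam * ip v ?\<phi>" by (rule ground_state_Euler_Lagrange[OF g \<phi>])
  moreover have "0 \<le> lam * ip v ?\<phi>"
    unfolding ip_def using lam pos by (intro mult_nonneg_nonneg integral_nonneg_AE) auto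
  moreover have "ip (\<lambda>x. sqrt (V x) * v x) (\<lambda>x. sqrt (V x) * ?\<phi> x) \<le> (\<integral>x. C * \<tau> * (v x * (?m x)\<^sup>2) \<partial>lborel)"
    unfolding ip_def
  proof (rule integral_mono_AE)
    show "integrable lborel (\<lambda>x. sqrt (V x) * v x * (sqrt (V x) * ?\<phi> x))"
      by (rule L2_mult_integrable[OF vD(3) HspaceD(3)[OF \<phi>]])
    show "integrable lborel (\<lambda>x. C * \<tau> * (v x * (?m x)\<^sup>2))" using i2 by simp
    show "AE x in lborel. sqrt (V x) * v x * (sqrt (V x) * ?\<phi> x) \<le> C * \<tau> * (v x * (?m x)\<^sup>2)"
      using pos VC
    proof eventually_elim
      case (elim x)
      have e: "sqrt (V x) * v x * (sqrt (V x) * ?\<phi> x) = V x * ?m x * (v x * (?m x)\<^sup>2)"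
      proof -
        have "sqrt (V x) * v x * (sqrt (V x) * ?\<phi> x) = (sqrt (V x) * sqrt (V x)) * ?m x * (v x * (?m x)\<^sup>2)"
          by (simp only: power2_eq_square power3_eq_cube mult_ac)
        then show ?thesis by simp
      qed
      show ?case
      proof (cases "x \<in> cball c (sqrt \<tau>)")
        case True
        have "?m x \<le> \<tau>" using \<tau> by (simp add: bump_def)
        then have "V x * ?m x \<le> C * \<tau>" using True elim C by (intro mult_mono) auto
        then show ?thesis unfolding e using elim by (intro mult_right_mono) auto
      next
        case False
        then have "?m x = 0" using bump_eq_0_iff[OF \<tau>, of c x] by (simp add: dist_norm norm_minus_commute)
        then show ?thesis by simp
      qed
    qed
  qed
  moreover have "(\<integral>x. C * \<tau> * (v x * (?m x)\<^sup>2) \<partial>lborel) = C * \<tau> * (\<integral>x. v x * (?m x)\<^sup>2 \<partial>lborel)" using i2 by simp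
  ultimately show ?thesis using LS by linarith
qed

lemma ground_state_moment_decay:
  assumes g: "ground_state lam v" and pos: "AE x in lborel. 0 \<le> v x" and T: "0 < \<sigma>" "\<sigma> \<le> T" and C: "0 \<le> C"
    and VC: "AE x in lborel. x \<in> cball c (sqrt T) \<longrightarrow> V x \<le> C"
  shows "(\<integral>x. v x * (bump c T x)\<^sup>2 \<partial>lborel) \<le> T^3 * exp (C / 12 * T) * ((\<integral>x. v x * (bump c \<sigma> x)\<^sup>2 \<partial>lborel) / \<sigma>^3)"
proof -
  have v: "v \<in> L2" using g by (auto simp: ground_state_def dest: HspaceD)
  define M where "M \<tau> = (\<integral>x. v x * (bump c \<tau> x)\<^sup>2 \<partial>lborel)" for \<tau>
  define M1 where "M1 \<tau> = (\<integral>x. v x * bump c \<tau> x \<partial>lborel)" for \<tau>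
  define k where "k = C / 12"
  have M0: "0 \<le> M \<tau>" for \<tau> unfolding M_def using pos by (intro integral_nonneg_AE) auto
  define h where "h \<tau> = M \<tau> / \<tau>^3 * exp (- k * \<tau>)" for \<tau>
  have "h T \<le> h \<sigma>"
  proof (rule DERIV_nonpos_imp_nonincreasing[OF T(2)])
    fix \<tau> assume \<tau>: "\<sigma> \<le> \<tau>" "\<tau> \<le> T"
    then have \<tau>0: "0 < \<tau>" using T by simp
    have "AE x in lborel. x \<in> cball c (sqrt \<tau>) \<longrightarrow> V x \<le> C"
      using VC
    proof eventually_elim
      case (elim x)
      then show ?case using subset_cball[OF real_sqrt_le_mono[OF \<tau>(2)], of c] by blast
    qed
    from ground_state_moment_inequality[OF g pos \<tau>0 C this]
    have le: "2 * \<tau> * M1 \<tau> - 3 * M \<tau> - k * \<tau> * M \<tau> \<le> 0" unfolding M_def M1_def k_def by (simp add: field_simps)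
    have dM: "(M has_real_derivative 2 * M1 \<tau>) (at \<tau>)"
      unfolding M_def[abs_def] M1_def by (rule bump_moment_derivative[OF v \<tau>0])
    have dP: "((\<lambda>\<tau>. exp (- k * \<tau>) / \<tau>^3) has_real_derivative - (exp (- k * \<tau>) / \<tau>^4 * (k * \<tau> + 3))) (at \<tau>)"
    proof (rule DERIV_cong)
      show "((\<lambda>\<tau>. exp (- k * \<tau>) / \<tau>^3) has_real_derivative
        (exp (- k * \<tau>) * (- k) * \<tau>^3 - exp (- k * \<tau>) * (3 * \<tau>\<^sup>2)) / (\<tau>^3 * \<tau>^3)) (at \<tau>)"
        by (rule DERIV_divide) (use \<tau>0 in \<open>auto intro!: derivative_eq_intros\<close>)
      have "\<tau>^3 * \<tau>^3 = \<tau>^4 * \<tau>\<^sup>2" by (simp add: power2_eq_square power3_eq_cube power4_eq_xxxx)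
      moreover have "exp (- k * \<tau>) * (- k) * \<tau>^3 - exp (- k * \<tau>) * (3 * \<tau>\<^sup>2) = - (exp (- k * \<tau>) * (k * \<tau> + 3)) * \<tau>\<^sup>2"
        by (simp add: power2_eq_square power3_eq_cube algebra_simps)
      ultimately have "(exp (- k * \<tau>) * (- k) * \<tau>^3 - exp (- k * \<tau>) * (3 * \<tau>\<^sup>2)) / (\<tau>^3 * \<tau>^3)
        = - (exp (- k * \<tau>) * (k * \<tau> + 3)) * \<tau>\<^sup>2 / (\<tau>^4 * \<tau>\<^sup>2)" by (simp only:)
      also have "\<dots> = - (exp (- k * \<tau>) * (k * \<tau> + 3)) / \<tau>^4"
        by (rule nonzero_mult_divide_mult_cancel_right) (use \<tau>0 in simp)
      finally show "(exp (- k * \<tau>) * (- k) * \<tau>^3 - exp (- k * \<tau>) * (3 * \<tau>\<^sup>2)) / (\<tau>^3 * \<tau>^3) = - (exp (- k * \<tau>) / \<tau>^4 * (k * \<tau> + 3))"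
        by simp
    qed
    have h_eq: "h = (\<lambda>\<tau>. M \<tau> * (exp (- k * \<tau>) / \<tau>^3))" by (auto simp: h_def)
    have "(h has_real_derivative 2 * M1 \<tau> * (exp (- k * \<tau>) / \<tau>^3) + - (exp (- k * \<tau>) / \<tau>^4 * (k * \<tau> + 3)) * M \<tau>) (at \<tau>)"
      unfolding h_eq by (rule DERIV_mult[OF dM dP])
    moreover have "2 * M1 \<tau> * (exp (- k * \<tau>) / \<tau>^3) + - (exp (- k * \<tau>) / \<tau>^4 * (k * \<tau> + 3)) * M \<tau>
      = exp (- k * \<tau>) / \<tau>^4 * (2 * \<tau> * M1 \<tau> - 3 * M \<tau> - k * \<tau> * M \<tau>)"
    proof -
      have "exp (- k * \<tau>) / \<tau>^3 = exp (- k * \<tau>) / \<tau>^4 * \<tau>" using \<tau>0 by (simp add: power3_eq_cube power4_eq_xxxx)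
      then show ?thesis by (simp only:) (simp add: algebra_simps add_divide_distrib)
    qed
    moreover have "exp (- k * \<tau>) / \<tau>^4 * (2 * \<tau> * M1 \<tau> - 3 * M \<tau> - k * \<tau> * M \<tau>) \<le> 0"
      using le by (intro mult_nonneg_nonpos) auto
    ultimately show "\<exists>y. (h has_real_derivative y) (at \<tau>) \<and> y \<le> 0" by auto
  qed
  also have "h \<sigma> \<le> M \<sigma> / \<sigma>^3 * 1"
    unfolding h_def using M0[of \<sigma>] T C by (intro mult_left_mono) (auto simp: k_def)
  finally have "h T \<le> M \<sigma> / \<sigma>^3" by simp
  then have "T^3 * exp (k * T) * h T \<le> T^3 * exp (k * T) * (M \<sigma> / \<sigma>^3)" using T by (intro mult_left_mono) auto
  moreover have "T^3 * exp (k * T) * h T = M T"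
    unfolding h_def using T by (simp add: exp_minus field_simps)
  ultimately show ?thesis by (simp add: M_def k_def)
qed

lemma nn_integral_shifted_zero_set:
  assumes v: "v \<in> Hspace V" and Z: "Z = {x \<in> cball 0 \<rho>. v x = 0}"
  shows "(\<integral>\<^sup>+y. indicator Z y * ennreal (v (y + h)) \<partial>lborel)
    \<le> ennreal (sqrt (measure lborel (cball (0::R2) \<rho>)) * sqrt (2 * Qf V v) * norm h)"
proof -
  note vD = HspaceD[OF v]
  define w where "w y = v (y + h) - v y" for y
  have wL: "w \<in> L2" unfolding w_def[abs_def] by (intro L2_diff L2_shift vD)
  have IL: "(\<lambda>y::R2. indicator (cball 0 \<rho>) y) \<in> L2" by (rule indicator_cball_L2)
  have "(\<integral>\<^sup>+y. indicator Z y * ennreal (v (y + h)) \<partial>lborel) \<le> (\<integral>\<^sup>+y. ennreal (indicator (cball 0 \<rho>) y * \<bar>w y\<bar>) \<partial>lborel)"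
    by (intro nn_integral_mono) (auto simp: Z w_def indicator_def intro!: ennreal_leI)
  also have "\<dots> = ennreal (ip (\<lambda>y. indicator (cball 0 \<rho>) y) (\<lambda>y. \<bar>w y\<bar>))"
    unfolding ip_def by (intro nn_integral_eq_integral L2_mult_integrable IL L2_abs wL) auto
  also have "\<dots> \<le> ennreal (sqrt (measure lborel (cball (0::R2) \<rho>)) * sqrt (2 * Qf V v) * norm h)"
  proof (rule ennreal_leI)
    have "ip (\<lambda>y. indicator (cball 0 \<rho>) y) (\<lambda>y. \<bar>w y\<bar>) \<le> sqrt (measure lborel (cball (0::R2) \<rho>)) * sqrt (sqn w)"
      using abs_ip_le[OF IL L2_abs[OF wL]] by (simp add: sqn_indicator_cball) (simp add: sqn_def)
    also have "sqn w \<le> 2 * (norm h)\<^sup>2 * (sqn (\<lambda>x. wgrad v x $ 1) + sqn (\<lambda>x. wgrad v x $ 2))"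
      unfolding w_def[abs_def] by (rule sqn_shift_diff[OF vD(2) H1D(2)[OF vD(1)] H1D(3)[OF vD(1)]])
    also have "\<dots> \<le> 2 * (norm h)\<^sup>2 * Qf V v" by (intro mult_left_mono) (auto simp: Qf_def)
    also have "\<dots> = (2 * Qf V v) * (norm h)\<^sup>2" by simp
    also have "sqrt \<dots> = sqrt (2 * Qf V v) * norm h" by (simp only: real_sqrt_mult real_sqrt_abs) simp
    finally show "ip (\<lambda>y. indicator (cball 0 \<rho>) y) (\<lambda>y. \<bar>w y\<bar>) \<le> sqrt (measure lborel (cball (0::R2) \<rho>)) * sqrt (2 * Qf V v) * norm h"
      by (simp add: mult.assoc mult_left_mono)
  qed
  finally show ?thesis .
qed

lemma ground_state_moment_vanishes:
  assumes g: "ground_state lam v" and pos: "AE x in lborel. 0 \<le> v x" and T: "0 < T"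
  shows "AE y in lborel. y \<in> cball 0 \<rho> \<and> v y = 0 \<longrightarrow> (\<integral>x. v x * (bump y T x)\<^sup>2 \<partial>lborel) \<le> 0"
proof -
  have v: "v \<in> Hspace V" using g by (auto simp: ground_state_def)
  note vD = HspaceD[OF v]
  have vm[measurable]: "v \<in> borel_measurable borel" by (rule L2D(1)[OF vD(2)])
  have [measurable]: "cball (0::R2) r \<in> sets borel" for r by (simp add: borel_closed)
  define Z where "Z = {x \<in> cball 0 \<rho>. v x = 0}"
  have [measurable]: "Z \<in> sets borel" unfolding Z_def by measurable
  define M where "M y \<sigma> = (\<integral>x. v x * (bump y \<sigma> x)\<^sup>2 \<partial>lborel)" for y \<sigma>
  have "(\<lambda>y. M y T) \<in> borel_measurable lborel"
    unfolding M_def bump_def by (rule lborel.borel_measurable_lebesgue_integral) measurable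
  then have [measurable]: "(\<lambda>y. M y T) \<in> borel_measurable borel" by simp
  have M_nn: "ennreal (M y \<sigma>) = (\<integral>\<^sup>+h. ennreal ((bump 0 \<sigma> h)\<^sup>2) * ennreal (v (y + h)) \<partial>lborel)" if \<sigma>: "0 < \<sigma>" for y \<sigma>
  proof -
    have "ennreal (M y \<sigma>) = (\<integral>\<^sup>+x. ennreal (v x * (bump y \<sigma> x)\<^sup>2) \<partial>lborel)"
      unfolding M_def using pos L2_mult_integrable[OF vD(2) bump_power_L2[OF \<sigma>, of y 1]]
      by (intro nn_integral_eq_integral[symmetric]) (auto simp: power2_eq_square)
    also have "\<dots> = (\<integral>\<^sup>+h. ennreal (v (h + y) * (bump y \<sigma> (h + y))\<^sup>2) \<partial>lborel)"
      by (rule nn_integral_shift[symmetric]) measurable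
    also have "\<dots> = (\<integral>\<^sup>+h. ennreal ((bump 0 \<sigma> h)\<^sup>2) * ennreal (v (y + h)) \<partial>lborel)"
      by (intro nn_integral_cong) (simp add: bump_def ennreal_mult'' mult.commute add.commute)
    finally show ?thesis .
  qed
  have "compact (cball (0::R2) (\<rho> + sqrt T))" by simp
  then obtain C0 where C0: "AE x in lborel. x \<in> cball 0 (\<rho> + sqrt T) \<longrightarrow> \<bar>V x\<bar> \<le> C0"
    using Linf unfolding Linf_loc_def by blast
  define C where "C = max 0 C0"
  have C: "0 \<le> C" by (simp add: C_def)
  have VC: "AE x in lborel. x \<in> cball y (sqrt T) \<longrightarrow> V x \<le> C" if y: "y \<in> cball 0 \<rho>" for y
    using C0
  proof eventually_elim
    case (elim x)
    show ?case
    proof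
      assume "x \<in> cball y (sqrt T)"
      then have "x \<in> cball 0 (\<rho> + sqrt T)" using y norm_triangle_ineq[of y "x - y"] by (simp add: dist_norm norm_minus_commute)
      then show "V x \<le> C" using elim by (auto simp: C_def)
    qed
  qed
  define CT where "CT = T^3 * exp (C / 12 * T)"
  have CT: "0 \<le> CT" using T by (simp add: CT_def)
  define A where "A = sqrt (measure lborel (cball (0::R2) \<rho>)) * sqrt (2 * Qf V v)"
  have A: "0 \<le> A" by (simp add: A_def)
  define U where "U = measure lborel (cball (0::R2) 1)"
  have bd: "(\<integral>\<^sup>+y. indicator Z y * ennreal (M y T) \<partial>lborel) \<le> ennreal (CT * A * U * sqrt \<sigma>)" if \<sigma>: "0 < \<sigma>" "\<sigma> \<le> T" for \<sigma>
  proof -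
    have "(\<integral>\<^sup>+y. indicator Z y * ennreal (M y T) \<partial>lborel)
      \<le> (\<integral>\<^sup>+y. ennreal (CT / \<sigma>^3) * (indicator Z y * (\<integral>\<^sup>+h. ennreal ((bump 0 \<sigma> h)\<^sup>2) * ennreal (v (y + h)) \<partial>lborel)) \<partial>lborel)"
    proof (rule nn_integral_mono)
      fix y
      show "indicator Z y * ennreal (M y T) \<le> ennreal (CT / \<sigma>^3) * (indicator Z y * (\<integral>\<^sup>+h. ennreal ((bump 0 \<sigma> h)\<^sup>2) * ennreal (v (y + h)) \<partial>lborel))"
      proof (cases "y \<in> Z")
        case True
        then have "M y T \<le> CT * (M y \<sigma> / \<sigma>^3)"
          unfolding M_def CT_def Z_def using ground_state_moment_decay[OF g pos \<sigma> C VC] by auto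
        also have "\<dots> = CT / \<sigma>^3 * M y \<sigma>" by simp
        finally have "ennreal (M y T) \<le> ennreal (CT / \<sigma>^3 * M y \<sigma>)" by (rule ennreal_leI)
        also have "\<dots> = ennreal (CT / \<sigma>^3) * ennreal (M y \<sigma>)" by (rule ennreal_mult') (use CT \<sigma> in simp)
        finally show ?thesis using True M_nn[OF \<sigma>(1)] by simp
      qed simp
    qed
    also have "\<dots> = ennreal (CT / \<sigma>^3) * (\<integral>\<^sup>+y. indicator Z y * (\<integral>\<^sup>+h. ennreal ((bump 0 \<sigma> h)\<^sup>2) * ennreal (v (y + h)) \<partial>lborel) \<partial>lborel)"
      by (rule nn_integral_cmult) measurable
    also have "(\<integral>\<^sup>+y. indicator Z y * (\<integral>\<^sup>+h. ennreal ((bump 0 \<sigma> h)\<^sup>2) * ennreal (v (y + h)) \<partial>lborel) \<partial>lborel)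
      = (\<integral>\<^sup>+y. (\<integral>\<^sup>+h. ennreal ((bump 0 \<sigma> h)\<^sup>2) * (indicator Z y * ennreal (v (y + h))) \<partial>lborel) \<partial>lborel)"
      by (intro nn_integral_cong, subst nn_integral_cmult[symmetric]) (auto simp: mult_ac)
    also have "\<dots> = (\<integral>\<^sup>+h. (\<integral>\<^sup>+y. ennreal ((bump 0 \<sigma> h)\<^sup>2) * (indicator Z y * ennreal (v (y + h))) \<partial>lborel) \<partial>lborel)"
      by (rule lborel_pair.Fubini'[symmetric]) measurable
    also have "\<dots> \<le> (\<integral>\<^sup>+h. ennreal (\<sigma>\<^sup>2 * (A * sqrt \<sigma>)) * indicator (cball (0::R2) (sqrt \<sigma>)) h \<partial>lborel)"
    proof (rule nn_integral_mono)
      fix h :: R2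
      have "(\<integral>\<^sup>+y. ennreal ((bump 0 \<sigma> h)\<^sup>2) * (indicator Z y * ennreal (v (y + h))) \<partial>lborel)
        = ennreal ((bump 0 \<sigma> h)\<^sup>2) * (\<integral>\<^sup>+y. indicator Z y * ennreal (v (y + h)) \<partial>lborel)"
        by (rule nn_integral_cmult) measurable
      also have "\<dots> \<le> ennreal ((bump 0 \<sigma> h)\<^sup>2) * ennreal (A * norm h)"
        unfolding A_def by (intro mult_left_mono nn_integral_shifted_zero_set[OF v Z_def]) simp
      also have "\<dots> \<le> ennreal (\<sigma>\<^sup>2 * (A * sqrt \<sigma>)) * indicator (cball (0::R2) (sqrt \<sigma>)) h"
      proof (cases "norm h \<le> sqrt \<sigma>")
        case True
        have "(bump 0 \<sigma> h)\<^sup>2 \<le> \<sigma>\<^sup>2" using \<sigma> by (intro power_mono) (auto simp: bump_def)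
        then have "(bump 0 \<sigma> h)\<^sup>2 * (A * norm h) \<le> \<sigma>\<^sup>2 * (A * sqrt \<sigma>)"
          using True A by (intro mult_mono) auto
        then show ?thesis using True A by (simp add: ennreal_mult[symmetric] ennreal_leI)
      next
        case False
        then show ?thesis using bump_eq_0_iff[OF \<sigma>(1), of 0 h] by simp
      qed
      finally show "(\<integral>\<^sup>+y. ennreal ((bump 0 \<sigma> h)\<^sup>2) * (indicator Z y * ennreal (v (y + h))) \<partial>lborel)
        \<le> ennreal (\<sigma>\<^sup>2 * (A * sqrt \<sigma>)) * indicator (cball (0::R2) (sqrt \<sigma>)) h" .
    qed
    also have "\<dots> = ennreal (\<sigma>\<^sup>2 * (A * sqrt \<sigma>)) * ennreal (U * \<sigma>)"
    proof -
      have "emeasure lborel (cball (0::R2) (sqrt \<sigma>)) = ennreal (measure lborel (cball (0::R2) (sqrt \<sigma>)))"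
        using emeasure_bounded_finite[OF bounded_cball[of "0::R2" "sqrt \<sigma>"]] by (intro emeasure_eq_ennreal_measure) auto
      also have "measure lborel (cball (0::R2) (sqrt \<sigma>)) = U * \<sigma>"
        unfolding U_def using content_cball[of "sqrt \<sigma>" "0::R2"] content_cball[of 1 "0::R2"] \<sigma> by simp
      finally show ?thesis by (subst nn_integral_cmult_indicator) auto
    qed
    finally have "(\<integral>\<^sup>+y. indicator Z y * ennreal (M y T) \<partial>lborel) \<le> ennreal (CT / \<sigma>^3) * (ennreal (\<sigma>\<^sup>2 * (A * sqrt \<sigma>)) * ennreal (U * \<sigma>))"
      by (simp add: mult_left_mono)
    also have "\<dots> = ennreal (CT / \<sigma>^3 * (\<sigma>\<^sup>2 * (A * sqrt \<sigma>) * (U * \<sigma>)))"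
    proof -
      have "ennreal a * (ennreal b * ennreal c) = ennreal (a * (b * c))" if "0 \<le> a" "0 \<le> b" "0 \<le> c" for a b c
        using that by (simp add: ennreal_mult)
      then show ?thesis using CT A \<sigma> by (simp add: U_def)
    qed
    also have "CT / \<sigma>^3 * (\<sigma>\<^sup>2 * (A * sqrt \<sigma>) * (U * \<sigma>)) = CT * A * U * sqrt \<sigma>"
      using \<sigma> by (simp add: field_simps power2_eq_square power3_eq_cube)
    finally show ?thesis .
  qed
  have "(\<integral>\<^sup>+y. indicator Z y * ennreal (M y T) \<partial>lborel) \<le> ennreal (CT * A * U * sqrt (T * 0))"
  proof (rule LIMSEQ_le_const)
    show "(\<lambda>n. ennreal (CT * A * U * sqrt (T * (1 / real (Suc n))))) \<longlonglongrightarrow> ennreal (CT * A * U * sqrt (T * 0))"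
      by (intro tendsto_ennrealI tendsto_intros LIMSEQ_Suc[OF lim_1_over_n])
    show "\<exists>N. \<forall>n\<ge>N. (\<integral>\<^sup>+y. indicator Z y * ennreal (M y T) \<partial>lborel) \<le> ennreal (CT * A * U * sqrt (T * (1 / real (Suc n))))"
      using T by (intro exI[of _ 0] allI impI bd) (auto simp: field_simps)
  qed
  then have "(\<integral>\<^sup>+y. indicator Z y * ennreal (M y T) \<partial>lborel) = 0" by simp
  then have "AE y in lborel. indicator Z y * ennreal (M y T) = 0"
    by (subst (asm) nn_integral_0_iff_AE) auto
  then show ?thesis
  proof eventually_elim
    case (elim y)
    then show ?case unfolding Z_def M_def by (auto simp: ennreal_eq_0_iff)
  qed
qed

lemma ground_state_zero_or_positive:
  assumes g: "ground_state lam v" and pos: "AE x in lborel. 0 \<le> v x"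
  shows "(AE x in lborel. v x = 0) \<or> (AE x in lborel. 0 < v x)"
proof (cases "AE x in lborel. v x \<noteq> 0")
  case True
  then have "AE x in lborel. 0 < v x" using pos by eventually_elim simp
  then show ?thesis ..
next
  case False
  have v: "v \<in> Hspace V" using g by (auto simp: ground_state_def)
  let ?P = "\<lambda>y. \<forall>k n::nat. y \<in> cball 0 (real k) \<and> v y = 0 \<longrightarrow> (\<integral>x. v x * (bump y (real (Suc n)) x)\<^sup>2 \<partial>lborel) \<le> 0"
  have "AE y in lborel. ?P y"
    unfolding AE_all_countable by (intro allI ground_state_moment_vanishes[OF g pos]) simp
  have "\<exists>y. ?P y \<and> v y = 0"
  proof (rule ccontr)
    assume "\<nexists>y. ?P y \<and> v y = 0"
    then have "\<And>y. ?P y \<Longrightarrow> v y \<noteq> 0" by blast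
    with \<open>AE y in lborel. ?P y\<close> have "AE y in lborel. v y \<noteq> 0" by (rule eventually_mono)
    with False show False by simp
  qed
  then obtain y where Py: "?P y" and vy: "v y = 0" by blast
  obtain k :: nat where "norm y \<le> real k" using real_arch_simple by blast
  then have le0: "(\<integral>x. v x * (bump y (real (Suc n)) x)\<^sup>2 \<partial>lborel) \<le> 0" for n
    using Py[rule_format, of k n] vy by simp
  have "AE x in lborel. v x * (bump y (real (Suc n)) x)\<^sup>2 = 0" for n
  proof -
    have i: "integrable lborel (\<lambda>x. v x * (bump y (real (Suc n)) x)\<^sup>2)"
      using L2_mult_integrable[OF HspaceD(2)[OF v] bump_power_L2[of "real (Suc n)" y 1]] by (simp add: power2_eq_square)
    have nn: "AE x in lborel. 0 \<le> v x * (bump y (real (Suc n)) x)\<^sup>2" using pos by eventually_elim simp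
    have "(\<integral>x. v x * (bump y (real (Suc n)) x)\<^sup>2 \<partial>lborel) = 0"
      using le0[of n] integral_nonneg_AE[OF nn] by simp
    then show ?thesis using integral_nonneg_eq_0_iff_AE[OF i nn] by simp
  qed
  then have "AE x in lborel. \<forall>n. v x * (bump y (real (Suc n)) x)\<^sup>2 = 0" unfolding AE_all_countable by blast
  then have "AE x in lborel. v x = 0"
  proof eventually_elim
    case (elim x)
    obtain n :: nat where n: "(norm (x - y))\<^sup>2 < real n" using reals_Archimedean2 by blast
    then have "0 < bump y (real (Suc n)) x" by (simp add: bump_def)
    then show ?case using elim[rule_format, of n] by simp
  qed
  then show ?thesis ..
qed

lemma ground_state_constant_sign:
  assumes g: "ground_state lam z" and z1: "sqn z = 1"
  shows "(AE x in lborel. 0 < z x) \<or> (AE x in lborel. z x < 0)"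
proof -
  have z: "z \<in> Hspace V" "Qf V z = lam * sqn z" and lam: "0 \<le> lam" and low: "\<And>u. u \<in> Hspace V \<Longrightarrow> lam * sqn u \<le> Qf V u"
    using g by (auto simp: ground_state_def)
  note a = Hspace_abs[OF z(1)]
  have sa: "sqn (\<lambda>x. \<bar>z x\<bar>) = sqn z" by (simp add: sqn_def)
  define p where "p x = \<bar>z x\<bar> + z x" for x
  define q where "q x = \<bar>z x\<bar> - z x" for x
  have p: "p \<in> Hspace V" and q: "q \<in> Hspace V"
    unfolding p_def[abs_def] q_def[abs_def] by (intro Hspace_add Hspace_diff a z)+
  have "Qf V p + Qf V q = 2 * Qf V (\<lambda>x. \<bar>z x\<bar>) + 2 * Qf V z"
    unfolding p_def[abs_def] q_def[abs_def] by (rule Qf_parallelogram[OF a(1) z(1)])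
  moreover have "sqn p + sqn q = 2 * sqn z + 2 * sqn z"
    unfolding p_def[abs_def] q_def[abs_def] using sqn_parallelogram[OF HspaceD(2)[OF a(1)] HspaceD(2)[OF z(1)]] sa by simp
  then have "lam * sqn p + lam * sqn q = 4 * (lam * sqn z)" by (simp add: distrib_left[symmetric])
  ultimately have "Qf V p = lam * sqn p" "Qf V q = lam * sqn q"
    using low[OF p] low[OF q] a(2) z(2) by linarith+
  then have gp: "ground_state lam p" and gq: "ground_state lam q"
    using p q lam low by (auto simp: ground_state_def)
  have "(AE x in lborel. p x = 0) \<or> (AE x in lborel. 0 < p x)"
    by (rule ground_state_zero_or_positive[OF gp]) (auto simp: p_def)
  moreover have "(AE x in lborel. q x = 0) \<or> (AE x in lborel. 0 < q x)"
    by (rule ground_state_zero_or_positive[OF gq]) (auto simp: q_def)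
  moreover have "AE x in lborel. 0 < z x" if "AE x in lborel. 0 < p x"
    using that by eventually_elim (auto simp: p_def)
  moreover have "AE x in lborel. z x < 0" if "AE x in lborel. 0 < q x"
    using that by eventually_elim (auto simp: q_def)
  moreover have False if "AE x in lborel. p x = 0" "AE x in lborel. q x = 0"
  proof -
    have "AE x in lborel. z x = 0" using that by eventually_elim (auto simp: p_def q_def)
    then have "sqn z = sqn (\<lambda>x. 0)" by (rule sqn_cong_AE[OF HspaceD(2)[OF z(1)] L2_zero])
    then show False using z1 by (simp add: sqn_def)
  qed
  ultimately show ?thesis by blast
qed

lemma ex_unit_Hspace: "\<exists>u\<in>Hspace V. sqn u = 1"
proof -
  let ?b = "\<lambda>x. bump 0 1 x ^ 3"
  have b: "?b \<in> Hspace V" by (rule test_fun_Hspace[OF test_fun_bump_cube]) simp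
  have "sqn ?b \<noteq> 0"
  proof
    assume "sqn ?b = 0"
    then have "AE x in lborel. ?b x = 0" by (intro sqn_eq_0 HspaceD b)
    then have "AE x in lborel. x \<notin> ball (0::R2) 1"
    proof eventually_elim
      case (elim x)
      then show ?case using bump_eq_0_iff[of 1 0 x] by simp
    qed
    then have "emeasure lborel (ball (0::R2) 1) = 0"
      using AE_iff_measurable[of "ball (0::R2) 1" lborel "\<lambda>x. x \<notin> ball 0 1"]
      by (simp add: ball_def dist_norm del: mem_ball)
    then have "measure lborel (ball (0::R2) 1) = 0" by (simp add: measure_def)
    then show False using content_ball_pos[of 1 "0::R2"] by simp
  qed
  then have s: "0 < sqn ?b" using sqn_nonneg[of ?b] by linarith
  have "sqn (\<lambda>x. (1 / sqrt (sqn ?b)) * ?b x) = 1"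
    unfolding sqn_scale using s by (simp add: power_divide)
  then show ?thesis using Hspace_scale[OF b, of "1 / sqrt (sqn ?b)"] by blast
qed

definition lam :: real where
  "lam = Inf (Qf V ` {u \<in> Hspace V. sqn u = 1})"

lemma lam_le_unit:
  assumes "u \<in> Hspace V" "sqn u = 1"
  shows "lam \<le> Qf V u"
  unfolding lam_def using assms by (intro cInf_lower bdd_belowI[of _ 0]) auto

lemma lam_nonneg: "0 \<le> lam"
  unfolding lam_def using ex_unit_Hspace by (intro cInf_greatest) auto

lemma lam_le:
  assumes u: "u \<in> Hspace V"
  shows "lam * sqn u \<le> Qf V u"
proof (cases "sqn u = 0")
  case False
  then have s: "0 < sqn u" using sqn_nonneg[of u] by linarith
  let ?w = "\<lambda>x. (1 / sqrt (sqn u)) * u x"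
  have "sqn ?w = 1" unfolding sqn_scale using s by (simp add: power_divide)
  then have "lam \<le> Qf V ?w" by (intro lam_le_unit Hspace_scale u)
  also have "\<dots> = Qf V u / sqn u" unfolding Qf_scale[OF u] using s by (simp add: power_divide)
  finally show ?thesis using s by (simp add: field_simps)
qed simp

lemma Bf_Cauchy_Schwarz:
  assumes "u \<in> Hspace V" "v \<in> Hspace V"
  shows "(Bf V u v)\<^sup>2 \<le> Qf V u * Qf V v"
proof (rule quadratic_nonneg_discriminant)
  fix t
  have "0 \<le> Qf V (\<lambda>x. 1 * u x + t * v x)" by (rule Qf_nonneg)
  then show "0 \<le> Qf V u + 2 * t * Bf V u v + t\<^sup>2 * Qf V v"
    unfolding Hspace_lincomb(2)[OF assms] by simp
qed simp

lemma Qf_tendsto: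
  assumes u: "\<And>n. u n \<in> Hspace V" and w: "w \<in> Hspace V"
    and lim: "(\<lambda>n. Kf V (\<lambda>x. u n x - w x)) \<longlonglongrightarrow> 0"
  shows "(\<lambda>n. Qf V (u n)) \<longlonglongrightarrow> Qf V w" "(\<lambda>n. sqn (u n)) \<longlonglongrightarrow> sqn w"
    "(\<lambda>n. sqn (\<lambda>x. u n x - w x)) \<longlonglongrightarrow> 0"
proof -
  define d where "d n x = u n x - w x" for n x
  have d: "d n \<in> Hspace V" for n unfolding d_def[abs_def] by (intro Hspace_diff u w)
  have K: "(\<lambda>n. Kf V (d n)) \<longlonglongrightarrow> 0" using lim by (simp add: d_def[abs_def])
  have "norm (sqn (d n)) \<le> Kf V (d n)" "norm (Qf V (d n)) \<le> Kf V (d n)" for n by (simp_all add: Kf_def)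
  then have s: "(\<lambda>n. sqn (d n)) \<longlonglongrightarrow> 0" and Q: "(\<lambda>n. Qf V (d n)) \<longlonglongrightarrow> 0"
    by (auto intro!: Lim_null_comparison[OF always_eventually K])
  show ss: "(\<lambda>n. sqn (\<lambda>x. u n x - w x)) \<longlonglongrightarrow> 0" using s by (simp add: d_def[abs_def])
  show "(\<lambda>n. sqn (u n)) \<longlonglongrightarrow> sqn w" by (rule sqn_tendsto[OF _ _ ss]) (intro HspaceD u w)+
  have B: "(\<lambda>n. Bf V w (d n)) \<longlonglongrightarrow> 0"
  proof (rule Lim_null_comparison)
    show "\<forall>\<^sub>F n in sequentially. norm (Bf V w (d n)) \<le> sqrt (Qf V w * Qf V (d n))"
      using Bf_Cauchy_Schwarz[OF w d] by (intro always_eventually allI) (simp add: real_le_rsqrt)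
    show "(\<lambda>n. sqrt (Qf V w * Qf V (d n))) \<longlonglongrightarrow> 0"
      using tendsto_real_sqrt[OF tendsto_mult_left[OF Q, of "Qf V w"]] by simp
  qed
  have "Qf V (u n) = Qf V w + 2 * Bf V w (d n) + Qf V (d n)" for n
    using Hspace_lincomb(2)[OF w d[of n], of 1 1] by (simp add: d_def[abs_def])
  moreover have "(\<lambda>n. Qf V w + 2 * Bf V w (d n) + Qf V (d n)) \<longlonglongrightarrow> Qf V w + 2 * 0 + 0"
    by (intro tendsto_intros B Q)
  ultimately show "(\<lambda>n. Qf V (u n)) \<longlonglongrightarrow> Qf V w" by simp
qed

lemma minimizing_sequence_compact:
  assumes u: "\<And>n. u n \<in> Hspace V" "\<And>n. sqn (u n) = 1" and Q: "(\<lambda>n. Qf V (u n)) \<longlonglongrightarrow> lam"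
  obtains w r where "strict_mono (r :: nat \<Rightarrow> nat)" "w \<in> Hspace V" "(\<lambda>k. Kf V (\<lambda>x. u (r k) x - w x)) \<longlonglongrightarrow> 0"
    "AE x in lborel. (\<lambda>k. u (r k) x) \<longlonglongrightarrow> w x" "ground_state lam w" "sqn w = 1"
proof -
  obtain C where C: "\<And>n. norm (Qf V (u n)) \<le> C" using convergent_imp_Bseq[OF convergentI[OF Q]] by (auto simp: Bseq_def)
  have kc: "Kf V (u n) \<le> 1 + C" for n using C[of n] u(2)[of n] by (simp add: Kf_def)
  obtain r1 where r1: "strict_mono (r1 :: nat \<Rightarrow> nat)"
    "\<And>e. 0 < e \<Longrightarrow> \<exists>N. \<forall>m\<ge>N. \<forall>n\<ge>N. sqn (\<lambda>x. u (r1 m) x - u (r1 n) x) < e"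
    by (rule Hspace_compact[of u "1 + C", OF u(1) kc]) blast
  define v where "v k = u (r1 k)" for k
  have v: "v k \<in> Hspace V" "sqn (v k) = 1" for k using u by (auto simp: v_def)
  have Qv: "(\<lambda>k. Qf V (v k)) \<longlonglongrightarrow> lam" using LIMSEQ_subseq_LIMSEQ[OF Q r1(1)] by (simp add: v_def o_def)
  have est: "Kf V (\<lambda>x. v m x - v n x) \<le> 2 * (Qf V (v m) - lam) + 2 * (Qf V (v n) - lam) + (lam + 1) * sqn (\<lambda>x. v m x - v n x)" for m n
  proof -
    have "Qf V (\<lambda>x. v m x - v n x) = 2 * Qf V (v m) + 2 * Qf V (v n) - Qf V (\<lambda>x. v m x + v n x)"
      using Qf_parallelogram[OF v(1)[of m] v(1)[of n]] by simp
    moreover have "lam * sqn (\<lambda>x. v m x + v n x) \<le> Qf V (\<lambda>x. v m x + v n x)" by (intro lam_le Hspace_add v)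
    moreover have s: "sqn (\<lambda>x. v m x + v n x) = 4 - sqn (\<lambda>x. v m x - v n x)"
      using sqn_parallelogram[OF HspaceD(2)[OF v(1)[of m]] HspaceD(2)[OF v(1)[of n]]] v(2) by simp
    ultimately show ?thesis unfolding Kf_def s by (simp add: algebra_simps)
  qed
  have cau: "\<exists>N. \<forall>m\<ge>N. \<forall>n\<ge>N. Kf V (\<lambda>x. v m x - v n x) < e" if e: "e > 0" for e
  proof -
    have l1: "0 < lam + 1" using lam_nonneg by simp
    obtain N1 where N1: "\<And>n. n \<ge> N1 \<Longrightarrow> Qf V (v n) < lam + e / 8"
      using order_tendstoD(2)[OF Qv, of "lam + e/8"] e by (auto simp: eventually_sequentially)
    obtain N2 where N2: "\<And>m n. m \<ge> N2 \<Longrightarrow> n \<ge> N2 \<Longrightarrow> sqn (\<lambda>x. v m x - v n x) < e / (2 * (lam + 1))"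
      using r1(2)[of "e / (2 * (lam + 1))"] e l1 unfolding v_def by auto
    show ?thesis
    proof (intro exI[of _ "max N1 N2"] allI impI)
      fix m n assume mn: "max N1 N2 \<le> m" "max N1 N2 \<le> n"
      have "(lam + 1) * sqn (\<lambda>x. v m x - v n x) \<le> (lam + 1) * (e / (2 * (lam + 1)))"
        using N2[of m n] mn l1 by (intro mult_left_mono) auto
      also have "\<dots> = e / 2" using l1 by (simp add: field_simps)
      finally show "Kf V (\<lambda>x. v m x - v n x) < e" using est[of m n] N1[of m] N1[of n] mn by simp
    qed
  qed
  obtain w r2 where w: "w \<in> Hspace V" "strict_mono (r2 :: nat \<Rightarrow> nat)"
    "(\<lambda>k. Kf V (\<lambda>x. v (r2 k) x - w x)) \<longlonglongrightarrow> 0" "AE x in lborel. (\<lambda>k. v (r2 k) x) \<longlonglongrightarrow> w x"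
    by (rule Hspace_complete[OF v(1) cau]) blast
  have sm: "strict_mono (\<lambda>k. r1 (r2 k))" using r1(1) w(2) by (simp add: strict_mono_def)
  note lim = Qf_tendsto[OF v(1) w(1) w(3)]
  have s1: "sqn w = 1" using lim(2) v(2) by (simp add: LIMSEQ_const_iff)
  have "Qf V w = lam" using LIMSEQ_unique[OF lim(1) LIMSEQ_subseq_LIMSEQ[OF Qv w(2), unfolded o_def]] .
  then have "ground_state lam w" unfolding ground_state_def using lam_nonneg lam_le w(1) s1 by simp
  then show ?thesis using that[OF sm w(1)] w(3,4) s1 by (simp add: v_def)
qed

text \<open>Normalized differences of almost minimizers form a minimizing sequence; they are orthogonal
  to the sum of the two minimizers, so their limit would be a ground state orthogonal to a positive
  function.\<close>

lemma spectral_gap: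
  obtains eps kap where "0 < eps" "0 < kap"
    "\<And>u v. u \<in> Hspace V \<Longrightarrow> v \<in> Hspace V \<Longrightarrow> sqn u = 1 \<Longrightarrow> sqn v = 1 \<Longrightarrow>
      AE x in lborel. 0 \<le> u x \<Longrightarrow> AE x in lborel. 0 \<le> v x \<Longrightarrow> Qf V u \<le> lam + eps \<Longrightarrow> Qf V v \<le> lam + eps \<Longrightarrow>
      kap * Kf V (\<lambda>x. u x - v x) \<le> Qf V (\<lambda>x. u x - v x) - (lam + eps) * sqn (\<lambda>x. u x - v x)"
proof (rule ccontr)
  assume neg: "\<not> thesis"
  define c where "c n = 1 / real (Suc (Suc n))" for n
  have c: "0 < c n" "c n \<le> 1/2" for n by (auto simp: c_def field_simps)
  have c0: "c \<longlonglongrightarrow> 0" unfolding c_def by (intro LIMSEQ_Suc lim_1_over_n)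
  define good where "good n p \<longleftrightarrow> fst p \<in> Hspace V \<and> snd p \<in> Hspace V \<and> sqn (fst p) = 1 \<and> sqn (snd p) = 1 \<and>
     (AE x in lborel. 0 \<le> fst p x) \<and> (AE x in lborel. 0 \<le> snd p x) \<and> Qf V (fst p) \<le> lam + c n \<and> Qf V (snd p) \<le> lam + c n \<and>
     Qf V (\<lambda>x. fst p x - snd p x) - (lam + c n) * sqn (\<lambda>x. fst p x - snd p x) < c n * Kf V (\<lambda>x. fst p x - snd p x)"
    for n and p :: "(R2 \<Rightarrow> real) \<times> (R2 \<Rightarrow> real)"
  have "\<exists>p. good n p" for n
  proof (rule ccontr)
    assume no: "\<nexists>p. good n p"
    have thesis
    proof (rule that[OF c(1) c(1)])
      fix u v assume "u \<in> Hspace V" "v \<in> Hspace V" "sqn u = 1" "sqn v = 1"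
        "AE x in lborel. 0 \<le> u x" "AE x in lborel. 0 \<le> v x" "Qf V u \<le> lam + c n" "Qf V v \<le> lam + c n"
      then show "c n * Kf V (\<lambda>x. u x - v x) \<le> Qf V (\<lambda>x. u x - v x) - (lam + c n) * sqn (\<lambda>x. u x - v x)"
        using no[unfolded not_ex, rule_format, of "(u, v)"] unfolding good_def by (simp add: not_less)
    qed
    with neg show False ..
  qed
  then have "\<exists>p. \<forall>n. good n (p n)" by (intro choice allI)
  then obtain p where p: "\<And>n. good n (p n)" by blast
  define u where "u n = fst (p n)" for n
  define v where "v n = snd (p n)" for n
  have uv: "u n \<in> Hspace V" "v n \<in> Hspace V" "sqn (u n) = 1" "sqn (v n) = 1" "AE x in lborel. 0 \<le> u n x" "AE x in lborel. 0 \<le> v n x"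
    "Qf V (u n) \<le> lam + c n" "Qf V (v n) \<le> lam + c n"
    and bad: "Qf V (\<lambda>x. u n x - v n x) - (lam + c n) * sqn (\<lambda>x. u n x - v n x) < c n * Kf V (\<lambda>x. u n x - v n x)" for n
    using p[of n] by (auto simp: good_def u_def v_def)
  define w where "w n x = u n x - v n x" for n x
  have w: "w n \<in> Hspace V" for n unfolding w_def[abs_def] by (intro Hspace_diff uv)
  have wq: "(1 - c n) * Qf V (w n) < (lam + 2 * c n) * sqn (w n)" for n
  proof -
    have "w n = (\<lambda>x. u n x - v n x)" by (auto simp: w_def)
    then show ?thesis using bad[of n] unfolding Kf_def by (simp add: algebra_simps)
  qed
  have ws: "0 < sqn (w n)" for n
  proof (rule ccontr)
    assume "\<not> 0 < sqn (w n)"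
    then have "sqn (w n) = 0" using sqn_nonneg[of "w n"] by linarith
    then have "(1 - c n) * Qf V (w n) < 0" using wq[of n] by simp
    moreover have "0 \<le> (1 - c n) * Qf V (w n)" using c(2)[of n] by (intro mult_nonneg_nonneg) auto
    ultimately show False by simp
  qed
  define z where "z n x = (1 / sqrt (sqn (w n))) * w n x" for n x
  have z: "z n \<in> Hspace V" for n unfolding z_def[abs_def] by (intro Hspace_scale w)
  have zs: "sqn (z n) = 1" for n unfolding z_def[abs_def] sqn_scale using ws[of n] by (simp add: power_divide)
  have zQ: "Qf V (z n) = Qf V (w n) / sqn (w n)" for n
    unfolding z_def[abs_def] Qf_scale[OF w] using ws[of n] by (simp add: power_divide)
  have zlim: "(\<lambda>n. Qf V (z n)) \<longlonglongrightarrow> lam"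
  proof (rule real_tendsto_sandwich)
    show "\<forall>\<^sub>F n in sequentially. lam \<le> Qf V (z n)" by (intro always_eventually allI lam_le_unit z zs)
    show "\<forall>\<^sub>F n in sequentially. Qf V (z n) \<le> (lam + 2 * c n) / (1 - c n)"
    proof (intro always_eventually allI)
      fix n
      have "0 < 1 - c n" using c(2)[of n] by simp
      then show "Qf V (z n) \<le> (lam + 2 * c n) / (1 - c n)"
        unfolding zQ using wq[of n] ws[of n] by (simp add: field_simps)
    qed
    have "(\<lambda>n. (lam + 2 * c n) / (1 - c n)) \<longlonglongrightarrow> (lam + 2 * 0) / (1 - 0)" by (intro tendsto_intros c0) simp
    then show "(\<lambda>n. (lam + 2 * c n) / (1 - c n)) \<longlonglongrightarrow> lam" by simp
  qed simp
  have ulim: "(\<lambda>n. Qf V (a n)) \<longlonglongrightarrow> lam" if "\<And>n. a n \<in> Hspace V" "\<And>n. sqn (a n) = 1" "\<And>n. Qf V (a n) \<le> lam + c n" for a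
  proof (rule real_tendsto_sandwich)
    show "\<forall>\<^sub>F n in sequentially. lam \<le> Qf V (a n)" by (intro always_eventually allI lam_le_unit that)
    show "\<forall>\<^sub>F n in sequentially. Qf V (a n) \<le> lam + c n" by (intro always_eventually allI that)
    show "(\<lambda>n. lam + c n) \<longlonglongrightarrow> lam" using tendsto_add[OF tendsto_const c0] by simp
  qed simp
  obtain z' r1 where r1: "strict_mono (r1 :: nat \<Rightarrow> nat)" "z' \<in> Hspace V" "(\<lambda>k. Kf V (\<lambda>x. z (r1 k) x - z' x)) \<longlonglongrightarrow> 0"
    "ground_state lam z'" "sqn z' = 1"
    by (rule minimizing_sequence_compact[OF z zs zlim]) blast
  obtain u' r2 where r2: "strict_mono (r2 :: nat \<Rightarrow> nat)" "u' \<in> Hspace V" "(\<lambda>k. Kf V (\<lambda>x. u (r1 (r2 k)) x - u' x)) \<longlonglongrightarrow> 0"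
    "AE x in lborel. (\<lambda>k. u (r1 (r2 k)) x) \<longlonglongrightarrow> u' x" "ground_state lam u'" "sqn u' = 1"
    by (rule minimizing_sequence_compact[of "\<lambda>n. u (r1 n)"])
      (use uv LIMSEQ_subseq_LIMSEQ[OF ulim[OF uv(1,3,7)] r1(1)] in \<open>auto simp: o_def\<close>)
  have r12: "strict_mono (\<lambda>k. r1 (r2 k))" using r1(1) r2(1) by (simp add: strict_mono_def)
  obtain v' r3 where r3: "strict_mono (r3 :: nat \<Rightarrow> nat)" "v' \<in> Hspace V" "(\<lambda>k. Kf V (\<lambda>x. v (r1 (r2 (r3 k))) x - v' x)) \<longlonglongrightarrow> 0"
    "AE x in lborel. (\<lambda>k. v (r1 (r2 (r3 k))) x) \<longlonglongrightarrow> v' x" "ground_state lam v'" "sqn v' = 1"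
    by (rule minimizing_sequence_compact[of "\<lambda>n. v (r1 (r2 n))"])
      (use uv LIMSEQ_subseq_LIMSEQ[OF ulim[OF uv(2,4,8)] r12] in \<open>auto simp: o_def\<close>)
  define R where "R k = r1 (r2 (r3 k))" for k
  have lz: "(\<lambda>k. sqn (\<lambda>x. z (R k) x - z' x)) \<longlonglongrightarrow> 0"
    using LIMSEQ_subseq_LIMSEQ[OF LIMSEQ_subseq_LIMSEQ[OF Qf_tendsto(3)[OF z r1(2,3)] r2(1)] r3(1)] by (simp add: o_def R_def)
  have lu: "(\<lambda>k. sqn (\<lambda>x. u (R k) x - u' x)) \<longlonglongrightarrow> 0"
    using LIMSEQ_subseq_LIMSEQ[OF Qf_tendsto(3)[OF uv(1) r2(2,3)] r3(1)] by (simp add: o_def R_def)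
  have lv: "(\<lambda>k. sqn (\<lambda>x. v (R k) x - v' x)) \<longlonglongrightarrow> 0"
    using Qf_tendsto(3)[OF uv(2) r3(2,3)] by (simp add: R_def)
  have zero: "ip (z n) (u n) + ip (z n) (v n) = 0" for n
  proof -
    note uL = HspaceD(2)[OF uv(1)[of n]] and vL = HspaceD(2)[OF uv(2)[of n]]
    have "ip (\<lambda>x. 1 * u n x + 1 * v n x) (\<lambda>x. 1 * u n x + (- 1) * v n x) = sqn (u n) - sqn (v n)"
      using ip_lincomb_right[OF uL vL L2_lincomb[OF uL vL], of 1 1 1 "-1"] ip_lincomb_right[OF uL vL uL, of 1 1] ip_lincomb_right[OF uL vL vL, of 1 1]
      by (simp add: ip_commute ip_self)
    then have w0: "ip (\<lambda>x. u n x + v n x) (w n) = 0" using uv(3,4) by (simp add: w_def[abs_def])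
    have "ip (z n) (u n) + ip (z n) (v n) = ip (\<lambda>x. u n x + v n x) (z n)"
      using ip_lincomb_right[OF uL vL HspaceD(2)[OF z[of n]], of 1 1] by (simp add: ip_commute)
    also have "\<dots> = (1 / sqrt (sqn (w n))) * ip (\<lambda>x. u n x + v n x) (w n)"
      unfolding z_def[abs_def] ip_def by (subst integral_mult_right_zero[symmetric]) (simp add: mult_ac)
    finally show ?thesis by (simp add: w0)
  qed
  note zL = HspaceD(2)[OF z] and z'L = HspaceD(2)[OF r1(2)]
  have "(\<lambda>k. ip (z (R k)) (u (R k)) + ip (z (R k)) (v (R k))) \<longlonglongrightarrow> ip z' u' + ip z' v'"
    by (intro tendsto_add ip_tendsto_both lz lu lv zL z'L HspaceD(2)[OF uv(1)] HspaceD(2)[OF uv(2)] HspaceD(2)[OF r2(2)] HspaceD(2)[OF r3(2)])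
  then have zero': "ip z' u' + ip z' v' = 0" by (simp add: zero LIMSEQ_const_iff)
  have "AE x in lborel. 0 \<le> u' x"
  proof -
    have "AE x in lborel. \<forall>k. 0 \<le> u (r1 (r2 k)) x" unfolding AE_all_countable using uv(5) by blast
    then show ?thesis using r2(4) by eventually_elim (auto intro: LIMSEQ_le_const)
  qed
  then have u'pos: "AE x in lborel. 0 < u' x"
  proof -
    have "\<not> (AE x in lborel. u' x = 0)"
    proof
      assume "AE x in lborel. u' x = 0"
      then have "sqn u' = sqn (\<lambda>x. 0)" by (rule sqn_cong_AE[OF HspaceD(2)[OF r2(2)] L2_zero])
      then show False using r2(6) by (simp add: sqn_def)
    qed
    then show ?thesis using ground_state_zero_or_positive[OF r2(5) \<open>AE x in lborel. 0 \<le> u' x\<close>] by blast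
  qed
  have v'nn: "AE x in lborel. 0 \<le> v' x"
  proof -
    have "AE x in lborel. \<forall>k. 0 \<le> v (r1 (r2 (r3 k))) x" unfolding AE_all_countable using uv(6) by blast
    then show ?thesis using r3(4) by eventually_elim (auto intro: LIMSEQ_le_const)
  qed
  have contra: False if s: "s = 1 \<or> s = - 1" and sz: "AE x in lborel. 0 < s * z' x" for s :: real
  proof -
    have i: "integrable lborel (\<lambda>x. s * (z' x * u' x + z' x * v' x))"
      using L2_mult_integrable[OF z'L HspaceD(2)[OF r2(2)]] L2_mult_integrable[OF z'L HspaceD(2)[OF r3(2)]] by simp
    have eq: "s * (z' x * u' x + z' x * v' x) = (s * z' x) * (u' x + v' x)" for x by (simp add: algebra_simps)
    have pos: "AE x in lborel. 0 < s * (z' x * u' x + z' x * v' x)"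
      unfolding eq using sz u'pos v'nn by eventually_elim (rule mult_pos_pos, assumption, rule add_pos_nonneg)
    then have nn: "AE x in lborel. 0 \<le> s * (z' x * u' x + z' x * v' x)" by eventually_elim simp
    have "(\<integral>x. s * (z' x * u' x + z' x * v' x) \<partial>lborel) = s * (ip z' u' + ip z' v')"
      unfolding ip_def using L2_mult_integrable[OF z'L HspaceD(2)[OF r2(2)]] L2_mult_integrable[OF z'L HspaceD(2)[OF r3(2)]] by simp
    then have "AE x in lborel. s * (z' x * u' x + z' x * v' x) = 0"
      using integral_nonneg_eq_0_iff_AE[OF i nn] zero' by simp
    then have "AE x in lborel. u' x = 0" using pos by eventually_elim linarith
    then have "sqn u' = sqn (\<lambda>x. 0)" by (rule sqn_cong_AE[OF HspaceD(2)[OF r2(2)] L2_zero])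
    then show False using r2(6) by (simp add: sqn_def)
  qed
  from ground_state_constant_sign[OF r1(4,5)] show False
    using contra[of 1] contra[of "- 1"] by auto
qed

end

section \<open>The coupled problem\<close>

lemma prodint_eq_ip: "prodint u v = ip (\<lambda>x. (u x)\<^sup>2) (\<lambda>x. (v x)\<^sup>2)"
  by (simp add: prodint_def ip_def)

lemma prodint_nonneg [simp]: "0 \<le> prodint u v"
  by (simp add: prodint_def)

lemma prodint_scale: "prodint (\<lambda>x. s * u x) (\<lambda>x. t * v x) = s\<^sup>2 * t\<^sup>2 * prodint u v"
proof -
  have "prodint (\<lambda>x. s * u x) (\<lambda>x. t * v x) = (\<integral>x. (s\<^sup>2 * t\<^sup>2) * ((u x)\<^sup>2 * (v x)\<^sup>2) \<partial>lborel)"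
    unfolding prodint_def by (simp add: power_mult_distrib mult_ac)
  then show ?thesis unfolding prodint_def by simp
qed

lemma prodint_le_scale:
  assumes "1 \<le> s" "1 \<le> t"
  shows "prodint u v \<le> prodint (\<lambda>x. s * u x) (\<lambda>x. t * v x)"
proof -
  have "1 * 1 \<le> s\<^sup>2 * t\<^sup>2" using assms by (intro mult_mono) auto
  then have "1 * prodint u v \<le> s\<^sup>2 * t\<^sup>2 * prodint u v" by (intro mult_right_mono) auto
  then show ?thesis by (simp add: prodint_scale)
qed

lemma (in trapping_potential) square_tendsto:
  assumes u: "\<And>n. u n \<in> Hspace V" and w: "w \<in> Hspace V"
    and lim: "(\<lambda>n. Kf V (\<lambda>x. u n x - w x)) \<longlonglongrightarrow> 0"
  shows "(\<lambda>n. sqn (\<lambda>x. (u n x)\<^sup>2 - (w x)\<^sup>2)) \<longlonglongrightarrow> 0"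
proof (rule Lim_null_comparison)
  let ?k = "\<lambda>n. Kf V (\<lambda>x. u n x - w x)"
  show "\<forall>\<^sub>F n in sequentially. norm (sqn (\<lambda>x. (u n x)\<^sup>2 - (w x)\<^sup>2)) \<le> 4 * ?k n * (2 * ?k n + 8 * Kf V w)"
  proof (intro always_eventually allI)
    fix n
    have d: "(\<lambda>x. u n x - w x) \<in> Hspace V" by (intro Hspace_diff u w)
    have w2: "(\<lambda>x. 2 * w x) \<in> Hspace V" by (intro Hspace_scale w)
    have s: "(\<lambda>x. (u n x - w x) + 2 * w x) \<in> Hspace V" by (intro Hspace_add d w2)
    have "sqn (\<lambda>x. (u n x)\<^sup>2 - (w x)\<^sup>2) = prodint (\<lambda>x. u n x - w x) (\<lambda>x. (u n x - w x) + 2 * w x)"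
      unfolding sqn_def prodint_def by (intro Bochner_Integration.integral_cong) (auto simp: power2_eq_square algebra_simps)
    also have "\<dots> \<le> 4 * ?k n * Kf V (\<lambda>x. (u n x - w x) + 2 * w x)"
      by (rule prodint_le(3)[OF trapping_potential_axioms trapping_potential_axioms d s])
    also have "Kf V (\<lambda>x. (u n x - w x) + 2 * w x) \<le> 2 * ?k n + 8 * Kf V w"
    proof -
      have "Kf V (\<lambda>x. 2 * w x) = 4 * Kf V w" using Kf_scale[OF w, of 2] by simp
      then show ?thesis
        using Kf_parallelogram[OF d w2] Kf_nonneg[of V "\<lambda>x. (u n x - w x) - 2 * w x"] by linarith
    qed
    finally show "norm (sqn (\<lambda>x. (u n x)\<^sup>2 - (w x)\<^sup>2)) \<le> 4 * ?k n * (2 * ?k n + 8 * Kf V w)"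
      by (simp add: mult_left_mono)
  qed
  have "(\<lambda>n. 4 * ?k n * (2 * ?k n + 8 * Kf V w)) \<longlonglongrightarrow> 4 * 0 * (2 * 0 + 8 * Kf V w)"
    by (intro tendsto_intros lim)
  then show "(\<lambda>n. 4 * ?k n * (2 * ?k n + 8 * Kf V w)) \<longlonglongrightarrow> 0" by simp
qed

lemma (in trapping_potential) square_L2: "u \<in> Hspace V \<Longrightarrow> (\<lambda>x. (u x)\<^sup>2) \<in> L2"
  by (rule prodint_le(1)[OF trapping_potential_axioms trapping_potential_axioms])

lemma (in trapping_potential) midpoint_component:
  assumes u: "u \<in> Hspace V" and v: "v \<in> Hspace V" and n: "sqn u = 1" "sqn v = 1"
    and pos: "AE x in lborel. 0 \<le> u x" "AE x in lborel. 0 \<le> v x"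
    and a_def: "a = (\<lambda>x. (1/2) * u x + (1/2) * v x)" and d_def: "d = (\<lambda>x. (1/2) * u x + (-1/2) * v x)"
  shows "a \<in> Hspace V" "d \<in> Hspace V" "sqn d \<le> 1/2" "Kf V a + Kf V d = (Kf V u + Kf V v) / 2"
    "\<exists>s\<ge>1. sqn (\<lambda>x. s * a x) = 1 \<and>
       Qf V (\<lambda>x. s * a x) = (Qf V u + Qf V v) / 2 + ((Qf V u + Qf V v) / 2 * sqn d - Qf V d) / (1 - sqn d)"
proof -
  note uL = HspaceD(2)[OF u] and vL = HspaceD(2)[OF v]
  show a: "a \<in> Hspace V" and d: "d \<in> Hspace V" unfolding a_def d_def by (intro Hspace_lincomb u v)+
  have sa: "sqn a = 1/4 + ip u v / 2 + 1/4" and sd: "sqn d = 1/4 - ip u v / 2 + 1/4"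
    unfolding a_def d_def sqn_lincomb[OF uL vL] n by (simp_all add: power2_eq_square)
  have Qa: "Qf V a = Qf V u / 4 + Bf V u v / 2 + Qf V v / 4" and Qd: "Qf V d = Qf V u / 4 - Bf V u v / 2 + Qf V v / 4"
    unfolding a_def d_def Hspace_lincomb(2)[OF u v] by (simp_all add: power2_eq_square)
  have ipnn: "0 \<le> ip u v" unfolding ip_def
    by (rule integral_nonneg_AE) (use pos in \<open>eventually_elim, simp\<close>)
  show sd2: "sqn d \<le> 1/2" using sd ipnn by simp
  show "Kf V a + Kf V d = (Kf V u + Kf V v) / 2" unfolding Kf_def using sa sd Qa Qd n by simp
  have sa': "sqn a = 1 - sqn d" using sa sd by simp
  have Qa': "Qf V a = (Qf V u + Qf V v) / 2 - Qf V d" using Qa Qd by simp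
  have sap: "0 < sqn a" "sqn a \<le> 1" using sa' sd2 sqn_nonneg[of d] by linarith+
  define s where "s = 1 / sqrt (sqn a)"
  have s2: "s\<^sup>2 = 1 / sqn a" using sap by (simp add: s_def power_divide)
  have "1 \<le> s" using sap by (simp add: s_def)
  moreover have "sqn (\<lambda>x. s * a x) = 1" unfolding sqn_scale s2 using sap by simp
  moreover have "Qf V (\<lambda>x. s * a x) = (Qf V u + Qf V v) / 2 + ((Qf V u + Qf V v) / 2 * sqn d - Qf V d) / (1 - sqn d)"
  proof -
    have "1 - sqn d \<noteq> 0" using sa' sap by simp
    then show ?thesis unfolding Qf_scale[OF a] s2 Qa' sa' by (simp add: field_simps)
  qed
  ultimately show "\<exists>s\<ge>1. sqn (\<lambda>x. s * a x) = 1 \<and>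
       Qf V (\<lambda>x. s * a x) = (Qf V u + Qf V v) / 2 + ((Qf V u + Qf V v) / 2 * sqn d - Qf V d) / (1 - sqn d)" by blast
qed

lemma (in trapping_potential) energy1_eq:
  assumes u: "u \<in> Hspace V"
  shows "energy1 V b u = Qf V u - b / 2 * prodint u u"
proof -
  note uD = HspaceD[OF u]
  have i1: "integrable lborel (\<lambda>x. (wgrad u x $ j)\<^sup>2)" for j by (rule L2D(2)[OF H1D(3)[OF uD(1)]])
  have i2: "integrable lborel (\<lambda>x. (sqrt (V x) * u x)\<^sup>2)" by (rule L2D(2)[OF uD(3)])
  have i3: "integrable lborel (\<lambda>x. (u x)\<^sup>2 * (u x)\<^sup>2)"
    by (rule prodint_le(2)[OF trapping_potential_axioms trapping_potential_axioms u u])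
  have "energy1 V b u = (\<integral>x. (wgrad u x $ 1)\<^sup>2 + (wgrad u x $ 2)\<^sup>2 + (sqrt (V x) * u x)\<^sup>2 - b / 2 * ((u x)\<^sup>2 * (u x)\<^sup>2) \<partial>lborel)"
    unfolding energy1_def norm_sq_R2
    by (intro Bochner_Integration.integral_cong) (simp_all add: power_mult_distrib flip: power_add)
  also have "\<dots> = Qf V u - b / 2 * prodint u u"
    unfolding Qf_def sqn_def prodint_def using i1[of 1] i1[of 2] i2 i3 by simp
  finally show ?thesis .
qed

lemma (in trapping_potential) near_lam:
  assumes "0 < \<eta>"
  shows "\<exists>u\<in>Hspace V. sqn u = 1 \<and> Qf V u < lam + \<eta>"
proof -
  have "Inf (Qf V ` {u \<in> Hspace V. sqn u = 1}) < lam + \<eta>" using assms by (simp add: lam_def)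
  from cInf_lessD[OF _ this] show ?thesis using ex_unit_Hspace by auto
qed

locale two_potentials = P1: trapping_potential V1 + P2: trapping_potential V2 for V1 V2
begin

lemmas T1 = P1.trapping_potential_axioms and T2 = P2.trapping_potential_axioms

lemma Mset_iff: "(u1, u2) \<in> Mset V1 V2 \<longleftrightarrow> u1 \<in> Hspace V1 \<and> u2 \<in> Hspace V2 \<and> sqn u1 = 1 \<and> sqn u2 = 1"
  by (simp add: Mset_def sqn_def)

lemma energy_eq:
  assumes "u1 \<in> Hspace V1" "u2 \<in> Hspace V2"
  shows "energy V1 V2 b1 b2 \<beta> u1 u2 = Qf V1 u1 + Qf V2 u2
    - (b1 / 2 * prodint u1 u1 + b2 / 2 * prodint u2 u2 + \<beta> * prodint u1 u2)"
  unfolding energy_def P1.energy1_eq[OF assms(1)] P2.energy1_eq[OF assms(2)] by (simp add: prodint_def)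

lemma energy_coercive:
  assumes M: "(u1, u2) \<in> Mset V1 V2" and b: "0 < b1" "0 < b2" "0 < \<beta>" "b1 \<le> \<delta>" "b2 \<le> \<delta>" "\<beta> \<le> \<delta>"
  shows "(1 - 16 * \<delta>) * (Qf V1 u1 + Qf V2 u2) \<le> energy V1 V2 b1 b2 \<beta> u1 u2"
    "energy V1 V2 b1 b2 \<beta> u1 u2 \<le> Qf V1 u1 + Qf V2 u2"
proof -
  have u: "u1 \<in> Hspace V1" "u2 \<in> Hspace V2" "sqn u1 = 1" "sqn u2 = 1" using M by (auto simp: Mset_iff)
  have p1: "prodint u1 u1 \<le> 16 * Qf V1 u1" and p2: "prodint u2 u2 \<le> 16 * Qf V2 u2"
    using P1.Hspace_fourth_power(2)[OF u(1)] P2.Hspace_fourth_power(2)[OF u(2)] u(3,4)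
    by (simp_all add: prodint_def power2_eq_square power4_eq_xxxx mult.assoc)
  have "prodint u1 u2 \<le> (\<integral>x. (1/2) * ((u1 x)\<^sup>2 * (u1 x)\<^sup>2) + (1/2) * ((u2 x)\<^sup>2 * (u2 x)\<^sup>2) \<partial>lborel)"
    unfolding prodint_def
  proof (rule integral_mono)
    show "integrable lborel (\<lambda>x. (u1 x)\<^sup>2 * (u2 x)\<^sup>2)" by (rule prodint_le(2)[OF T1 T2 u(1,2)])
    show "integrable lborel (\<lambda>x. (1/2) * ((u1 x)\<^sup>2 * (u1 x)\<^sup>2) + (1/2) * ((u2 x)\<^sup>2 * (u2 x)\<^sup>2))"
      using prodint_le(2)[OF T1 T1 u(1,1)] prodint_le(2)[OF T2 T2 u(2,2)] by simp
    have "p * q \<le> (1/2) * (p * p) + (1/2) * (q * q)" for p q :: real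
      using zero_le_power2[of "p - q"] by (simp add: power2_eq_square algebra_simps)
    then show "(u1 x)\<^sup>2 * (u2 x)\<^sup>2 \<le> (1/2) * ((u1 x)\<^sup>2 * (u1 x)\<^sup>2) + (1/2) * ((u2 x)\<^sup>2 * (u2 x)\<^sup>2)" for x .
  qed
  also have "\<dots> = (1/2) * prodint u1 u1 + (1/2) * prodint u2 u2"
    unfolding prodint_def using prodint_le(2)[OF T1 T1 u(1,1)] prodint_le(2)[OF T2 T2 u(2,2)] by simp
  finally have p12: "prodint u1 u2 \<le> 8 * (Qf V1 u1 + Qf V2 u2)" using p1 p2 by simp
  have "b1 / 2 * prodint u1 u1 \<le> \<delta> / 2 * (16 * Qf V1 u1)"
    by (rule mult_mono[OF _ p1]) (use b in simp_all)
  moreover have "b2 / 2 * prodint u2 u2 \<le> \<delta> / 2 * (16 * Qf V2 u2)"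
    by (rule mult_mono[OF _ p2]) (use b in simp_all)
  moreover have "\<beta> * prodint u1 u2 \<le> \<delta> * (8 * (Qf V1 u1 + Qf V2 u2))"
    by (rule mult_mono[OF _ p12]) (use b in simp_all)
  ultimately show "(1 - 16 * \<delta>) * (Qf V1 u1 + Qf V2 u2) \<le> energy V1 V2 b1 b2 \<beta> u1 u2"
    unfolding energy_eq[OF u(1,2)] by (simp add: algebra_simps)
  have "0 \<le> b1 / 2 * prodint u1 u1" "0 \<le> b2 / 2 * prodint u2 u2" "0 \<le> \<beta> * prodint u1 u2" using b by auto
  then show "energy V1 V2 b1 b2 \<beta> u1 u2 \<le> Qf V1 u1 + Qf V2 u2" unfolding energy_eq[OF u(1,2)] by linarith
qed

lemma energy_midpoint:
  assumes u: "u1 \<in> Hspace V1" "u2 \<in> Hspace V2" "sqn u1 = 1" "sqn u2 = 1" "AE x in lborel. 0 \<le> u1 x" "AE x in lborel. 0 \<le> u2 x"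
    and v: "v1 \<in> Hspace V1" "v2 \<in> Hspace V2" "sqn v1 = 1" "sqn v2 = 1" "AE x in lborel. 0 \<le> v1 x" "AE x in lborel. 0 \<le> v2 x"
    and L: "Kf V1 u1 \<le> L" "Kf V2 u2 \<le> L" "Kf V1 v1 \<le> L" "Kf V2 v2 \<le> L"
    and b: "0 < b1" "0 < b2" "0 < \<beta>" "b1 \<le> \<delta>" "b2 \<le> \<delta>" "\<beta> \<le> \<delta>"
    and d1_def: "d1 = (\<lambda>x. (1/2) * u1 x + (-1/2) * v1 x)" and d2_def: "d2 = (\<lambda>x. (1/2) * u2 x + (-1/2) * v2 x)"
  shows "\<exists>m1 m2. (m1, m2) \<in> Mset V1 V2 \<and> energy V1 V2 b1 b2 \<beta> m1 m2
    \<le> (energy V1 V2 b1 b2 \<beta> u1 u2 + energy V1 V2 b1 b2 \<beta> v1 v2) / 2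
      + ((Qf V1 u1 + Qf V1 v1) / 2 * sqn d1 - Qf V1 d1) / (1 - sqn d1)
      + ((Qf V2 u2 + Qf V2 v2) / 2 * sqn d2 - Qf V2 d2) / (1 - sqn d2)
      + 30 * \<delta> * L * (Kf V1 d1 + Kf V2 d2)"
proof -
  define a1 where "a1 = (\<lambda>x. (1/2) * u1 x + (1/2) * v1 x)"
  define a2 where "a2 = (\<lambda>x. (1/2) * u2 x + (1/2) * v2 x)"
  note c1 = P1.midpoint_component[OF u(1) v(1) u(3) v(3) u(5) v(5) a1_def d1_def]
  note c2 = P2.midpoint_component[OF u(2) v(2) u(4) v(4) u(6) v(6) a2_def d2_def]
  obtain s1 where s1: "1 \<le> s1" "sqn (\<lambda>x. s1 * a1 x) = 1"
    "Qf V1 (\<lambda>x. s1 * a1 x) = (Qf V1 u1 + Qf V1 v1) / 2 + ((Qf V1 u1 + Qf V1 v1) / 2 * sqn d1 - Qf V1 d1) / (1 - sqn d1)"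
    using c1(5) by blast
  obtain s2 where s2: "1 \<le> s2" "sqn (\<lambda>x. s2 * a2 x) = 1"
    "Qf V2 (\<lambda>x. s2 * a2 x) = (Qf V2 u2 + Qf V2 v2) / 2 + ((Qf V2 u2 + Qf V2 v2) / 2 * sqn d2 - Qf V2 d2) / (1 - sqn d2)"
    using c2(5) by blast
  have m1: "(\<lambda>x. s1 * a1 x) \<in> Hspace V1" and m2: "(\<lambda>x. s2 * a2 x) \<in> Hspace V2"
    by (intro P1.Hspace_scale P2.Hspace_scale c1 c2)+
  have K: "Kf V1 a1 \<le> L" "Kf V1 d1 \<le> L" "Kf V2 a2 \<le> L" "Kf V2 d2 \<le> L"
    using c1(4) c2(4) L Kf_nonneg[of V1 a1] Kf_nonneg[of V1 d1] Kf_nonneg[of V2 a2] Kf_nonneg[of V2 d2]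
    unfolding add_divide_distrib by - linarith+
  have L0: "0 \<le> L" using K(1) Kf_nonneg[of V1 a1] by linarith
  have ud: "u1 x = a1 x + d1 x" "v1 x = a1 x - d1 x" "u2 x = a2 x + d2 x" "v2 x = a2 x - d2 x" for x
    by (simp_all add: a1_def a2_def d1_def d2_def field_simps)
  have quart: "prodint p p + prodint q q = 2 * (prodint a a + 6 * prodint a d + prodint d d)"
    if T: "trapping_potential V" and a: "a \<in> Hspace V" and d: "d \<in> Hspace V"
      and pq: "\<And>x. p x = a x + d x" "\<And>x. q x = a x - d x" "p \<in> Hspace V" "q \<in> Hspace V" for V p q a d
  proof -
    have "prodint p p + prodint q q = (\<integral>x. (p x)\<^sup>2 * (p x)\<^sup>2 + (q x)\<^sup>2 * (q x)\<^sup>2 \<partial>lborel)"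
      unfolding prodint_def using prodint_le(2)[OF T T pq(3,3)] prodint_le(2)[OF T T pq(4,4)] by simp
    also have "\<dots> = (\<integral>x. 2 * ((a x)\<^sup>2 * (a x)\<^sup>2 + 6 * ((a x)\<^sup>2 * (d x)\<^sup>2) + (d x)\<^sup>2 * (d x)\<^sup>2) \<partial>lborel)"
      by (intro Bochner_Integration.integral_cong) (auto simp: pq power2_eq_square algebra_simps)
    also have "\<dots> = 2 * (prodint a a + 6 * prodint a d + prodint d d)"
      unfolding prodint_def using prodint_le(2)[OF T T a a] prodint_le(2)[OF T T a d] prodint_le(2)[OF T T d d] by simp
    finally show ?thesis .
  qed
  note q1 = quart[OF T1 c1(1,2) ud(1,2) u(1) v(1)] and q2 = quart[OF T2 c2(1,2) ud(3,4) u(2) v(2)]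
  have cross: "prodint u1 u2 + prodint v1 v2 \<le> 2 * (prodint a1 a2 + 3 * prodint a1 d2 + 3 * prodint d1 a2 + prodint d1 d2)"
  proof -
    note I = prodint_le(2)[OF T1 T2 c1(1) c2(1)] prodint_le(2)[OF T1 T2 c1(1) c2(2)] prodint_le(2)[OF T1 T2 c1(2) c2(1)]
      prodint_le(2)[OF T1 T2 c1(2) c2(2)]
    have "prodint u1 u2 + prodint v1 v2 = (\<integral>x. (u1 x)\<^sup>2 * (u2 x)\<^sup>2 + (v1 x)\<^sup>2 * (v2 x)\<^sup>2 \<partial>lborel)"
      unfolding prodint_def using prodint_le(2)[OF T1 T2 u(1,2)] prodint_le(2)[OF T1 T2 v(1,2)] by simp
    also have "\<dots> \<le> (\<integral>x. 2 * ((a1 x)\<^sup>2 * (a2 x)\<^sup>2 + 3 * ((a1 x)\<^sup>2 * (d2 x)\<^sup>2) + 3 * ((d1 x)\<^sup>2 * (a2 x)\<^sup>2) + (d1 x)\<^sup>2 * (d2 x)\<^sup>2) \<partial>lborel)"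
    proof (rule integral_mono)
      show "integrable lborel (\<lambda>x. (u1 x)\<^sup>2 * (u2 x)\<^sup>2 + (v1 x)\<^sup>2 * (v2 x)\<^sup>2)"
        using prodint_le(2)[OF T1 T2 u(1,2)] prodint_le(2)[OF T1 T2 v(1,2)] by simp
      show "integrable lborel (\<lambda>x. 2 * ((a1 x)\<^sup>2 * (a2 x)\<^sup>2 + 3 * ((a1 x)\<^sup>2 * (d2 x)\<^sup>2) + 3 * ((d1 x)\<^sup>2 * (a2 x)\<^sup>2) + (d1 x)\<^sup>2 * (d2 x)\<^sup>2))"
        using I by simp
      have "(p + q)\<^sup>2 * (r + t)\<^sup>2 + (p - q)\<^sup>2 * (r - t)\<^sup>2 \<le> 2 * (p\<^sup>2 * r\<^sup>2 + 3 * (p\<^sup>2 * t\<^sup>2) + 3 * (q\<^sup>2 * r\<^sup>2) + q\<^sup>2 * t\<^sup>2)" for p q r t :: real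
      proof -
        have "2 * (p\<^sup>2 * r\<^sup>2 + 3 * (p\<^sup>2 * t\<^sup>2) + 3 * (q\<^sup>2 * r\<^sup>2) + q\<^sup>2 * t\<^sup>2) - ((p + q)\<^sup>2 * (r + t)\<^sup>2 + (p - q)\<^sup>2 * (r - t)\<^sup>2) = 4 * (p * t - q * r)\<^sup>2"
          by (simp add: power2_eq_square algebra_simps)
        then show ?thesis using zero_le_power2[of "p * t - q * r"] by linarith
      qed
      then show "(u1 x)\<^sup>2 * (u2 x)\<^sup>2 + (v1 x)\<^sup>2 * (v2 x)\<^sup>2
        \<le> 2 * ((a1 x)\<^sup>2 * (a2 x)\<^sup>2 + 3 * ((a1 x)\<^sup>2 * (d2 x)\<^sup>2) + 3 * ((d1 x)\<^sup>2 * (a2 x)\<^sup>2) + (d1 x)\<^sup>2 * (d2 x)\<^sup>2)" for x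
        unfolding ud .
    qed
    also have "\<dots> = 2 * (prodint a1 a2 + 3 * prodint a1 d2 + 3 * prodint d1 a2 + prodint d1 d2)"
      unfolding prodint_def using I by simp
    finally show ?thesis .
  qed
  have pl: "prodint p q \<le> 4 * L * Kf W q" if "trapping_potential V" "trapping_potential W" "p \<in> Hspace V" "q \<in> Hspace W" "Kf V p \<le> L" for V W p q
  proof -
    have "prodint p q \<le> 4 * Kf V p * Kf W q" by (rule prodint_le(3)[OF that(1-4)])
    also have "\<dots> \<le> 4 * L * Kf W q" using that(5) by (intro mult_right_mono) auto
    finally show ?thesis .
  qed
  have sym: "prodint p q = prodint q p" for p q by (simp add: prodint_def mult.commute)
  define k1 k2 where "k1 = Kf V1 d1" and "k2 = Kf V2 d2"
  have e: "prodint a1 d1 \<le> 4 * L * k1" "prodint d1 d1 \<le> 4 * L * k1" "prodint a2 d2 \<le> 4 * L * k2" "prodint d2 d2 \<le> 4 * L * k2"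
    "prodint a1 d2 \<le> 4 * L * k2" "prodint d1 a2 \<le> 4 * L * k1" "prodint d1 d2 \<le> 4 * L * k2"
    unfolding k1_def k2_def using pl[OF T1 T1 c1(1,2) K(1)] pl[OF T1 T1 c1(2,2) K(2)] pl[OF T2 T2 c2(1,2) K(3)] pl[OF T2 T2 c2(2,2) K(4)]
      pl[OF T1 T2 c1(1) c2(2) K(1)] pl[OF T2 T1 c2(1) c1(2) K(3)] pl[OF T1 T2 c1(2) c2(2) K(2)] sym[of d1 a2] by auto
  have k0: "0 \<le> k1" "0 \<le> k2" by (simp_all add: k1_def k2_def)
  have g1: "prodint a1 a1 \<le> prodint (\<lambda>x. s1 * a1 x) (\<lambda>x. s1 * a1 x)" by (rule prodint_le_scale[OF s1(1) s1(1)])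
  have g2: "prodint a2 a2 \<le> prodint (\<lambda>x. s2 * a2 x) (\<lambda>x. s2 * a2 x)" by (rule prodint_le_scale[OF s2(1) s2(1)])
  have g12: "prodint a1 a2 \<le> prodint (\<lambda>x. s1 * a1 x) (\<lambda>x. s2 * a2 x)" by (rule prodint_le_scale[OF s1(1) s2(1)])
  have n1: "(b1 / 2 * prodint u1 u1 + b1 / 2 * prodint v1 v1) / 2 \<le> b1 / 2 * prodint (\<lambda>x. s1 * a1 x) (\<lambda>x. s1 * a1 x) + 14 * \<delta> * L * k1"
  proof -
    have "(prodint u1 u1 + prodint v1 v1) / 2 \<le> prodint (\<lambda>x. s1 * a1 x) (\<lambda>x. s1 * a1 x) + 28 * (L * k1)"
      using q1 e(1,2) g1 by simp
    then have "b1 / 2 * ((prodint u1 u1 + prodint v1 v1) / 2) \<le> b1 / 2 * (prodint (\<lambda>x. s1 * a1 x) (\<lambda>x. s1 * a1 x) + 28 * (L * k1))"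
      using b by (intro mult_left_mono) auto
    moreover have "b1 * (L * k1) \<le> \<delta> * (L * k1)" using b L0 k0 by (intro mult_right_mono) auto
    ultimately show ?thesis by (simp add: algebra_simps add_divide_distrib)
  qed
  have n2: "(b2 / 2 * prodint u2 u2 + b2 / 2 * prodint v2 v2) / 2 \<le> b2 / 2 * prodint (\<lambda>x. s2 * a2 x) (\<lambda>x. s2 * a2 x) + 14 * \<delta> * L * k2"
  proof -
    have "(prodint u2 u2 + prodint v2 v2) / 2 \<le> prodint (\<lambda>x. s2 * a2 x) (\<lambda>x. s2 * a2 x) + 28 * (L * k2)"
      using q2 e(3,4) g2 by simp
    then have "b2 / 2 * ((prodint u2 u2 + prodint v2 v2) / 2) \<le> b2 / 2 * (prodint (\<lambda>x. s2 * a2 x) (\<lambda>x. s2 * a2 x) + 28 * (L * k2))"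
      using b by (intro mult_left_mono) auto
    moreover have "b2 * (L * k2) \<le> \<delta> * (L * k2)" using b L0 k0 by (intro mult_right_mono) auto
    ultimately show ?thesis by (simp add: algebra_simps add_divide_distrib)
  qed
  have n12: "(\<beta> * prodint u1 u2 + \<beta> * prodint v1 v2) / 2 \<le> \<beta> * prodint (\<lambda>x. s1 * a1 x) (\<lambda>x. s2 * a2 x) + 16 * \<delta> * L * (k1 + k2)"
  proof -
    have Lk: "0 \<le> L * k1" using L0 k0 by simp
    have "(prodint u1 u2 + prodint v1 v2) / 2 \<le> prodint (\<lambda>x. s1 * a1 x) (\<lambda>x. s2 * a2 x) + 16 * (L * k1 + L * k2)"
      using cross e(5-7) g12 Lk by simp
    then have "\<beta> * ((prodint u1 u2 + prodint v1 v2) / 2) \<le> \<beta> * (prodint (\<lambda>x. s1 * a1 x) (\<lambda>x. s2 * a2 x) + 16 * (L * k1 + L * k2))"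
      using b by (intro mult_left_mono) auto
    moreover have "\<beta> * (L * k1 + L * k2) \<le> \<delta> * (L * k1 + L * k2)" using b L0 k0 by (intro mult_right_mono) auto
    ultimately show ?thesis by (simp add: algebra_simps add_divide_distrib)
  qed
  have fin: "14 * \<delta> * L * k1 + 14 * \<delta> * L * k2 + 16 * \<delta> * L * (k1 + k2) = 30 * \<delta> * L * (k1 + k2)"
    by (simp add: algebra_simps)
  have gen: "((qu1 + qv1) / 2 + F1) + ((qu2 + qv2) / 2 + F2) - (m1 + m2 + m12)
    \<le> (qu1 + qu2 - (A1 + A2 + A12) + (qv1 + qv2 - (B1 + B2 + B12))) / 2 + F1 + F2 + T"
    if "(A1 + B1) / 2 \<le> m1 + t1" "(A2 + B2) / 2 \<le> m2 + t2" "(A12 + B12) / 2 \<le> m12 + t12" "t1 + t2 + t12 = T"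
    for qu1 qu2 qv1 qv2 F1 F2 m1 m2 m12 A1 A2 A12 B1 B2 B12 t1 t2 t12 T :: real
    using that by (simp add: field_simps)
  have le: "energy V1 V2 b1 b2 \<beta> (\<lambda>x. s1 * a1 x) (\<lambda>x. s2 * a2 x)
    \<le> (energy V1 V2 b1 b2 \<beta> u1 u2 + energy V1 V2 b1 b2 \<beta> v1 v2) / 2
      + ((Qf V1 u1 + Qf V1 v1) / 2 * sqn d1 - Qf V1 d1) / (1 - sqn d1)
      + ((Qf V2 u2 + Qf V2 v2) / 2 * sqn d2 - Qf V2 d2) / (1 - sqn d2)
      + 30 * \<delta> * L * (k1 + k2)"
    unfolding energy_eq[OF m1 m2] energy_eq[OF u(1,2)] energy_eq[OF v(1,2)] s1(3) s2(3)
    by (rule gen[OF n1 n2 n12 fin])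
  have M: "((\<lambda>x. s1 * a1 x), (\<lambda>x. s2 * a2 x)) \<in> Mset V1 V2"
    unfolding Mset_iff by (intro conjI m1 m2 s1(2) s2(2))
  show ?thesis by (rule exI, rule exI, rule conjI[OF M le[unfolded k1_def k2_def]])
qed

lemma energy_tendsto:
  assumes u: "\<And>n. u1 n \<in> Hspace V1" "\<And>n. u2 n \<in> Hspace V2" and w: "w1 \<in> Hspace V1" "w2 \<in> Hspace V2"
    and lim: "(\<lambda>n. Kf V1 (\<lambda>x. u1 n x - w1 x)) \<longlonglongrightarrow> 0" "(\<lambda>n. Kf V2 (\<lambda>x. u2 n x - w2 x)) \<longlonglongrightarrow> 0"
  shows "(\<lambda>n. energy V1 V2 b1 b2 \<beta> (u1 n) (u2 n)) \<longlonglongrightarrow> energy V1 V2 b1 b2 \<beta> w1 w2"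
proof -
  note c1 = P1.square_L2[OF u(1)] P1.square_L2[OF w(1)] P1.square_tendsto[OF u(1) w(1) lim(1)]
    and c2 = P2.square_L2[OF u(2)] P2.square_L2[OF w(2)] P2.square_tendsto[OF u(2) w(2) lim(2)]
  show ?thesis
    unfolding energy_eq[OF u] energy_eq[OF w] prodint_eq_ip
    by (rule tendsto_diff[OF tendsto_add[OF P1.Qf_tendsto(1)[OF u(1) w(1) lim(1)] P2.Qf_tendsto(1)[OF u(2) w(2) lim(2)]]
      tendsto_add[OF tendsto_add[OF tendsto_mult_left[OF ip_tendsto_both[OF c1 c1]] tendsto_mult_left[OF ip_tendsto_both[OF c2 c2]]]
        tendsto_mult_left[OF ip_tendsto_both[OF c1 c2]]]])
qed

lemma near_ground_energy:
  assumes b: "0 < b1" "0 < b2" "0 < \<beta>" "b1 \<le> \<delta>" "b2 \<le> \<delta>" "\<beta> \<le> \<delta>" and \<eta>: "0 < \<eta>"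
  shows "\<exists>u1 u2. (u1, u2) \<in> Mset V1 V2 \<and> energy V1 V2 b1 b2 \<beta> u1 u2 \<le> P1.lam + P2.lam + \<eta>"
proof -
  obtain u1 where u1: "u1 \<in> Hspace V1" "sqn u1 = 1" "Qf V1 u1 < P1.lam + \<eta> / 2"
    using P1.near_lam[of "\<eta> / 2"] \<eta> by auto
  obtain u2 where u2: "u2 \<in> Hspace V2" "sqn u2 = 1" "Qf V2 u2 < P2.lam + \<eta> / 2"
    using P2.near_lam[of "\<eta> / 2"] \<eta> by auto
  have M: "(u1, u2) \<in> Mset V1 V2" using u1 u2 by (simp add: Mset_iff)
  have "energy V1 V2 b1 b2 \<beta> u1 u2 \<le> P1.lam + P2.lam + \<eta>"
    using energy_coercive(2)[OF M b] u1(3) u2(3) by linarith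
  then show ?thesis using M by blast
qed

lemma energy_abs_le:
  assumes M: "(u1, u2) \<in> Mset V1 V2"
  shows "((\<lambda>x. \<bar>u1 x\<bar>), (\<lambda>x. \<bar>u2 x\<bar>)) \<in> Mset V1 V2"
    "energy V1 V2 b1 b2 \<beta> (\<lambda>x. \<bar>u1 x\<bar>) (\<lambda>x. \<bar>u2 x\<bar>) \<le> energy V1 V2 b1 b2 \<beta> u1 u2"
proof -
  have u: "u1 \<in> Hspace V1" "u2 \<in> Hspace V2" "sqn u1 = 1" "sqn u2 = 1" using M by (auto simp: Mset_iff)
  have s: "sqn (\<lambda>x. \<bar>u x\<bar>) = sqn u" for u by (simp add: sqn_def)
  have p: "prodint (\<lambda>x. \<bar>p x\<bar>) (\<lambda>x. \<bar>q x\<bar>) = prodint p q" for p q by (simp add: prodint_def)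
  show "((\<lambda>x. \<bar>u1 x\<bar>), (\<lambda>x. \<bar>u2 x\<bar>)) \<in> Mset V1 V2"
    unfolding Mset_iff s using P1.Hspace_abs(1)[OF u(1)] P2.Hspace_abs(1)[OF u(2)] u by simp
  show "energy V1 V2 b1 b2 \<beta> (\<lambda>x. \<bar>u1 x\<bar>) (\<lambda>x. \<bar>u2 x\<bar>) \<le> energy V1 V2 b1 b2 \<beta> u1 u2"
    unfolding energy_eq[OF P1.Hspace_abs(1)[OF u(1)] P2.Hspace_abs(1)[OF u(2)]] energy_eq[OF u(1,2)] p
    using P1.Hspace_abs(2)[OF u(1)] P2.Hspace_abs(2)[OF u(2)] by simp
qed

lemma minimizer_exists:
  assumes b: "0 < b1" "0 < b2" "0 < \<beta>" "b1 \<le> \<delta>" "b2 \<le> \<delta>" "\<beta> \<le> \<delta>"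
    and \<delta>: "16 * \<delta> \<le> 1/2" and L: "L = 3 + 2 * (P1.lam + P2.lam)" and \<delta>L: "30 * \<delta> * L \<le> 1/4"
  shows "\<exists>u1 u2. nonneg_minimizer V1 V2 b1 b2 \<beta> u1 u2"
proof -
  let ?E = "energy V1 V2 b1 b2 \<beta>"
  define Lam where "Lam = P1.lam + P2.lam"
  have Lam0: "0 \<le> Lam" using P1.lam_nonneg P2.lam_nonneg by (simp add: Lam_def)
  define S where "S = (\<lambda>(u1, u2). ?E u1 u2) ` Mset V1 V2"
  define e where "e = Inf S"
  have half: "(Qf V1 u1 + Qf V2 u2) / 2 \<le> ?E u1 u2" if "(u1, u2) \<in> Mset V1 V2" for u1 u2
  proof -
    have "1/2 * (Qf V1 u1 + Qf V2 u2) \<le> (1 - 16 * \<delta>) * (Qf V1 u1 + Qf V2 u2)"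
      using \<delta> by (intro mult_right_mono) auto
    then show ?thesis using energy_coercive(1)[OF that b] by simp
  qed
  have bdd: "bdd_below S"
  proof (rule bdd_belowI[of _ 0])
    fix y assume "y \<in> S"
    then obtain u1 u2 where M: "(u1, u2) \<in> Mset V1 V2" "y = ?E u1 u2" by (auto simp: S_def)
    have "0 \<le> (Qf V1 u1 + Qf V2 u2) / 2" by simp
    then show "0 \<le> y" using half[OF M(1)] M(2) by linarith
  qed
  have ne: "S \<noteq> {}" using near_ground_energy[OF b, of 1] by (auto simp: S_def)
  have e_le: "e \<le> ?E u1 u2" if "(u1, u2) \<in> Mset V1 V2" for u1 u2
    unfolding e_def using that by (intro cInf_lower bdd) (auto simp: S_def)
  have eLam: "e \<le> Lam"
  proof (rule field_le_epsilon)
    fix \<eta> :: real assume "0 < \<eta>"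
    then obtain u1 u2 where "(u1, u2) \<in> Mset V1 V2" "?E u1 u2 \<le> Lam + \<eta>"
      using near_ground_energy[OF b] unfolding Lam_def by blast
    then show "e \<le> Lam + \<eta>" using e_le by force
  qed
  have "\<exists>p. p \<in> Mset V1 V2 \<and> (\<forall>x. 0 \<le> fst p x) \<and> (\<forall>x. 0 \<le> snd p x) \<and> ?E (fst p) (snd p) < e + 1 / real (Suc n)" for n
  proof -
    have "Inf S < e + 1 / real (Suc n)" by (simp add: e_def)
    from cInf_lessD[OF ne this] obtain u1 u2 where M: "(u1, u2) \<in> Mset V1 V2" "?E u1 u2 < e + 1 / real (Suc n)"
      by (auto simp: S_def)
    show ?thesis
      using energy_abs_le(1)[OF M(1)] order_le_less_trans[OF energy_abs_le(2)[OF M(1)] M(2)]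
      by (intro exI[of _ "((\<lambda>x. \<bar>u1 x\<bar>), (\<lambda>x. \<bar>u2 x\<bar>))"]) simp
  qed
  then have "\<exists>p. \<forall>n. p n \<in> Mset V1 V2 \<and> (\<forall>x. 0 \<le> fst (p n) x) \<and> (\<forall>x. 0 \<le> snd (p n) x) \<and> ?E (fst (p n)) (snd (p n)) < e + 1 / real (Suc n)"
    by (intro choice allI)
  then obtain p where p: "\<And>n. p n \<in> Mset V1 V2" "\<And>n x. 0 \<le> fst (p n) x" "\<And>n x. 0 \<le> snd (p n) x"
    "\<And>n. ?E (fst (p n)) (snd (p n)) < e + 1 / real (Suc n)" by blast
  define u1 where "u1 n = fst (p n)" for n
  define u2 where "u2 n = snd (p n)" for n
  have uM: "(u1 n, u2 n) \<in> Mset V1 V2" for n using p(1)[of n] by (simp add: u1_def u2_def)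
  have u: "u1 n \<in> Hspace V1" "u2 n \<in> Hspace V2" "sqn (u1 n) = 1" "sqn (u2 n) = 1" for n using uM[of n] by (auto simp: Mset_iff)
  have upos: "0 \<le> u1 n x" "0 \<le> u2 n x" for n x using p(2,3) by (auto simp: u1_def u2_def)
  define ex where "ex n = ?E (u1 n) (u2 n) - e" for n
  have ex: "0 \<le> ex n" "ex n \<le> 1 / real (Suc n)" for n
    using e_le[OF uM[of n]] p(4)[of n] by (auto simp: ex_def u1_def u2_def)
  have ex0: "ex \<longlonglongrightarrow> 0"
    by (rule real_tendsto_sandwich[OF _ _ tendsto_const LIMSEQ_Suc[OF lim_1_over_n]]) (use ex in \<open>auto intro!: always_eventually\<close>)
  have QB: "Qf V1 (u1 n) + Qf V2 (u2 n) \<le> 2 * (Lam + 1)" for n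
  proof -
    have "1 / real (Suc n) \<le> 1" by simp
    then have "?E (u1 n) (u2 n) \<le> Lam + 1" using ex(2)[of n] eLam unfolding ex_def by linarith
    then show ?thesis using half[OF uM[of n]] by (simp add: field_simps)
  qed
  have KL: "Kf V1 (u1 n) \<le> L" "Kf V2 (u2 n) \<le> L" for n
    using QB[of n] u(3,4)[of n] Qf_nonneg[of V1 "u1 n"] Qf_nonneg[of V2 "u2 n"] unfolding Kf_def L Lam_def[symmetric] by - argo+
  have L0: "0 \<le> L" using Lam0 by (simp add: L Lam_def)
  have key: "Kf V1 (\<lambda>x. u1 m x - u1 n x) + Kf V2 (\<lambda>x. u2 m x - u2 n x)
    \<le> 4 * (ex m + ex n) + (4 * L + 2) * (sqn (\<lambda>x. u1 m x - u1 n x) + sqn (\<lambda>x. u2 m x - u2 n x))" for m n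
  proof -
    let ?d1 = "\<lambda>x. (1/2) * u1 m x + (-1/2) * u1 n x" and ?d2 = "\<lambda>x. (1/2) * u2 m x + (-1/2) * u2 n x"
    have pos: "AE x in lborel. 0 \<le> u1 k x" "AE x in lborel. 0 \<le> u2 k x" for k using upos by auto
    have d1: "?d1 = (\<lambda>x. (1/2) * (u1 m x - u1 n x))" and d2: "?d2 = (\<lambda>x. (1/2) * (u2 m x - u2 n x))" by auto
    have K1: "Kf V1 ?d1 = Kf V1 (\<lambda>x. u1 m x - u1 n x) / 4" and K2: "Kf V2 ?d2 = Kf V2 (\<lambda>x. u2 m x - u2 n x) / 4"
      unfolding d1 d2 P1.Kf_scale[OF P1.Hspace_diff[OF u(1) u(1)]] P2.Kf_scale[OF P2.Hspace_diff[OF u(2) u(2)]]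
      by (simp_all add: power2_eq_square)
    have s1: "sqn ?d1 = sqn (\<lambda>x. u1 m x - u1 n x) / 4" and s2: "sqn ?d2 = sqn (\<lambda>x. u2 m x - u2 n x) / 4"
      unfolding d1 d2 sqn_scale by (simp_all add: power2_eq_square)
    have sh: "sqn ?d1 \<le> 1/2" "sqn ?d2 \<le> 1/2"
      by (rule P1.midpoint_component(3)[OF u(1) u(1) u(3) u(3) pos(1) pos(1) refl refl], rule P2.midpoint_component(3)[OF u(2) u(2) u(4) u(4) pos(2) pos(2) refl refl])
    obtain m1 m2 where m: "(m1, m2) \<in> Mset V1 V2" "?E m1 m2 \<le> (?E (u1 m) (u2 m) + ?E (u1 n) (u2 n)) / 2
      + ((Qf V1 (u1 m) + Qf V1 (u1 n)) / 2 * sqn ?d1 - Qf V1 ?d1) / (1 - sqn ?d1)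
      + ((Qf V2 (u2 m) + Qf V2 (u2 n)) / 2 * sqn ?d2 - Qf V2 ?d2) / (1 - sqn ?d2)
      + 30 * \<delta> * L * (Kf V1 ?d1 + Kf V2 ?d2)"
      using energy_midpoint[OF u[of m] pos[of m] u[of n] pos[of n] KL[of m] KL[of n] b refl refl] by blast
    have frac: "(q * s - Q) / (1 - s) \<le> 2 * L * s - Q" if "0 \<le> q" "q \<le> L" "0 \<le> s" "s \<le> 1/2" "0 \<le> Q" for q s Q :: real
    proof -
      have "q * s \<le> L * s" "0 \<le> L * s" "0 \<le> Q * s" using that L0 by (auto intro: mult_right_mono)
      moreover have "L * s * s \<le> L * s * (1/2)" using that \<open>0 \<le> L * s\<close> by (intro mult_left_mono) auto
      ultimately have "q * s - Q \<le> (2 * L * s - Q) * (1 - s)" by (simp add: algebra_simps)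
      then show ?thesis using that by (simp add: pos_divide_le_eq)
    qed
    have QL: "Qf V1 (u1 k) \<le> L" "Qf V2 (u2 k) \<le> L" for k
      using KL[of k] sqn_nonneg[of "u1 k"] sqn_nonneg[of "u2 k"] unfolding Kf_def by linarith+
    have f1: "((Qf V1 (u1 m) + Qf V1 (u1 n)) / 2 * sqn ?d1 - Qf V1 ?d1) / (1 - sqn ?d1) \<le> 2 * L * sqn ?d1 - Qf V1 ?d1"
      using QL[of m] QL[of n] sh by (intro frac) auto
    have f2: "((Qf V2 (u2 m) + Qf V2 (u2 n)) / 2 * sqn ?d2 - Qf V2 ?d2) / (1 - sqn ?d2) \<le> 2 * L * sqn ?d2 - Qf V2 ?d2"
      using QL[of m] QL[of n] sh by (intro frac) auto
    have "30 * \<delta> * L * (Kf V1 ?d1 + Kf V2 ?d2) \<le> 1/4 * (Kf V1 ?d1 + Kf V2 ?d2)"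
      using \<delta>L by (intro mult_right_mono) auto
    with m(2) f1 f2 e_le[OF m(1)]
    have "e \<le> (?E (u1 m) (u2 m) + ?E (u1 n) (u2 n)) / 2 + (2 * L * sqn ?d1 - Qf V1 ?d1) + (2 * L * sqn ?d2 - Qf V2 ?d2)
      + 1/4 * (Kf V1 ?d1 + Kf V2 ?d2)" by linarith
    moreover have "Qf V1 ?d1 = Kf V1 ?d1 - sqn ?d1" "Qf V2 ?d2 = Kf V2 ?d2 - sqn ?d2" by (simp_all add: Kf_def)
    ultimately have "3/4 * (Kf V1 ?d1 + Kf V2 ?d2) \<le> (ex m + ex n) / 2 + (2 * L + 1) * (sqn ?d1 + sqn ?d2)"
      unfolding ex_def by (simp add: field_simps)
    moreover have "0 \<le> (2 * L + 1) * (sqn ?d1 + sqn ?d2)" using L0 by simp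
    moreover have "0 \<le> ex m + ex n" using ex(1) by simp
    moreover have "k \<le> x + 2 * y" if "3/4 * k \<le> x / 2 + y" "0 \<le> y" "0 \<le> x" for k x y :: real using that by argo
    ultimately have "Kf V1 ?d1 + Kf V2 ?d2 \<le> (ex m + ex n) + 2 * ((2 * L + 1) * (sqn ?d1 + sqn ?d2))"
      by blast
    moreover have "a + b \<le> 4 * x + (4 * L + 2) * (s + t)" if "a / 4 + b / 4 \<le> x + 2 * ((2 * L + 1) * (s / 4 + t / 4))" for a b x s t :: real
      using that by (simp add: field_simps)
    ultimately show ?thesis unfolding K1 K2 s1 s2 by blast
  qed
  obtain r1 where r1: "strict_mono (r1 :: nat \<Rightarrow> nat)"
    "\<And>e. 0 < e \<Longrightarrow> \<exists>N. \<forall>m\<ge>N. \<forall>n\<ge>N. sqn (\<lambda>x. u1 (r1 m) x - u1 (r1 n) x) < e"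
    by (rule P1.Hspace_compact[of u1 L, OF u(1) KL(1)]) blast
  obtain r2 where r2: "strict_mono (r2 :: nat \<Rightarrow> nat)"
    "\<And>e. 0 < e \<Longrightarrow> \<exists>N. \<forall>m\<ge>N. \<forall>n\<ge>N. sqn (\<lambda>x. u2 (r1 (r2 m)) x - u2 (r1 (r2 n)) x) < e"
    by (rule P2.Hspace_compact[of "\<lambda>n. u2 (r1 n)" L, OF u(2) KL(2)]) blast
  define r where "r k = r1 (r2 k)" for k
  have sm: "strict_mono r" using r1(1) r2(1) by (simp add: strict_mono_def r_def)
  have cau: "\<exists>N. \<forall>m\<ge>N. \<forall>n\<ge>N. Kf V1 (\<lambda>x. u1 (r m) x - u1 (r n) x) + Kf V2 (\<lambda>x. u2 (r m) x - u2 (r n) x) < \<epsilon>" if \<epsilon>: "0 < \<epsilon>" for \<epsilon>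
  proof -
    define c where "c = \<epsilon> / (4 * (4 * L + 2))"
    have c: "0 < c" "(4 * L + 2) * c = \<epsilon> / 4" using \<epsilon> L0 by (auto simp: c_def field_simps)
    obtain N1 where N1: "\<And>m n. m \<ge> N1 \<Longrightarrow> n \<ge> N1 \<Longrightarrow> sqn (\<lambda>x. u1 (r1 m) x - u1 (r1 n) x) < c"
      using r1(2)[OF c(1)] by blast
    obtain N2 where N2: "\<And>m n. m \<ge> N2 \<Longrightarrow> n \<ge> N2 \<Longrightarrow> sqn (\<lambda>x. u2 (r m) x - u2 (r n) x) < c"
      using r2(2)[OF c(1)] unfolding r_def by blast
    obtain N3 where N3: "\<And>n. n \<ge> N3 \<Longrightarrow> ex n < \<epsilon> / 16"
      using order_tendstoD(2)[OF ex0, of "\<epsilon>/16"] \<epsilon> by (auto simp: eventually_sequentially)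
    show ?thesis
    proof (intro exI[of _ "max N1 (max N2 N3)"] allI impI)
      fix m n assume mn: "max N1 (max N2 N3) \<le> m" "max N1 (max N2 N3) \<le> n"
      have "r2 m \<ge> N1" "r2 n \<ge> N1" "r m \<ge> N3" "r n \<ge> N3"
        using seq_suble[OF r2(1)] seq_suble[OF sm] mn order_trans by (meson max.boundedE)+
      then have 1: "sqn (\<lambda>x. u1 (r m) x - u1 (r n) x) < c" "ex (r m) < \<epsilon> / 16" "ex (r n) < \<epsilon> / 16"
        using N1 N3 by (auto simp: r_def)
      have 2: "sqn (\<lambda>x. u2 (r m) x - u2 (r n) x) < c" using N2 mn by simp
      have "(4 * L + 2) * (sqn (\<lambda>x. u1 (r m) x - u1 (r n) x) + sqn (\<lambda>x. u2 (r m) x - u2 (r n) x)) \<le> (4 * L + 2) * (c + c)"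
        using 1 2 L0 by (intro mult_left_mono) auto
      also have "\<dots> = \<epsilon> / 2" using c(2) by (simp only: distrib_left)
      finally have 3: "(4 * L + 2) * (sqn (\<lambda>x. u1 (r m) x - u1 (r n) x) + sqn (\<lambda>x. u2 (r m) x - u2 (r n) x)) \<le> \<epsilon> / 2" .
      have "k < \<epsilon>" if "k \<le> 4 * (s + t) + y" "y \<le> \<epsilon> / 2" "s < \<epsilon> / 16" "t < \<epsilon> / 16" for k y s t :: real
        using that by argo
      from this[OF key 3 1(2,3)] show "Kf V1 (\<lambda>x. u1 (r m) x - u1 (r n) x) + Kf V2 (\<lambda>x. u2 (r m) x - u2 (r n) x) < \<epsilon>" .
    qed
  qed
  have cau1: "\<exists>N. \<forall>m\<ge>N. \<forall>n\<ge>N. Kf V1 (\<lambda>x. u1 (r m) x - u1 (r n) x) < \<epsilon>" if \<epsilon>: "0 < \<epsilon>" for \<epsilon>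
  proof -
    obtain N where N: "\<And>m n. m \<ge> N \<Longrightarrow> n \<ge> N \<Longrightarrow> Kf V1 (\<lambda>x. u1 (r m) x - u1 (r n) x) + Kf V2 (\<lambda>x. u2 (r m) x - u2 (r n) x) < \<epsilon>"
      using cau[OF \<epsilon>] by blast
    show ?thesis
    proof (intro exI[of _ N] allI impI)
      fix m n assume "N \<le> m" "N \<le> n"
      then show "Kf V1 (\<lambda>x. u1 (r m) x - u1 (r n) x) < \<epsilon>"
        using N[of m n] Kf_nonneg[of V2 "\<lambda>x. u2 (r m) x - u2 (r n) x"] by linarith
    qed
  qed
  obtain w1 q1 where w1: "w1 \<in> Hspace V1" "strict_mono (q1 :: nat \<Rightarrow> nat)"
    "(\<lambda>k. Kf V1 (\<lambda>x. u1 (r (q1 k)) x - w1 x)) \<longlonglongrightarrow> 0" "AE x in lborel. (\<lambda>k. u1 (r (q1 k)) x) \<longlonglongrightarrow> w1 x"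
    by (rule P1.Hspace_complete[of "\<lambda>n. u1 (r n)", OF u(1) cau1]) blast
  have cau2: "\<exists>N. \<forall>m\<ge>N. \<forall>n\<ge>N. Kf V2 (\<lambda>x. u2 (r (q1 m)) x - u2 (r (q1 n)) x) < \<epsilon>" if \<epsilon>: "0 < \<epsilon>" for \<epsilon>
  proof -
    obtain N where N: "\<And>m n. m \<ge> N \<Longrightarrow> n \<ge> N \<Longrightarrow> Kf V1 (\<lambda>x. u1 (r m) x - u1 (r n) x) + Kf V2 (\<lambda>x. u2 (r m) x - u2 (r n) x) < \<epsilon>"
      using cau[OF \<epsilon>] by blast
    show ?thesis
    proof (intro exI[of _ N] allI impI)
      fix m n assume "N \<le> m" "N \<le> n"
      then have "N \<le> q1 m" "N \<le> q1 n" using seq_suble[OF w1(2)] order_trans by blast+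
      then show "Kf V2 (\<lambda>x. u2 (r (q1 m)) x - u2 (r (q1 n)) x) < \<epsilon>"
        using N[of "q1 m" "q1 n"] Kf_nonneg[of V1 "\<lambda>x. u1 (r (q1 m)) x - u1 (r (q1 n)) x"] by linarith
    qed
  qed
  obtain w2 q2 where w2: "w2 \<in> Hspace V2" "strict_mono (q2 :: nat \<Rightarrow> nat)"
    "(\<lambda>k. Kf V2 (\<lambda>x. u2 (r (q1 (q2 k))) x - w2 x)) \<longlonglongrightarrow> 0" "AE x in lborel. (\<lambda>k. u2 (r (q1 (q2 k))) x) \<longlonglongrightarrow> w2 x"
    by (rule P2.Hspace_complete[of "\<lambda>n. u2 (r (q1 n))", OF u(2) cau2]) blast
  define R where "R k = r (q1 (q2 k))" for k
  have smR: "strict_mono R" using sm w1(2) w2(2) by (simp add: strict_mono_def R_def)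
  have l1: "(\<lambda>k. Kf V1 (\<lambda>x. u1 (R k) x - w1 x)) \<longlonglongrightarrow> 0"
    using LIMSEQ_subseq_LIMSEQ[OF w1(3) w2(2)] by (simp add: o_def R_def)
  have l2: "(\<lambda>k. Kf V2 (\<lambda>x. u2 (R k) x - w2 x)) \<longlonglongrightarrow> 0" using w2(3) by (simp add: R_def)
  have "sqn w1 = 1" using P1.Qf_tendsto(2)[OF u(1) w1(1) l1] u(3) by (simp add: LIMSEQ_const_iff)
  moreover have "sqn w2 = 1" using P2.Qf_tendsto(2)[OF u(2) w2(1) l2] u(4) by (simp add: LIMSEQ_const_iff)
  ultimately have wM: "(w1, w2) \<in> Mset V1 V2" using w1(1) w2(1) by (simp add: Mset_iff)
  have "(\<lambda>k. ?E (u1 (R k)) (u2 (R k))) \<longlonglongrightarrow> ?E w1 w2"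
    by (rule energy_tendsto[OF u(1) u(2) w1(1) w2(1) l1 l2])
  moreover have "(\<lambda>k. ?E (u1 (R k)) (u2 (R k))) \<longlonglongrightarrow> e"
  proof -
    have "(\<lambda>k. ex (R k) + e) \<longlonglongrightarrow> 0 + e"
      using LIMSEQ_subseq_LIMSEQ[OF ex0 smR] by (intro tendsto_add tendsto_const) (simp add: o_def)
    then show ?thesis by (simp add: ex_def)
  qed
  ultimately have "?E w1 w2 = e" by (rule LIMSEQ_unique)
  moreover have "AE x in lborel. 0 \<le> w1 x" using w1(4) by eventually_elim (auto intro: LIMSEQ_le_const upos)
  moreover have "AE x in lborel. 0 \<le> w2 x" using w2(4) by eventually_elim (auto intro: LIMSEQ_le_const upos)
  ultimately have "nonneg_minimizer V1 V2 b1 b2 \<beta> w1 w2"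
    unfolding nonneg_minimizer_def using wM e_le by auto
  then show ?thesis by blast
qed

lemma minimizer_Qf_bound:
  assumes b: "0 < b1" "0 < b2" "0 < \<beta>" "b1 \<le> \<delta>" "b2 \<le> \<delta>" "\<beta> \<le> \<delta>"
    and \<delta>: "16 * \<delta> \<le> 1/2" and u: "nonneg_minimizer V1 V2 b1 b2 \<beta> u1 u2"
  shows "Qf V1 u1 \<le> P1.lam + 32 * \<delta> * (P1.lam + P2.lam)" "Qf V2 u2 \<le> P2.lam + 32 * \<delta> * (P1.lam + P2.lam)"
    "Qf V1 u1 + Qf V2 u2 \<le> 2 * (P1.lam + P2.lam)"
proof -
  define Lam where "Lam = P1.lam + P2.lam"
  define q where "q = Qf V1 u1 + Qf V2 u2"
  have M: "(u1, u2) \<in> Mset V1 V2" and min: "\<And>v1 v2. (v1, v2) \<in> Mset V1 V2 \<Longrightarrow> energy V1 V2 b1 b2 \<beta> u1 u2 \<le> energy V1 V2 b1 b2 \<beta> v1 v2"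
    using u by (auto simp: nonneg_minimizer_def)
  have uH: "u1 \<in> Hspace V1" "u2 \<in> Hspace V2" "sqn u1 = 1" "sqn u2 = 1" using M by (auto simp: Mset_iff)
  have "energy V1 V2 b1 b2 \<beta> u1 u2 \<le> Lam"
  proof (rule field_le_epsilon)
    fix \<eta> :: real assume "0 < \<eta>"
    then obtain v1 v2 where "(v1, v2) \<in> Mset V1 V2" "energy V1 V2 b1 b2 \<beta> v1 v2 \<le> Lam + \<eta>"
      using near_ground_energy[OF b] unfolding Lam_def by blast
    then show "energy V1 V2 b1 b2 \<beta> u1 u2 \<le> Lam + \<eta>" using min by force
  qed
  then have c: "(1 - 16 * \<delta>) * q \<le> Lam" using energy_coercive(1)[OF M b] by (simp add: q_def)
  have q0: "0 \<le> q" by (simp add: q_def)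
  have "1/2 * q \<le> (1 - 16 * \<delta>) * q" using \<delta> q0 by (intro mult_right_mono) auto
  then have q2: "q \<le> 2 * Lam" using c by simp
  then show "Qf V1 u1 + Qf V2 u2 \<le> 2 * (P1.lam + P2.lam)" by (simp add: q_def Lam_def)
  have "16 * \<delta> * q \<le> 16 * \<delta> * (2 * Lam)" using b q2 by (intro mult_left_mono) auto
  then have "q \<le> Lam + 32 * \<delta> * Lam" using c by (simp add: algebra_simps)
  then show "Qf V1 u1 \<le> P1.lam + 32 * \<delta> * (P1.lam + P2.lam)" "Qf V2 u2 \<le> P2.lam + 32 * \<delta> * (P1.lam + P2.lam)"
    using P1.lam_le_unit[OF uH(1,3)] P2.lam_le_unit[OF uH(2,4)] unfolding q_def Lam_def by linarith+
qed

lemma unique_minimizer_small_coupling: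
  "\<exists>\<delta>>0. \<forall>b1 b2 \<beta>. 0 < b1 \<and> 0 < b2 \<and> 0 < \<beta> \<and> b1 \<le> \<delta> \<and> b2 \<le> \<delta> \<and> \<beta> \<le> \<delta> \<longrightarrow>
     (\<exists>u1 u2. nonneg_minimizer V1 V2 b1 b2 \<beta> u1 u2 \<and>
        (\<forall>v1 v2. nonneg_minimizer V1 V2 b1 b2 \<beta> v1 v2 \<longrightarrow>
           (AE x in lborel. v1 x = u1 x) \<and> (AE x in lborel. v2 x = u2 x)))"
proof -
  obtain eps1 kap1 where g1: "0 < eps1" "0 < kap1"
    "\<And>u v. u \<in> Hspace V1 \<Longrightarrow> v \<in> Hspace V1 \<Longrightarrow> sqn u = 1 \<Longrightarrow> sqn v = 1 \<Longrightarrow>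
      AE x in lborel. 0 \<le> u x \<Longrightarrow> AE x in lborel. 0 \<le> v x \<Longrightarrow> Qf V1 u \<le> P1.lam + eps1 \<Longrightarrow> Qf V1 v \<le> P1.lam + eps1 \<Longrightarrow>
      kap1 * Kf V1 (\<lambda>x. u x - v x) \<le> Qf V1 (\<lambda>x. u x - v x) - (P1.lam + eps1) * sqn (\<lambda>x. u x - v x)"
    by (rule P1.spectral_gap) blast
  obtain eps2 kap2 where g2: "0 < eps2" "0 < kap2"
    "\<And>u v. u \<in> Hspace V2 \<Longrightarrow> v \<in> Hspace V2 \<Longrightarrow> sqn u = 1 \<Longrightarrow> sqn v = 1 \<Longrightarrow>
      AE x in lborel. 0 \<le> u x \<Longrightarrow> AE x in lborel. 0 \<le> v x \<Longrightarrow> Qf V2 u \<le> P2.lam + eps2 \<Longrightarrow> Qf V2 v \<le> P2.lam + eps2 \<Longrightarrow>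
      kap2 * Kf V2 (\<lambda>x. u x - v x) \<le> Qf V2 (\<lambda>x. u x - v x) - (P2.lam + eps2) * sqn (\<lambda>x. u x - v x)"
    by (rule P2.spectral_gap) blast
  define Lam where "Lam = P1.lam + P2.lam"
  have Lam0: "0 \<le> Lam" using P1.lam_nonneg P2.lam_nonneg by (simp add: Lam_def)
  define L where "L = 3 + 2 * Lam"
  have L0: "0 < L" using Lam0 by (simp add: L_def)
  define \<delta> where "\<delta> = Min {1/32, eps1 / (32 * (Lam + 1)), eps2 / (32 * (Lam + 1)), kap1 / (60 * L), kap2 / (60 * L), 1 / (120 * L)}"
  have \<delta>0: "0 < \<delta>" using g1(1,2) g2(1,2) Lam0 L0 by (simp add: \<delta>_def)
  have le: "\<delta> \<le> 1/32" "\<delta> \<le> eps1 / (32 * (Lam + 1))" "\<delta> \<le> eps2 / (32 * (Lam + 1))" "\<delta> \<le> kap1 / (60 * L)" "\<delta> \<le> kap2 / (60 * L)" "\<delta> \<le> 1 / (120 * L)"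
    unfolding \<delta>_def by (rule Min_le; simp)+
  have \<delta>16: "16 * \<delta> \<le> 1/2" using le(1) by simp
  have \<delta>L: "30 * \<delta> * L \<le> 1/4" "30 * \<delta> * L \<le> kap1 / 2" "30 * \<delta> * L \<le> kap2 / 2"
    using le(4-6) L0 by (simp_all add: field_simps)
  have \<delta>e: "32 * \<delta> * Lam \<le> eps1" "32 * \<delta> * Lam \<le> eps2"
  proof -
    have "32 * \<delta> * Lam \<le> 32 * \<delta> * (Lam + 1)" using \<delta>0 by (intro mult_left_mono) auto
    moreover have "32 * \<delta> * (Lam + 1) \<le> eps1" "32 * \<delta> * (Lam + 1) \<le> eps2" using le(2,3) Lam0 by (simp_all add: field_simps)
    ultimately show "32 * \<delta> * Lam \<le> eps1" "32 * \<delta> * Lam \<le> eps2" by linarith+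
  qed
  have "\<exists>u1 u2. nonneg_minimizer V1 V2 b1 b2 \<beta> u1 u2 \<and>
        (\<forall>v1 v2. nonneg_minimizer V1 V2 b1 b2 \<beta> v1 v2 \<longrightarrow>
           (AE x in lborel. v1 x = u1 x) \<and> (AE x in lborel. v2 x = u2 x))"
    if b: "0 < b1" "0 < b2" "0 < \<beta>" "b1 \<le> \<delta>" "b2 \<le> \<delta>" "\<beta> \<le> \<delta>" for b1 b2 \<beta>
  proof -
    let ?E = "energy V1 V2 b1 b2 \<beta>"
    obtain u1 u2 where U: "nonneg_minimizer V1 V2 b1 b2 \<beta> u1 u2"
      using minimizer_exists[OF b \<delta>16 _ \<delta>L(1)] by (auto simp: L_def Lam_def)
    have "(AE x in lborel. v1 x = u1 x) \<and> (AE x in lborel. v2 x = u2 x)"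
      if W: "nonneg_minimizer V1 V2 b1 b2 \<beta> v1 v2" for v1 v2
    proof -
      have uM: "(u1, u2) \<in> Mset V1 V2" and vM: "(v1, v2) \<in> Mset V1 V2"
        and upos: "AE x in lborel. 0 \<le> u1 x" "AE x in lborel. 0 \<le> u2 x"
        and vpos: "AE x in lborel. 0 \<le> v1 x" "AE x in lborel. 0 \<le> v2 x"
        and min: "\<And>m1 m2. (m1, m2) \<in> Mset V1 V2 \<Longrightarrow> ?E u1 u2 \<le> ?E m1 m2" "\<And>m1 m2. (m1, m2) \<in> Mset V1 V2 \<Longrightarrow> ?E v1 v2 \<le> ?E m1 m2"
        using U W by (auto simp: nonneg_minimizer_def)
      have uu: "u1 \<in> Hspace V1" "u2 \<in> Hspace V2" "sqn u1 = 1" "sqn u2 = 1"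
        and vv: "v1 \<in> Hspace V1" "v2 \<in> Hspace V2" "sqn v1 = 1" "sqn v2 = 1" using uM vM by (auto simp: Mset_iff)
      have Eeq: "?E v1 v2 = ?E u1 u2" using min(1)[OF vM] min(2)[OF uM] by simp
      note uQ = minimizer_Qf_bound[OF b \<delta>16 U, folded Lam_def] and vQ = minimizer_Qf_bound[OF b \<delta>16 W, folded Lam_def]
      have KL: "Kf V1 u1 \<le> L" "Kf V2 u2 \<le> L" "Kf V1 v1 \<le> L" "Kf V2 v2 \<le> L"
        using uQ(3) vQ(3) uu(3,4) vv(3,4) Qf_nonneg[of V1 u1] Qf_nonneg[of V2 u2] Qf_nonneg[of V1 v1] Qf_nonneg[of V2 v2]
        unfolding Kf_def L_def by linarith+
      let ?d1 = "\<lambda>x. (1/2) * u1 x + (-1/2) * v1 x" and ?d2 = "\<lambda>x. (1/2) * u2 x + (-1/2) * v2 x"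
      have d1: "?d1 = (\<lambda>x. (1/2) * (u1 x - v1 x))" and d2: "?d2 = (\<lambda>x. (1/2) * (u2 x - v2 x))" by auto
      have w1: "(\<lambda>x. u1 x - v1 x) \<in> Hspace V1" and w2: "(\<lambda>x. u2 x - v2 x) \<in> Hspace V2"
        by (intro P1.Hspace_diff P2.Hspace_diff uu vv)+
      have K1: "Kf V1 ?d1 = Kf V1 (\<lambda>x. u1 x - v1 x) / 4" and Q1: "Qf V1 ?d1 = Qf V1 (\<lambda>x. u1 x - v1 x) / 4"
        and s1: "sqn ?d1 = sqn (\<lambda>x. u1 x - v1 x) / 4"
        unfolding d1 P1.Kf_scale[OF w1] P1.Qf_scale[OF w1] sqn_scale by (simp_all add: power2_eq_square)
      have K2: "Kf V2 ?d2 = Kf V2 (\<lambda>x. u2 x - v2 x) / 4" and Q2: "Qf V2 ?d2 = Qf V2 (\<lambda>x. u2 x - v2 x) / 4"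
        and s2: "sqn ?d2 = sqn (\<lambda>x. u2 x - v2 x) / 4"
        unfolding d2 P2.Kf_scale[OF w2] P2.Qf_scale[OF w2] sqn_scale by (simp_all add: power2_eq_square)
      have sh: "sqn ?d1 \<le> 1/2" "sqn ?d2 \<le> 1/2"
        by (rule P1.midpoint_component(3)[OF uu(1) vv(1) uu(3) vv(3) upos(1) vpos(1) refl refl],
            rule P2.midpoint_component(3)[OF uu(2) vv(2) uu(4) vv(4) upos(2) vpos(2) refl refl])
      have frac: "(q * s - Q) / (1 - s) \<le> - (k * K)"
        if "k * K \<le> Q - l * s" "q \<le> l" "0 \<le> s" "s \<le> 1/2" "0 \<le> k * K" for q s Q l k K :: real
      proof -
        have "q * s \<le> l * s" using that by (intro mult_right_mono) auto
        then have "q * s - Q \<le> - (k * K)" using that(1) by linarith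
        also have "\<dots> \<le> - (k * K) * (1 - s)" using mult_nonneg_nonneg[OF that(5,3)] by (simp add: algebra_simps)
        finally show ?thesis using that(4) by (simp add: pos_divide_le_eq)
      qed
      have f1: "((Qf V1 u1 + Qf V1 v1) / 2 * sqn ?d1 - Qf V1 ?d1) / (1 - sqn ?d1) \<le> - (kap1 * Kf V1 ?d1)"
      proof (rule frac[where l="P1.lam + eps1"])
        show "kap1 * Kf V1 ?d1 \<le> Qf V1 ?d1 - (P1.lam + eps1) * sqn ?d1"
          unfolding K1 Q1 s1 using g1(3)[OF uu(1) vv(1) uu(3) vv(3) upos(1) vpos(1)] uQ(1) vQ(1) \<delta>e(1) by simp
        show "(Qf V1 u1 + Qf V1 v1) / 2 \<le> P1.lam + eps1" using uQ(1) vQ(1) \<delta>e(1) by simp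
      qed (use sh g1(2) in auto)
      have f2: "((Qf V2 u2 + Qf V2 v2) / 2 * sqn ?d2 - Qf V2 ?d2) / (1 - sqn ?d2) \<le> - (kap2 * Kf V2 ?d2)"
      proof (rule frac[where l="P2.lam + eps2"])
        show "kap2 * Kf V2 ?d2 \<le> Qf V2 ?d2 - (P2.lam + eps2) * sqn ?d2"
          unfolding K2 Q2 s2 using g2(3)[OF uu(2) vv(2) uu(4) vv(4) upos(2) vpos(2)] uQ(2) vQ(2) \<delta>e(2) by simp
        show "(Qf V2 u2 + Qf V2 v2) / 2 \<le> P2.lam + eps2" using uQ(2) vQ(2) \<delta>e(2) by simp
      qed (use sh g2(2) in auto)
      obtain m1 m2 where m: "(m1, m2) \<in> Mset V1 V2" "?E m1 m2 \<le> (?E u1 u2 + ?E v1 v2) / 2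
        + ((Qf V1 u1 + Qf V1 v1) / 2 * sqn ?d1 - Qf V1 ?d1) / (1 - sqn ?d1)
        + ((Qf V2 u2 + Qf V2 v2) / 2 * sqn ?d2 - Qf V2 ?d2) / (1 - sqn ?d2)
        + 30 * \<delta> * L * (Kf V1 ?d1 + Kf V2 ?d2)"
        using energy_midpoint[OF uu upos vv vpos KL b refl refl] by blast
      have "30 * \<delta> * L * Kf V1 ?d1 \<le> kap1 / 2 * Kf V1 ?d1" "30 * \<delta> * L * Kf V2 ?d2 \<le> kap2 / 2 * Kf V2 ?d2"
        using \<delta>L by (intro mult_right_mono; simp)+
      then have "30 * \<delta> * L * (Kf V1 ?d1 + Kf V2 ?d2) \<le> kap1 * Kf V1 ?d1 / 2 + kap2 * Kf V2 ?d2 / 2"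
        unfolding distrib_left by simp
      then have sum0: "kap1 * Kf V1 ?d1 + kap2 * Kf V2 ?d2 \<le> 0"
        using m(2) f1 f2 min(1)[OF m(1)] unfolding Eeq by simp
      have "0 \<le> kap1 * Kf V1 ?d1" "0 \<le> kap2 * Kf V2 ?d2" using g1(2) g2(2) by auto
      then have "kap1 * Kf V1 ?d1 = 0" "kap2 * Kf V2 ?d2 = 0" using sum0 by linarith+
      then have "Kf V1 (\<lambda>x. u1 x - v1 x) = 0" "Kf V2 (\<lambda>x. u2 x - v2 x) = 0" using g1(2) g2(2) K1 K2 by auto
      then have "sqn (\<lambda>x. u1 x - v1 x) = 0" "sqn (\<lambda>x. u2 x - v2 x) = 0"
        using sqn_nonneg[of "\<lambda>x. u1 x - v1 x"] sqn_nonneg[of "\<lambda>x. u2 x - v2 x"]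
          Qf_nonneg[of V1 "\<lambda>x. u1 x - v1 x"] Qf_nonneg[of V2 "\<lambda>x. u2 x - v2 x"] unfolding Kf_def by linarith+
      then have "AE x in lborel. u1 x - v1 x = 0" "AE x in lborel. u2 x - v2 x = 0"
        using sqn_eq_0 P1.HspaceD(2)[OF w1] P2.HspaceD(2)[OF w2] by blast+
      then have "AE x in lborel. v1 x = u1 x" "AE x in lborel. v2 x = u2 x" by (eventually_elim, simp)+
      then show ?thesis by blast
    qed
    then show ?thesis using U by blast
  qed
  then show ?thesis using \<delta>0 by blast
qed

end

theorem theorem1p4:
  fixes V1 V2 :: "R2 \<Rightarrow> real"
  assumes "Linf_loc V1" and "Linf_loc V2"
    and "filterlim V1 at_top at_infinity" and "filterlim V2 at_top at_infinity"
    and "bdd_below (range V1)" and "(INF x. V1 x) = 0"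
    and "bdd_below (range V2)" and "(INF x. V2 x) = 0"
  shows "\<exists>\<delta>>0. \<forall>b1 b2 \<beta>::real. b1 > 0 \<and> b2 > 0 \<and> \<beta> > 0 \<and> sqrt (b1\<^sup>2 + b2\<^sup>2 + \<beta>\<^sup>2) < \<delta> \<longrightarrow>
     (\<exists>u1 u2. nonneg_minimizer V1 V2 b1 b2 \<beta> u1 u2 \<and>
        (\<forall>v1 v2. nonneg_minimizer V1 V2 b1 b2 \<beta> v1 v2 \<longrightarrow>
           (AE x in lborel. v1 x = u1 x) \<and> (AE x in lborel. v2 x = u2 x)))"
proof -
  interpret two_potentials V1 V2
    using assms by unfold_locales
  obtain \<delta> where \<delta>: "0 < \<delta>" "\<And>b1 b2 \<beta>. 0 < b1 \<Longrightarrow> 0 < b2 \<Longrightarrow> 0 < \<beta> \<Longrightarrow> b1 \<le> \<delta> \<Longrightarrow> b2 \<le> \<delta> \<Longrightarrow> \<beta> \<le> \<delta> \<Longrightarrow>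
     (\<exists>u1 u2. nonneg_minimizer V1 V2 b1 b2 \<beta> u1 u2 \<and>
        (\<forall>v1 v2. nonneg_minimizer V1 V2 b1 b2 \<beta> v1 v2 \<longrightarrow>
           (AE x in lborel. v1 x = u1 x) \<and> (AE x in lborel. v2 x = u2 x)))"
    using unique_minimizer_small_coupling by blast
  have "b1 \<le> \<delta>" "b2 \<le> \<delta>" "\<beta> \<le> \<delta>" if "sqrt (b1\<^sup>2 + b2\<^sup>2 + \<beta>\<^sup>2) < \<delta>" for b1 b2 \<beta> :: real
    using that real_le_rsqrt[of b1 "b1\<^sup>2 + b2\<^sup>2 + \<beta>\<^sup>2"] real_le_rsqrt[of b2 "b1\<^sup>2 + b2\<^sup>2 + \<beta>\<^sup>2"] real_le_rsqrt[of \<beta> "b1\<^sup>2 + b2\<^sup>2 + \<beta>\<^sup>2"]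
    by auto
  then show ?thesis using \<delta> by (intro exI[of _ \<delta>]) blast
qed

end
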